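(* Let $G$ be a finitely generated elementary amenable group. Then the extension problem is solvable for $H\le G$ for all subgroups $H$ of $G$ if and only if there exists a finite index free abelian subgroup $A\le G$ such that the action of $G$ on $A$ by conjugation is defined (i.e. $A$ is normal in $G$) and factors through the action of $\mathbb Z/2\mathbb Z$ on $A$ by inversion; that is, there is a homomorphism $\varepsilon\colon G\to\{1,-1\}$ such that $gag^{-1}=a^{\varepsilon(g)}$ for all $g\in G$ and $a\in A$.
   Context: The class of elementary amenable groups is the smallest class of groups that contains all finite groups and all abelian groups and is closed under taking subgroups, quotients, extensions, and directed unions. The trivial group is regarded as free abelian (of rank $0$). All group actions on metric spaces are by isometries. Let a group $H$ act on metric spaces $(R,d_R)$ and $(S,d_S)$. A map $f\colon R\to S$ is coarsely $H$-equivariant if for every $x\in R$ we have $\sup_{h\in H} d_S(f(hx),hf(x))<\infty$. It is a quasi-isometric embedding if there is a constant $C$ such that $\frac1C d_R(x,y)-C\le d_S(f(x),f(y))\le C d_R(x,y)+C$ for all $x,y\in R$. Let $H\le G$ and let $H$ act on a metric space $R$. An action of $G$ on a (possibly different) metric space $S$ is an extension of the action of $H$ on $R$ if there exists a coarsely $H$-equivariant quasi-isometric embedding $R\to S$. The extension problem is solvable for $H\le G$ if every action of $H$ on a metric space has an extension to an action of $G$ on some metric space. *)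

theory Defs
  imports
    "HOL-Analysis.Abstract_Metric_Spaces"
    "HOL-Algebra.Group_Action"
    "HOL-Algebra.Generated_Groups"
    "HOL-Algebra.Free_Abelian_Groups"
    "HOL-Algebra.Sym_Groups"
begin

section \<open>Classes of groups\<close>

definition finitely_generated :: "('a, 'm) monoid_scheme \<Rightarrow> bool" where
  "finitely_generated G \<longleftrightarrow>
    (\<exists>X. finite X \<and> X \<subseteq> carrier G \<and> generate G X = carrier G)"

text \<open>A free abelian group embeds its basis, so it suffices to look for a basis in the type of
  the group itself. The empty basis gives the trivial group.\<close>

definition free_abelian :: "('a, 'm) monoid_scheme \<Rightarrow> bool" where
  "free_abelian G \<longleftrightarrow> (\<exists>S :: 'a set. G \<cong> free_Abelian_group S)"

text \<open>Quotients are given up to isomorphism as images of surjective homomorphisms, so that all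
  groups stay in one type; in particular the class is closed under isomorphism. Staying in one
  type loses nothing. If \<open>'a\<close> is finite, all groups over it are finite. If \<open>'a\<close> is infinite and a
  group \<open>G\<close> of cardinality at most that of \<open>'a\<close> is constructed from finite and abelian groups via
  larger groups, these can be replaced by sections (quotients of subgroups) of cardinality at most
  that of \<open>'a\<close>: a section of an extension is an extension of sections of the two factors, and a
  section of a directed union is the directed union of sections of the members.\<close>

inductive elementary_amenable :: "'a monoid \<Rightarrow> bool" where
  finite: "\<lbrakk>group G; finite (carrier G)\<rbrakk> \<Longrightarrow> elementary_amenable G"
| abelian: "comm_group G \<Longrightarrow> elementary_amenable G"
| subgroup: "\<lbrakk>elementary_amenable G; subgroup H G\<rbrakk>
    \<Longrightarrow> elementary_amenable (G\<lparr>carrier := H\<rparr>)"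
| quotient: "\<lbrakk>elementary_amenable G; group Q; p \<in> epi G Q\<rbrakk> \<Longrightarrow> elementary_amenable Q"
| extension: "\<lbrakk>group G; group Q; p \<in> epi G Q;
      elementary_amenable (G\<lparr>carrier := kernel G Q p\<rparr>); elementary_amenable Q\<rbrakk>
    \<Longrightarrow> elementary_amenable G"
| directed_union: "\<lbrakk>group G; \<K> \<noteq> {}; \<And>K. K \<in> \<K> \<Longrightarrow> subgroup K G;
      \<And>K L. \<lbrakk>K \<in> \<K>; L \<in> \<K>\<rbrakk> \<Longrightarrow> \<exists>M\<in>\<K>. K \<subseteq> M \<and> L \<subseteq> M;
      carrier G = \<Union>\<K>;
      \<And>K. K \<in> \<K> \<Longrightarrow> elementary_amenable (G\<lparr>carrier := K\<rparr>)\<rbrakk>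
    \<Longrightarrow> elementary_amenable G"


section \<open>Extensions of isometric actions\<close>

definition isometric_action ::
    "('a, 'm) monoid_scheme \<Rightarrow> 's set \<Rightarrow> ('s \<Rightarrow> 's \<Rightarrow> real) \<Rightarrow> ('a \<Rightarrow> 's \<Rightarrow> 's) \<Rightarrow> bool" where
  "isometric_action G S d \<phi> \<longleftrightarrow>
    Metric_space S d \<and> group_action G S \<phi> \<and>
    (\<forall>g\<in>carrier G. \<forall>x\<in>S. \<forall>y\<in>S. d (\<phi> g x) (\<phi> g y) = d x y)"

definition coarsely_equivariant ::
    "'a set \<Rightarrow> 'r set \<Rightarrow> ('a \<Rightarrow> 'r \<Rightarrow> 'r) \<Rightarrow> ('s \<Rightarrow> 's \<Rightarrow> real) \<Rightarrow> ('a \<Rightarrow> 's \<Rightarrow> 's) \<Rightarrow> ('r \<Rightarrow> 's) \<Rightarrow> bool"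
  where
  "coarsely_equivariant H R \<phi> dS \<psi> f \<longleftrightarrow>
    (\<forall>x\<in>R. bdd_above ((\<lambda>h. dS (f (\<phi> h x)) (\<psi> h (f x))) ` H))"

text \<open>Positivity of \<open>C\<close> is implicit in the usual definition; it is needed here since \<open>1 / 0 = 0\<close>.\<close>

definition quasi_isometric_embedding ::
    "'r set \<Rightarrow> ('r \<Rightarrow> 'r \<Rightarrow> real) \<Rightarrow> 's set \<Rightarrow> ('s \<Rightarrow> 's \<Rightarrow> real) \<Rightarrow> ('r \<Rightarrow> 's) \<Rightarrow> bool" where
  "quasi_isometric_embedding R dR S dS f \<longleftrightarrow>
    f \<in> R \<rightarrow> S \<and>
    (\<exists>C>0. \<forall>x\<in>R. \<forall>y\<in>R.
       1 / C * dR x y - C \<le> dS (f x) (f y) \<and> dS (f x) (f y) \<le> C * dR x y + C)"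

text \<open>The action \<open>\<psi>\<close> of \<open>G\<close> on \<open>S\<close> is an extension of the action \<open>\<phi>\<close> of \<open>H\<close> on \<open>R\<close>.\<close>

definition extends_action ::
    "('a, 'm) monoid_scheme \<Rightarrow> 'a set \<Rightarrow> 'r set \<Rightarrow> ('r \<Rightarrow> 'r \<Rightarrow> real) \<Rightarrow> ('a \<Rightarrow> 'r \<Rightarrow> 'r)
      \<Rightarrow> 's set \<Rightarrow> ('s \<Rightarrow> 's \<Rightarrow> real) \<Rightarrow> ('a \<Rightarrow> 's \<Rightarrow> 's) \<Rightarrow> bool" where
  "extends_action G H R dR \<phi> S dS \<psi> \<longleftrightarrow>
    isometric_action G S dS \<psi> \<and>
    (\<exists>f. coarsely_equivariant H R \<phi> dS \<psi> f \<and> quasi_isometric_embedding R dR S dS f)"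

text \<open>HOL cannot quantify over types inside a formula, so the type \<open>'r\<close> of the points of \<open>R\<close> is a
  parameter; a statement in which \<open>'r\<close> is a schematic type variable covers spaces over all types.
  Note that over a finite \<open>'r\<close> every space is bounded and the problem is trivially solvable, so
  \<open>'r\<close> should be infinite. The space \<open>S\<close> is sought in \<open>'a \<times> 'r\<close>, which is no restriction: given an extension on a
  space in any type, the union of the \<open>G\<close>-orbits of the points of the image of \<open>R\<close> is again an
  extension and is an image of \<open>carrier G \<times> R\<close>. This is the lemma \<open>extends_action_retype\<close> below.\<close>

definition extension_problem_solvable ::
    "'r itself \<Rightarrow> ('a, 'm) monoid_scheme \<Rightarrow> 'a set \<Rightarrow> bool" where
  "extension_problem_solvable (_ :: 'r itself) G H \<longleftrightarrow>
    (\<forall>(R :: 'r set) dR \<phi>. isometric_action (G\<lparr>carrier := H\<rparr>) R dR \<phi> \<longrightarrow>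
       (\<exists>(S :: ('a \<times> 'r) set) dS \<psi>. extends_action G H R dR \<phi> S dS \<psi>))"

lemma extends_action_retype:
  fixes G :: "('a, 'm) monoid_scheme" and R :: "'r set" and S :: "'s set"
  assumes H: "subgroup H G"
    and R: "isometric_action (G\<lparr>carrier := H\<rparr>) R dR \<phi>"
    and S: "extends_action G H R dR \<phi> S dS \<psi>"
  shows "\<exists>(S' :: ('a \<times> 'r) set) dS' \<psi>'. extends_action G H R dR \<phi> S' dS' \<psi>'"
proof -
  have iso: "isometric_action G S dS \<psi>" using S by (simp add: extends_action_def)
  then have M: "Metric_space S dS" and act: "group_action G S \<psi>"
    and isom: "\<And>g x y. \<lbrakk>g \<in> carrier G; x \<in> S; y \<in> S\<rbrakk> \<Longrightarrow> dS (\<psi> g x) (\<psi> g y) = dS x y"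
    by (auto simp: isometric_action_def)
  interpret group_action G S \<psi> by (rule act)
  interpret G: group G using group_hom by (simp add: group_hom_def)
  obtain f C where ce: "coarsely_equivariant H R \<phi> dS \<psi> f" and fS: "f \<in> R \<rightarrow> S" and C: "C > 0"
    and qi: "\<And>x y. \<lbrakk>x \<in> R; y \<in> R\<rbrakk> \<Longrightarrow>
       1 / C * dR x y - C \<le> dS (f x) (f y) \<and> dS (f x) (f y) \<le> C * dR x y + C"
    using S unfolding extends_action_def quasi_isometric_embedding_def by metis
  have actS: "\<psi> g s \<in> S" if "g \<in> carrier G" "s \<in> S" for g s
    using element_image that by blast
  have act1: "\<psi> \<one>\<^bsub>G\<^esub> s = s" if "s \<in> S" for s
    using id_eq_one that by (metis restrict_apply')
  have actm: "\<psi> (g \<otimes>\<^bsub>G\<^esub> h) s = \<psi> g (\<psi> h s)" if "g \<in> carrier G" "h \<in> carrier G" "s \<in> S" for g h s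
    using composition_rule that by blast
  define q where "q = (\<lambda>u. \<psi> (fst u) (f (snd u)))"
  define T where "T = q ` (carrier G \<times> R)"
  define p where "p = inv_into (carrier G \<times> R) q"
  define S' where "S' = p ` T"
  define \<psi>' where "\<psi>' = (\<lambda>g. \<lambda>u\<in>S'. p (\<psi> g (q u)))"
  have qp: "q (p t) = t" if "t \<in> T" for t
    using that unfolding p_def T_def by (rule f_inv_into_f)
  have pS: "p t \<in> S'" if "t \<in> T" for t using that by (simp add: S'_def)
  have qT: "q u \<in> T" if "u \<in> S'" for u using that qp by (auto simp: S'_def)
  have pq: "p (q u) = u" if "u \<in> S'" for u using that qp by (auto simp: S'_def)
  have fS': "f x \<in> S" if "x \<in> R" for x using fS that by blast
  have TS: "T \<subseteq> S" using fS' actS by (auto simp: T_def q_def)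
  have Tact: "\<psi> g t \<in> T" if g: "g \<in> carrier G" and t: "t \<in> T" for g t
  proof -
    obtain k x where "k \<in> carrier G" "x \<in> R" "t = \<psi> k (f x)" using t by (auto simp: T_def q_def)
    then have "\<psi> g t = q (g \<otimes>\<^bsub>G\<^esub> k, x)" "(g \<otimes>\<^bsub>G\<^esub> k, x) \<in> carrier G \<times> R"
      using g fS' by (auto simp: q_def actm)
    then show ?thesis unfolding T_def by blast
  qed
  have fT: "f x \<in> T" if "x \<in> R" for x
  proof -
    have "f x = q (\<one>\<^bsub>G\<^esub>, x)" using that fS' by (auto simp: q_def act1)
    then show ?thesis using that unfolding T_def by blast
  qed
  have q\<psi>: "q (\<psi>' g u) = \<psi> g (q u)" if "g \<in> carrier G" "u \<in> S'" for g u
    using that qp Tact qT by (simp add: \<psi>'_def)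
  have \<psi>S: "\<psi>' g u \<in> S'" if "g \<in> carrier G" "u \<in> S'" for g u
    using that pS Tact qT by (simp add: \<psi>'_def)
  have \<psi>m: "\<psi>' (g \<otimes>\<^bsub>G\<^esub> h) u = \<psi>' g (\<psi>' h u)" if "g \<in> carrier G" "h \<in> carrier G" "u \<in> S'" for g h u
  proof -
    have "q (\<psi>' (g \<otimes>\<^bsub>G\<^esub> h) u) = q (\<psi>' g (\<psi>' h u))"
      using that q\<psi> \<psi>S actm qT TS by (metis G.m_closed subsetD)
    then show ?thesis using pq that \<psi>S by (metis G.m_closed)
  qed
  have \<psi>1: "\<psi>' \<one>\<^bsub>G\<^esub> u = u" if "u \<in> S'" for u
    using that act1 subsetD[OF TS qT] pq by (simp add: \<psi>'_def)
  have bij: "\<psi>' g \<in> Bij S'" if g: "g \<in> carrier G" for g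
  proof -
    have "bij_betw (\<psi>' g) S' S'"
      using g \<psi>S \<psi>m[of "inv\<^bsub>G\<^esub> g" g] \<psi>m[of g "inv\<^bsub>G\<^esub> g"] \<psi>1
      by (intro bij_betw_byWitness[where f' = "\<psi>' (inv\<^bsub>G\<^esub> g)"]) auto
    then show ?thesis by (simp add: Bij_def \<psi>'_def)
  qed
  have "group_action G S' \<psi>'"
  proof -
    have "\<psi>' (g \<otimes>\<^bsub>G\<^esub> h) = compose S' (\<psi>' g) (\<psi>' h)" if "g \<in> carrier G" "h \<in> carrier G" for g h
    proof (rule extensionalityI)
      show "\<psi>' (g \<otimes>\<^bsub>G\<^esub> h) \<in> extensional S'" by (simp add: \<psi>'_def)
    qed (use that \<psi>m in \<open>auto simp: compose_def\<close>)
    then have "\<psi>' \<in> hom G (BijGroup S')"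
      using bij by (auto simp: hom_def BijGroup_def)
    then show ?thesis
      by (simp add: group_action_def group_hom_def group_hom_axioms_def group_BijGroup)
  qed
  moreover have "Metric_space S' (\<lambda>u v. dS (q u) (q v))"
  proof
    fix u v assume "u \<in> S'" "v \<in> S'"
    then show "dS (q u) (q v) = 0 \<longleftrightarrow> u = v"
      using Metric_space.zero[OF M, of "q u" "q v"] qT TS pq by (metis subsetD)
  next
    fix u v w assume "u \<in> S'" "v \<in> S'" "w \<in> S'"
    then show "dS (q u) (q w) \<le> dS (q u) (q v) + dS (q v) (q w)"
      using Metric_space.triangle[OF M] qT TS by (meson subsetD)
  qed (simp_all add: Metric_space.nonneg[OF M] Metric_space.commute[OF M])
  ultimately have "isometric_action G S' (\<lambda>u v. dS (q u) (q v)) \<psi>'"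
    using isom subsetD[OF TS qT] q\<psi> by (simp add: isometric_action_def)
  moreover have "coarsely_equivariant H R \<phi> (\<lambda>u v. dS (q u) (q v)) \<psi>' (p \<circ> f)"
    unfolding coarsely_equivariant_def
  proof
    fix x assume x: "x \<in> R"
    have "\<phi> h x \<in> R" if "h \<in> H" for h
      using group_action.element_image[of "G\<lparr>carrier := H\<rparr>" R \<phi> h x] R that x
      by (auto simp: isometric_action_def)
    then have "q ((p \<circ> f) (\<phi> h x)) = f (\<phi> h x)" "q (\<psi>' h ((p \<circ> f) x)) = \<psi> h (f x)" if "h \<in> H" for h
      using that x qp fT q\<psi> pS subgroup.mem_carrier[OF H] by auto
    then have "(\<lambda>h. dS (q ((p \<circ> f) (\<phi> h x))) (q (\<psi>' h ((p \<circ> f) x)))) ` H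
        = (\<lambda>h. dS (f (\<phi> h x)) (\<psi> h (f x))) ` H"
      by (intro image_cong) auto
    then show "bdd_above ((\<lambda>h. dS (q ((p \<circ> f) (\<phi> h x))) (q (\<psi>' h ((p \<circ> f) x)))) ` H)"
      using ce x by (simp add: coarsely_equivariant_def)
  qed
  moreover have "quasi_isometric_embedding R dR S' (\<lambda>u v. dS (q u) (q v)) (p \<circ> f)"
    unfolding quasi_isometric_embedding_def using C qi fT pS qp by (intro conjI exI[of _ C]) auto
  ultimately show ?thesis unfolding extends_action_def by blast
qed

end

theory Submission
  imports Defs "HOL-Algebra.Multiplicative_Group" "HOL-Algebra.Weak_Morphisms"
    "HOL-Real_Asymp.Real_Asymp"
begin

text \<open>An action of \<open>H\<close> with a base point gives a length function on \<open>H\<close>. If the extension problem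
  is solvable for every \<open>H\<close>, then every length function on \<open>H\<close> is, up to affine bounds, the
  restriction of a length function on \<open>G\<close>. For finitely generated \<open>G\<close> this makes every subgroup
  finitely generated (otherwise an ultrametric length along a chain of subgroups grows too fast)
  and every infinite cyclic subgroup undistorted; and if \<open>B\<close> is an abelian normal
  subgroup, then for \<open>b \<in> B\<close> the word length of \<open>B\<close> modulo \<open>\<langle>b\<rangle>\<close> is bounded on each conjugate
  of \<open>\<langle>b\<rangle>\<close>, so that some power of a conjugate of \<open>b\<close> lies in \<open>\<langle>b\<rangle>\<close> and is in fact
  \<open>b\<^sup>\<plusminus>\<^sup>n\<close>. These properties pass to subgroups and quotients, and they imply that the class of
  groups whose FC-centre has finite index is closed under extensions. Induction over
  elementary amenable groups, with all sections at once, shows that the FC-centre of \<open>G\<close> has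
  finite index; its centre contains the required free abelian subgroup.

  Conversely, let \<open>H\<close> act on \<open>R\<close>. It suffices to extend the action of \<open>J = A \<inter> H\<close>, which has finite
  index in \<open>H\<close>. Choose \<open>B \<le> A\<close> with \<open>B \<inter> J\<close> trivial and \<open>K = J B\<close> of finite index in \<open>A\<close>, and
  let \<open>K\<close> act on \<open>R\<close> through the projection to \<open>J\<close>. The group \<open>G\<close> acts on finitely many copies
  of \<open>R\<close> indexed by the cosets of \<open>K\<close>, glued along the orbit of a base point; as conjugation
  inverts or fixes \<open>K\<close>, the glueing creates no shortcuts.\<close>

section \<open>Length functions\<close>

text \<open>Three phenomena must be excluded: a conjugate of \<open>b\<close> with no power in
  \<open>\<langle>b\<rangle>\<close>, as for a swap of coordinates; a conjugation that stretches
  exponents, as in Baumslag-Solitar groups; and a central commutator of infinite order, as in the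
  Heisenberg group. The last two distort a cyclic subgroup exponentially or quadratically, although
  its exponent is a length that must extend. The groups occurring in a derivation of elementary
  amenability need not share any property of \<open>G\<close>, so the induction makes assumptions
  only on their sections. In the converse, inversion preserves distances inside one orbit of an
  abelian group, since an inverse moves a point as far as the element itself, but it need not come
  from an isometry of \<open>R\<close>; hence the glueing happens along an orbit only. Coset
  representatives are not multiplicative, but their defect takes finitely many values and displaces
  the base point boundedly. The glued metric is therefore almost invariant, and a supremum over
  \<open>G\<close> makes it invariant at the cost of a bounded error.\<close>

definition length_on :: "('a, 'm) monoid_scheme \<Rightarrow> 'a set \<Rightarrow> ('a \<Rightarrow> real) \<Rightarrow> bool" where
  "length_on G H L \<longleftrightarrow> L \<one>\<^bsub>G\<^esub> = 0 \<and> (\<forall>g\<in>H. 0 \<le> L g \<and> L (inv\<^bsub>G\<^esub> g) = L g) \<and>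
     (\<forall>g\<in>H. \<forall>h\<in>H. L (g \<otimes>\<^bsub>G\<^esub> h) \<le> L g + L h)"

text \<open>Actions no longer occur here: the property is intrinsic to \<open>G\<close>, which lets
  it pass to subgroups and quotients. The affine comparison is what remains of quasi-isometric
  embeddings and coarse equivariance. Lengths may vanish on nontrivial elements, as the word length
  modulo a subgroup does.\<close>

definition lengths_extend :: "('a, 'm) monoid_scheme \<Rightarrow> bool" where
  "lengths_extend G \<longleftrightarrow> (\<forall>H L. subgroup H G \<longrightarrow> length_on G H L \<longrightarrow>
     (\<exists>M C. length_on G (carrier G) M \<and> C > 0 \<and>
        (\<forall>h\<in>H. L h \<le> C * M h + C \<and> M h \<le> C * L h + C)))"

definition noetherian_group :: "('a, 'm) monoid_scheme \<Rightarrow> bool" where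
  "noetherian_group G \<longleftrightarrow>
    (\<forall>H. subgroup H G \<longrightarrow> (\<exists>X. finite X \<and> X \<subseteq> H \<and> generate G X = H))"

primrec word_ball :: "('a, 'm) monoid_scheme \<Rightarrow> 'a set \<Rightarrow> nat \<Rightarrow> 'a set" where
  "word_ball G X 0 = {\<one>\<^bsub>G\<^esub>}"
| "word_ball G X (Suc n) = word_ball G X n <#>\<^bsub>G\<^esub> (insert \<one>\<^bsub>G\<^esub> (X \<union> m_inv G ` X))"

lemma lengths_extendE:
  assumes "lengths_extend G" "subgroup H G" "length_on G H L"
  obtains M C where "length_on G (carrier G) M" "C > 0"
    "\<And>h. h \<in> H \<Longrightarrow> L h \<le> C * M h + C" "\<And>h. h \<in> H \<Longrightarrow> M h \<le> C * L h + C"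
  using assms unfolding lengths_extend_def by metis

lemma length_onD:
  assumes "length_on G H L"
  shows "L \<one>\<^bsub>G\<^esub> = 0" "\<And>g. g \<in> H \<Longrightarrow> 0 \<le> L g" "\<And>g. g \<in> H \<Longrightarrow> L (inv\<^bsub>G\<^esub> g) = L g"
    "\<And>g h. g \<in> H \<Longrightarrow> h \<in> H \<Longrightarrow> L (g \<otimes>\<^bsub>G\<^esub> h) \<le> L g + L h"
  using assms by (auto simp: length_on_def)

lemma length_on_mono: "length_on G K L \<Longrightarrow> H \<subseteq> K \<Longrightarrow> length_on G H L"
  unfolding length_on_def by blast

context group
begin

lemma length_on_nat_pow:
  assumes "length_on G (carrier G) M" "g \<in> carrier G"
  shows "M (g [^] (n::nat)) \<le> real n * M g"
proof (induction n)
  case (Suc n)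
  have "M (g [^] Suc n) \<le> M (g [^] n) + M g"
    using length_onD(4)[OF assms(1), of "g [^] n" g] assms(2) by simp
  then show ?case using Suc by (simp add: algebra_simps)
qed (use length_onD(1)[OF assms(1)] in simp)

lemma length_on_conj:
  assumes M: "length_on G (carrier G) M" and "g \<in> carrier G" "x \<in> carrier G"
  shows "M (g \<otimes> x \<otimes> inv g) \<le> M x + 2 * M g"
  using length_onD(4)[OF M, of "g \<otimes> x" "inv g"] length_onD(4)[OF M, of g x]
    length_onD(3)[OF M, of g] assms by simp

text \<open>Any filtration compatible with products and inverses is measured by the least index. The
  sets \<open>W n\<close> need not increase with \<open>n\<close>. The two filtrations used later
  are word balls modulo a cyclic subgroup and bounded exponents in a cyclic group.\<close>

lemma length_on_filtration:
  assumes "subgroup H G" and ex: "\<And>h. h \<in> H \<Longrightarrow> \<exists>n. h \<in> W n" and one: "\<one> \<in> W 0"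
    and inv: "\<And>n h. h \<in> H \<Longrightarrow> h \<in> W n \<Longrightarrow> inv h \<in> W n"
    and mult: "\<And>m n g h. g \<in> H \<Longrightarrow> h \<in> H \<Longrightarrow> g \<in> W m \<Longrightarrow> h \<in> W n \<Longrightarrow> g \<otimes> h \<in> W (m + n)"
  shows "length_on G H (\<lambda>h. real (LEAST n. h \<in> W n))"
  unfolding length_on_def
proof (intro conjI ballI)
  interpret H: subgroup H G by fact
  have L: "h \<in> W (LEAST n. h \<in> W n)" if "h \<in> H" for h
    using ex[OF that] by (rule LeastI_ex)
  fix g assume g: "g \<in> H"
  have "(LEAST n. inv h \<in> W n) \<le> (LEAST n. h \<in> W n)" if "h \<in> H" for h
    by (intro Least_le inv L that)
  from this[of g] this[of "inv g"] show "real (LEAST n. inv g \<in> W n) = real (LEAST n. g \<in> W n)"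
    using g by simp
  fix h assume h: "h \<in> H"
  have "(LEAST n. g \<otimes> h \<in> W n) \<le> (LEAST n. g \<in> W n) + (LEAST n. h \<in> W n)"
    by (intro Least_le mult L g h)
  then show "real (LEAST n. g \<otimes> h \<in> W n) \<le> real (LEAST n. g \<in> W n) + real (LEAST n. h \<in> W n)"
    by linarith
next
  show "real (LEAST n. \<one> \<in> W n) = 0" using one by (simp add: Least_eq_0)
qed auto

lemma word_ball_incl: "X \<subseteq> carrier G \<Longrightarrow> word_ball G X n \<subseteq> carrier G"
  by (induction n) (auto simp: set_mult_def)

lemma finite_word_ball: "finite X \<Longrightarrow> finite (word_ball G X n)"
proof (induction n)
  case (Suc n)
  then have "finite ((\<lambda>(x, y). x \<otimes> y) ` (word_ball G X n \<times> insert \<one> (X \<union> m_inv G ` X)))"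
    by blast
  moreover have "word_ball G X (Suc n)
      = (\<lambda>(x, y). x \<otimes> y) ` (word_ball G X n \<times> insert \<one> (X \<union> m_inv G ` X))"
    by (auto simp: set_mult_def)
  ultimately show ?case by simp
qed simp

lemma word_ball_mult:
  assumes X: "X \<subseteq> carrier G" and g: "g \<in> word_ball G X m"
  shows "h \<in> word_ball G X n \<Longrightarrow> g \<otimes> h \<in> word_ball G X (m + n)"
proof (induction n arbitrary: h)
  case 0
  moreover have "g \<in> carrier G" using g word_ball_incl[OF X] by blast
  ultimately show ?case using g by simp
next
  case (Suc n)
  then obtain h' y where h': "h' \<in> word_ball G X n" and y: "y \<in> insert \<one> (X \<union> m_inv G ` X)"
    and h: "h = h' \<otimes> y" by (auto simp: set_mult_def)
  have "y \<in> carrier G" using y X by auto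
  then have "g \<otimes> h = (g \<otimes> h') \<otimes> y"
    using g h' h word_ball_incl[OF X] by (simp add: m_assoc subset_eq)
  then show ?case using Suc.IH[OF h'] y by (auto simp: set_mult_def)
qed

lemma word_ball_1:
  assumes X: "X \<subseteq> carrier G" shows "word_ball G X 1 = insert \<one> (X \<union> m_inv G ` X)"
  using X by (force simp: set_mult_def)

lemma word_ball_inv:
  assumes X: "X \<subseteq> carrier G"
  shows "h \<in> word_ball G X n \<Longrightarrow> inv h \<in> word_ball G X n"
proof (induction n arbitrary: h)
  case (Suc n)
  then obtain h' y where h': "h' \<in> word_ball G X n" and y: "y \<in> insert \<one> (X \<union> m_inv G ` X)"
    and h: "h = h' \<otimes> y" by (auto simp: set_mult_def)
  have yc: "y \<in> carrier G" using y X by auto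
  have "inv y \<in> insert \<one> (X \<union> m_inv G ` X)" using y X by auto
  then have "inv y \<in> word_ball G X 1" unfolding word_ball_1[OF X] .
  then have "inv y \<otimes> inv h' \<in> word_ball G X (1 + n)"
    by (rule word_ball_mult[OF X _ Suc.IH[OF h']])
  moreover have "h' \<in> carrier G" using h' word_ball_incl[OF X] by blast
  ultimately show ?case using h yc by (simp only: inv_mult_group plus_1_eq_Suc)
qed simp

lemma word_ball_mono: "X \<subseteq> carrier G \<Longrightarrow> m \<le> n \<Longrightarrow> word_ball G X m \<subseteq> word_ball G X n"
proof (induction n)
  case (Suc n)
  have "word_ball G X n \<subseteq> word_ball G X (Suc n)"
  proof
    fix x assume "x \<in> word_ball G X n"
    moreover have "x \<in> carrier G" using calculation word_ball_incl[OF Suc.prems(1)] by blast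
    then have "x = x \<otimes> \<one>" by simp
    ultimately show "x \<in> word_ball G X (Suc n)" unfolding word_ball.simps set_mult_def by blast
  qed
  then show ?case using Suc le_Suc_eq by (metis order_trans order_refl)
qed simp

lemma generate_eq_Union_word_ball:
  assumes X: "X \<subseteq> carrier G" shows "generate G X = (\<Union>n. word_ball G X n)"
proof
  show "generate G X \<subseteq> (\<Union>n. word_ball G X n)"
  proof
    fix h assume "h \<in> generate G X"
    then show "h \<in> (\<Union>n. word_ball G X n)"
    proof induction
      case one
      have "\<one> \<in> word_ball G X 0" by simp
      then show ?case by blast
    next
      case (incl h)
      then have "h \<in> word_ball G X 1" using word_ball_1[OF X] by simp
      then show ?case by blast
    next
      case (inv h)
      then have "inv h \<in> word_ball G X 1" using word_ball_1[OF X] by simp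
      then show ?case by blast
    next
      case (eng h1 h2)
      then show ?case using word_ball_mult[OF X] by blast
    qed
  qed
  have "word_ball G X n \<subseteq> generate G X" for n
  proof (induction n)
    case (Suc n)
    have "insert \<one> (X \<union> m_inv G ` X) \<subseteq> generate G X"
      by (auto intro: generate.intros)
    then show ?case using Suc by (auto simp: set_mult_def intro!: generate.eng)
  qed (auto intro: generate.one)
  then show "(\<Union>n. word_ball G X n) \<subseteq> generate G X" by blast
qed

lemma countable_generate:
  assumes "finite X" "X \<subseteq> carrier G" shows "countable (generate G X)"
  unfolding generate_eq_Union_word_ball[OF assms(2)]
  by (auto intro: countable_finite finite_word_ball assms)

text \<open>The slope is the largest value on the generators. This linear growth is the upper bound
  that even an unknown extension of a length has to obey.\<close>

lemma length_on_le_word_ball: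
  assumes M: "length_on G (carrier G) M" and fin: "finite X" and X: "X \<subseteq> carrier G"
  shows "\<exists>c\<ge>0. \<forall>n. \<forall>g\<in>word_ball G X n. M g \<le> c * real n"
proof -
  define Y where "Y = insert \<one> (X \<union> m_inv G ` X)"
  have Y: "finite Y" "Y \<subseteq> carrier G" "Y \<noteq> {}" using fin X by (auto simp: Y_def)
  define c where "c = Max (M ` Y)"
  have c: "M y \<le> c" if "y \<in> Y" for y unfolding c_def using Y that by (intro Max_ge) auto
  have "0 \<le> c" using c[of \<one>] length_onD(1)[OF M] by (simp add: Y_def)
  moreover have "\<forall>g\<in>word_ball G X n. M g \<le> c * real n" for n
  proof (induction n)
    case 0 then show ?case using length_onD(1)[OF M] by simp
  next
    case (Suc n)
    show ?case
    proof
      fix g assume "g \<in> word_ball G X (Suc n)"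
      then obtain h y where h: "h \<in> word_ball G X n" and y: "y \<in> Y" and g: "g = h \<otimes> y"
        by (auto simp: set_mult_def Y_def)
      have "M g \<le> M h + M y"
        unfolding g using h y Y word_ball_incl[OF X] by (intro length_onD(4)[OF M]) auto
      then show "M g \<le> c * real (Suc n)" using Suc h c[OF y] by (force simp: algebra_simps)
    qed
  qed
  ultimately show ?thesis by blast
qed

text \<open>For a subgroup \<open>H\<close> that is not finitely generated, an enumeration gives a
  chain of finitely generated proper subgroups \<open>F i\<close> exhausting \<open>H\<close>.
  Weighting the first stage at which an element appears gives an ultrametric, hence subadditive,
  length with freely chosen growth, which can outrun the linear bound on any extension.\<close>

lemma noetherian_groupI:
  assumes fg: "finitely_generated G" and ext: "lengths_extend G"
  shows "noetherian_group G"
  unfolding noetherian_group_def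
proof (intro allI impI, rule ccontr)
  obtain X where X: "finite X" "X \<subseteq> carrier G" "generate G X = carrier G"
    using fg unfolding finitely_generated_def by blast
  fix H assume H: "subgroup H G"
    and nfg: "\<not> (\<exists>X. finite X \<and> X \<subseteq> H \<and> generate G X = H)"
  interpret H: subgroup H G by (rule H)
  have "countable H"
    using countable_generate[OF X(1,2)] X(3) H.subset by (metis countable_subset)
  then obtain e :: "nat \<Rightarrow> 'a" where e: "range e = H"
    using H.one_closed by (metis empty_iff range_from_nat_into)
  define F where "F i = generate G (e ` {..<i})" for i
  have eH: "e ` S \<subseteq> H" for S using e by blast
  have Fsub: "subgroup (F i) G" for i
    unfolding F_def using eH H.subset by (intro generate_is_subgroup) blast
  have FH: "F i \<subseteq> H" for i unfolding F_def by (rule generate_subgroup_incl[OF eH H])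
  have mono: "F i \<subseteq> F j" if "i \<le> j" for i j
    unfolding F_def using that by (intro mono_generate image_mono) auto
  have "\<exists>k. k \<in> H \<and> k \<notin> F i" for i
    using nfg eH FH[of i] unfolding F_def by (metis finite_imageI finite_lessThan subset_antisym subsetI)
  then obtain k where k: "\<And>i. k i \<in> H" "\<And>i. k i \<notin> F i" by metis
  define l where "l g = (LEAST n. g \<in> word_ball G X n)" for g
  have l: "g \<in> word_ball G X (l g)" if "g \<in> carrier G" for g
    using that X(3) generate_eq_Union_word_ball[OF X(2)] unfolding l_def by (metis LeastI_ex UN_E)
  \<comment> \<open>\<open>k j\<close> first appears after stage \<open>j\<close>, so its length is
    at least \<open>w (Suc j)\<close>, whose last summand is \<open>Suc j\<close> times the
    successor of its word length. The factor \<open>Suc j\<close> exceeds every constant, and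
    \<open>Suc\<close> on the word length absorbs the additive error.\<close>
  define w where "w i = (\<Sum>j<i. Suc j * Suc (l (k j)))" for i
  have w_mono: "w i \<le> w j" if "i \<le> j" for i j
    unfolding w_def using that by (intro sum_mono2) auto
  define r where "r h = (LEAST i. h \<in> F i)" for h
  have rex: "\<exists>i. h \<in> F i" if "h \<in> H" for h
  proof -
    obtain i where "h = e i" using \<open>h \<in> H\<close> e by blast
    then have "h \<in> F (Suc i)" unfolding F_def by (auto intro: generate.incl)
    then show ?thesis by blast
  qed
  have rF: "h \<in> F (r h)" if "h \<in> H" for h unfolding r_def using rex[OF that] by (rule LeastI_ex)
  have rle: "r h \<le> i" if "h \<in> F i" for h i unfolding r_def using that by (rule Least_le)
  have L: "length_on G H (\<lambda>h. real (w (r h)))"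
    unfolding length_on_def
  proof (intro conjI ballI)
    have "\<one> \<in> F 0" using Fsub subgroup.one_closed by blast
    from rle[OF this] show "real (w (r \<one>)) = 0" by (simp add: w_def)
    fix g assume g: "g \<in> H"
    have "r (inv h) \<le> r h" if "h \<in> H" for h
      using rle rF[OF that] subgroup.m_inv_closed[OF Fsub] by blast
    from this[of g] this[of "inv g"] g show "real (w (r (inv g))) = real (w (r g))" by simp
    fix h assume h: "h \<in> H"
    have "g \<in> F (max (r g) (r h))" "h \<in> F (max (r g) (r h))"
      using rF[OF g] rF[OF h] mono by (meson max.cobounded1 max.cobounded2 subsetD)+
    then have "r (g \<otimes> h) \<le> max (r g) (r h)" by (intro rle subgroup.m_closed[OF Fsub])
    then have "w (r (g \<otimes> h)) \<le> w (r g) + w (r h)"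
      using w_mono by (metis max_def le_add1 le_add2 order_trans)
    then show "real (w (r (g \<otimes> h))) \<le> real (w (r g)) + real (w (r h))" by linarith
  qed auto
  obtain M C where M: "length_on G (carrier G) M" and C: "C > 0"
    and LM: "\<And>h. h \<in> H \<Longrightarrow> real (w (r h)) \<le> C * M h + C"
    using lengths_extendE[OF ext H L] by metis
  obtain c where c: "c \<ge> 0" "\<And>n g. g \<in> word_ball G X n \<Longrightarrow> M g \<le> c * real n"
    using length_on_le_word_ball[OF M X(1,2)] by blast
  have "real (Suc j) \<le> C * c + C" for j
  proof -
    have "Suc j \<le> r (k j)" using k(2)[of j] rF[OF k(1)] mono by (metis not_less_eq_eq subsetD)
    then have "w (Suc j) \<le> w (r (k j))" by (rule w_mono)
    moreover have "Suc j * Suc (l (k j)) \<le> w (Suc j)" unfolding w_def by simp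
    ultimately have "real (Suc j * Suc (l (k j))) \<le> real (w (r (k j)))" by linarith
    also have "\<dots> \<le> C * (c * real (l (k j))) + C"
      using LM[OF k(1)[of j]] c(2)[OF l[of "k j"]] k(1) C
      by (smt (verit) H.mem_carrier mult_left_mono)
    also have "\<dots> \<le> (C * c + C) * real (Suc (l (k j)))"
      using C c(1) by (simp add: algebra_simps)
    finally have "real (Suc j) * real (Suc (l (k j))) \<le> (C * c + C) * real (Suc (l (k j)))"
      by (simp only: of_nat_mult)
    then show ?thesis by (rule mult_right_le_imp_le) simp
  qed
  then show False using reals_Archimedean2[of "C * c + C"]
    by (metis Suc_n_not_le_n linorder_not_less nat_le_linear of_nat_le_iff order_le_less_trans)
qed

section \<open>Heredity of both properties under subgroups and quotients\<close>

lemma noetherian_subgroup: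
  assumes "noetherian_group G" and K: "subgroup K G"
  shows "noetherian_group (G\<lparr>carrier := K\<rparr>)"
  unfolding noetherian_group_def
proof (intro allI impI)
  fix H assume H: "subgroup H (G\<lparr>carrier := K\<rparr>)"
  then have HG: "subgroup H G" and HK: "H \<subseteq> K"
    using incl_subgroup[OF K] subgroup.subset by force+
  obtain X where "finite X" "X \<subseteq> H" "generate G X = H"
    using assms(1) HG unfolding noetherian_group_def by blast
  then show "\<exists>X. finite X \<and> X \<subseteq> H \<and> generate (G\<lparr>carrier := K\<rparr>) X = H"
    using generate_consistent[OF _ K, of X] HK by (metis order_trans)
qed

lemma lengths_extend_subgroup:
  assumes ext: "lengths_extend G" and K: "subgroup K G"
  shows "lengths_extend (G\<lparr>carrier := K\<rparr>)"
  unfolding lengths_extend_def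
proof (intro allI impI)
  fix H L assume H: "subgroup H (G\<lparr>carrier := K\<rparr>)" and L: "length_on (G\<lparr>carrier := K\<rparr>) H L"
  then have HG: "subgroup H G" and HK: "H \<subseteq> K"
    using incl_subgroup[OF K] subgroup.subset by force+
  have iff: "length_on (G\<lparr>carrier := K\<rparr>) J N \<longleftrightarrow> length_on G J N" if "J \<subseteq> K" for J N
    unfolding length_on_def using m_inv_consistent[OF K] that by (simp add: subset_eq)
  obtain M C where M: "length_on G (carrier G) M" "C > 0"
    "\<And>h. h \<in> H \<Longrightarrow> L h \<le> C * M h + C" "\<And>h. h \<in> H \<Longrightarrow> M h \<le> C * L h + C"
    using lengths_extendE[OF ext HG] L iff[OF HK] by metis
  moreover have "length_on (G\<lparr>carrier := K\<rparr>) (carrier (G\<lparr>carrier := K\<rparr>)) M"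
    using iff length_on_mono[OF M(1) subgroup.subset[OF K]] by simp
  ultimately show "\<exists>M C. length_on (G\<lparr>carrier := K\<rparr>) (carrier (G\<lparr>carrier := K\<rparr>)) M \<and> C > 0 \<and>
      (\<forall>h\<in>H. L h \<le> C * M h + C \<and> M h \<le> C * L h + C)" by blast
qed

end

lemma (in group_hom) vimage_subgroup:
  assumes K: "subgroup K H" shows "subgroup {g \<in> carrier G. h g \<in> K} G"
  using subgroup.m_closed[OF K] subgroup.m_inv_closed[OF K] subgroup.one_closed[OF K]
  by (intro subgroup.intro) auto

lemma (in group_hom) noetherian_epi:
  assumes "noetherian_group G" and surj: "h ` carrier G = carrier H"
  shows "noetherian_group H"
  unfolding noetherian_group_def
proof (intro allI impI)
  fix K assume K: "subgroup K H"
  define J where "J = {g \<in> carrier G. h g \<in> K}"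
  have "subgroup J G" unfolding J_def by (rule vimage_subgroup[OF K])
  then obtain X where X: "finite X" "X \<subseteq> J" "generate G X = J"
    using assms(1) unfolding noetherian_group_def by blast
  have "\<exists>g\<in>J. k = h g" if "k \<in> K" for k
  proof -
    have "k \<in> h ` carrier G" using surj subgroup.subset[OF K] that by blast
    then show ?thesis using that by (auto simp: J_def)
  qed
  then have "h ` J = K" by (auto simp: J_def)
  then have "generate H (h ` X) = K" "h ` X \<subseteq> K"
    using generate_img[of X] X by (auto simp: J_def)
  then show "\<exists>X. finite X \<and> X \<subseteq> K \<and> generate H X = K" using X(1) by blast
qed

text \<open>A length on a subgroup of the quotient is pulled back, extended, and pushed forward by
  the infimum over fibres. Since \<open>J\<close> is the full preimage, the lower bound for
  \<open>M\<close> holds on whole fibres and survives the infimum. The infimum need not be attained,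
  hence the \<open>e\<close> in the proof of subadditivity.\<close>

lemma (in group_hom) lengths_extend_epi:
  assumes ext: "lengths_extend G" and surj: "h ` carrier G = carrier H"
  shows "lengths_extend H"
  unfolding lengths_extend_def
proof (intro allI impI)
  fix K L assume K: "subgroup K H" and L: "length_on H K L"
  define J where "J = {g \<in> carrier G. h g \<in> K}"
  have J: "subgroup J G" unfolding J_def by (rule vimage_subgroup[OF K])
  have "length_on G J (L \<circ> h)" using L by (auto simp: length_on_def J_def)
  then obtain M C where M: "length_on G (carrier G) M" and C: "C > 0"
    and b: "\<And>g. g \<in> J \<Longrightarrow> L (h g) \<le> C * M g + C" "\<And>g. g \<in> J \<Longrightarrow> M g \<le> C * L (h g) + C"
    using lengths_extendE[OF ext J] by (metis comp_apply)
  define N where "N q = Inf (M ` {g \<in> carrier G. h g = q})" for q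
  have bdd: "bdd_below (M ` {g \<in> carrier G. h g = q})" for q
    using length_onD(2)[OF M] by (intro bdd_belowI[of _ 0]) auto
  have ne: "M ` {g \<in> carrier G. h g = q} \<noteq> {}" if "q \<in> carrier H" for q
  proof -
    have "q \<in> h ` carrier G" using surj that by blast
    then show ?thesis by auto
  qed
  have Nle: "N (h g) \<le> M g" if "g \<in> carrier G" for g
    unfolding N_def using that by (intro cInf_lower bdd) auto
  have Nge: "c \<le> N q" if "q \<in> carrier H" "\<And>g. g \<in> carrier G \<Longrightarrow> h g = q \<Longrightarrow> c \<le> M g" for q c
    unfolding N_def using that by (intro cInf_greatest ne) auto
  have Nex: "\<exists>g\<in>carrier G. h g = q \<and> M g < N q + e" if "q \<in> carrier H" "e > 0" for q e
    using cInf_lessD[OF ne[OF that(1)], of "N q + e"] that(2) by (auto simp: N_def)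
  have "length_on H (carrier H) N"
    unfolding length_on_def
  proof (intro conjI ballI)
    show pos: "0 \<le> N q" if "q \<in> carrier H" for q
      using that length_onD(2)[OF M] by (intro Nge) auto
    show "N \<one>\<^bsub>H\<^esub> = 0" using Nle[of \<one>] length_onD(1)[OF M] pos[of "\<one>\<^bsub>H\<^esub>"] by simp
    fix q assume q: "q \<in> carrier H"
    have le: "N q \<le> N (inv\<^bsub>H\<^esub> q)" if q: "q \<in> carrier H" for q
    proof (rule Nge)
      fix g assume g: "g \<in> carrier G" "h g = inv\<^bsub>H\<^esub> q"
      then show "N q \<le> M g" using Nle[of "inv g"] length_onD(3)[OF M, of g] q by simp
    qed (use q in auto)
    show "N (inv\<^bsub>H\<^esub> q) = N q" using le[OF q] le[of "inv\<^bsub>H\<^esub> q"] q by simp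
    fix r assume r: "r \<in> carrier H"
    show "N (q \<otimes>\<^bsub>H\<^esub> r) \<le> N q + N r"
    proof (rule field_le_epsilon)
      fix e :: real assume e: "e > 0"
      obtain a b where a: "a \<in> carrier G" "h a = q" "M a < N q + e / 2"
        and b: "b \<in> carrier G" "h b = r" "M b < N r + e / 2"
        using Nex[OF q, of "e / 2"] Nex[OF r, of "e / 2"] e by auto
      have "N (q \<otimes>\<^bsub>H\<^esub> r) \<le> M (a \<otimes> b)" using Nle[of "a \<otimes> b"] a b by simp
      also have "\<dots> \<le> M a + M b" using length_onD(4)[OF M] a b by blast
      finally show "N (q \<otimes>\<^bsub>H\<^esub> r) \<le> N q + N r + e" using a b by linarith
    qed
  qed
  moreover have "L k \<le> C * N k + C \<and> N k \<le> C * L k + C" if k: "k \<in> K" for k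
  proof
    have kH: "k \<in> carrier H" using k subgroup.subset[OF K] by blast
    have "(L k - C) / C \<le> N k"
    proof (rule Nge[OF kH])
      fix g assume "g \<in> carrier G" "h g = k"
      then have "L k \<le> C * M g + C" using b(1)[of g] k by (auto simp: J_def)
      then show "(L k - C) / C \<le> M g" using C by (simp add: field_simps)
    qed
    then show "L k \<le> C * N k + C" using C by (simp add: field_simps)
    obtain g where "g \<in> carrier G" "h g = k" using kH surj by (metis imageE)
    then show "N k \<le> C * L k + C" using Nle[of g] b(2)[of g] k by (auto simp: J_def)
  qed
  ultimately show "\<exists>M C. length_on H (carrier H) M \<and> C > 0 \<and>
      (\<forall>h\<in>K. L h \<le> C * M h + C \<and> M h \<le> C * L h + C)" using C by blast
qed

section \<open>Finite index and FC-centres\<close>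

text \<open>The translates only have to cover \<open>K\<close>: cosets may repeat, and
  \<open>H\<close> need not lie in \<open>K\<close>. This makes the notion monotone in
  \<open>H\<close>.\<close>

definition fin_index :: "('a, 'm) monoid_scheme \<Rightarrow> 'a set \<Rightarrow> 'a set \<Rightarrow> bool" where
  "fin_index G K H \<longleftrightarrow> (\<exists>T. finite T \<and> T \<subseteq> K \<and> (\<forall>k\<in>K. \<exists>t\<in>T. \<exists>h\<in>H. k = t \<otimes>\<^bsub>G\<^esub> h))"

text \<open>The equation says that \<open>y\<close> is the conjugate of \<open>x\<close> by
  \<open>m\<close> without mentioning inverses. Hence the set computed in \<open>G\<close> and the
  one computed in \<open>G\<lparr>carrier := K\<rparr>\<close> agree by unfolding alone.\<close>

definition fc_center :: "('a, 'm) monoid_scheme \<Rightarrow> 'a set \<Rightarrow> 'a set" where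
  "fc_center G K = {x \<in> K. finite {y \<in> K. \<exists>m\<in>K. m \<otimes>\<^bsub>G\<^esub> x = y \<otimes>\<^bsub>G\<^esub> m}}"

lemma fin_index_mono: "fin_index G K H \<Longrightarrow> H \<subseteq> H' \<Longrightarrow> fin_index G K H'"
  unfolding fin_index_def by (meson subsetD)

text \<open>After division by \<open>a ^ j\<close> the left side is a power of \<open>b / a\<close>,
  while \<open>a \<ge> 1\<close> keeps the right side at most linear in \<open>j\<close>; a ratio
  above one would grow faster.\<close>

lemma power_growth_le:
  fixes a b P Q R :: real
  assumes a: "a \<ge> 1" and nn: "P \<ge> 0" "Q \<ge> 0" "R \<ge> 0"
    and le: "\<And>j :: nat. b ^ j \<le> P * a ^ j + Q * real j + R"
  shows "b \<le> a"
proof (rule ccontr)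
  assume "\<not> b \<le> a"
  define q where "q = b / a"
  have q: "q > 1" using a \<open>\<not> b \<le> a\<close> by (simp add: q_def)
  have "q ^ j \<le> P + Q * real j + R" for j
  proof -
    have a1: "a ^ j \<ge> 1" using a by simp
    have "q ^ j = b ^ j / a ^ j" by (simp add: q_def power_divide)
    also have "\<dots> \<le> (P * a ^ j + Q * real j + R) / a ^ j"
      using le[of j] a1 by (intro divide_right_mono) auto
    also have "\<dots> = P + (Q * real j + R) / a ^ j" using a by (simp add: add_divide_distrib)
    also have "\<dots> \<le> P + (Q * real j + R) / 1"
      using a1 nn by (intro add_left_mono divide_left_mono) auto
    finally show ?thesis by simp
  qed
  moreover have "filterlim (\<lambda>j :: nat. q ^ j - (P + Q * real j + R)) at_top at_top"
    using q by real_asymp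
  then have "\<forall>\<^sub>F j :: nat in sequentially. q ^ j - (P + Q * real j + R) > 0"
    by (rule eventually_compose_filterlim[OF eventually_gt_at_top])
  then obtain j :: nat where "q ^ j - (P + Q * real j + R) > 0"
    using eventually_happens'[OF sequentially_bot] by blast
  ultimately show False by (metis diff_gt_0_iff_gt linorder_not_le)
qed

lemma quadratic_growth_contr:
  fixes P R :: real
  assumes le: "\<And>n :: nat. (real n)\<^sup>2 \<le> P * real n + R"
  shows False
proof -
  have "filterlim (\<lambda>n :: nat. (real n)\<^sup>2 - (P * real n + R)) at_top at_top" by real_asymp
  then have "\<forall>\<^sub>F n :: nat in sequentially. (real n)\<^sup>2 - (P * real n + R) > 0"
    by (rule eventually_compose_filterlim[OF eventually_gt_at_top])
  then obtain n :: nat where "(real n)\<^sup>2 - (P * real n + R) > 0"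
    using eventually_happens'[OF sequentially_bot] by blast
  then show False using le[of n] by simp
qed

context group
begin

lemma inv_cancel_left:
  assumes "x \<in> carrier G" "y \<in> carrier G"
  shows "inv x \<otimes> (x \<otimes> y) = y" "x \<otimes> (inv x \<otimes> y) = y"
  using assms by (simp_all flip: m_assoc)

lemma conj_eq_iff:
  assumes "m \<in> carrier G" "x \<in> carrier G" "y \<in> carrier G"
  shows "m \<otimes> x = y \<otimes> m \<longleftrightarrow> y = m \<otimes> x \<otimes> inv m"
  using assms by (metis inv_solve_right m_closed)

lemma conj_mult:
  assumes "m \<in> carrier G" "x \<in> carrier G" "y \<in> carrier G"
  shows "m \<otimes> (x \<otimes> y) \<otimes> inv m = (m \<otimes> x \<otimes> inv m) \<otimes> (m \<otimes> y \<otimes> inv m)"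
  using assms by (simp add: m_assoc inv_cancel_left)

lemma conj_conj:
  assumes "m \<in> carrier G" "n \<in> carrier G" "x \<in> carrier G"
  shows "(m \<otimes> n) \<otimes> x \<otimes> inv (m \<otimes> n) = m \<otimes> (n \<otimes> x \<otimes> inv n) \<otimes> inv m"
  using assms by (simp add: m_assoc inv_mult_group)

lemma conj_inv:
  assumes "m \<in> carrier G" "x \<in> carrier G"
  shows "m \<otimes> inv x \<otimes> inv m = inv (m \<otimes> x \<otimes> inv m)"
  using assms by (simp add: m_assoc inv_mult_group)

lemma conj_group_hom: "m \<in> carrier G \<Longrightarrow> group_hom G G (\<lambda>x. m \<otimes> x \<otimes> inv m)"
  by unfold_locales (auto simp: hom_def conj_mult)

lemma conj_nat_pow:
  assumes "m \<in> carrier G" "x \<in> carrier G"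
  shows "(m \<otimes> x \<otimes> inv m) [^] (n::nat) = m \<otimes> x [^] n \<otimes> inv m"
  using group_hom.hom_nat_pow[OF conj_group_hom[OF assms(1)] assms(2)] by simp

lemma conj_int_pow:
  assumes "m \<in> carrier G" "x \<in> carrier G"
  shows "(m \<otimes> x \<otimes> inv m) [^] (n::int) = m \<otimes> x [^] n \<otimes> inv m"
  using group_hom.hom_int_pow[OF conj_group_hom[OF assms(1)] assms(2)] by simp

lemma length_on_int_pow:
  assumes M: "length_on G (carrier G) M" and g: "g \<in> carrier G"
  shows "M (g [^] (i::int)) \<le> \<bar>real_of_int i\<bar> * M g"
proof (cases i rule: int_cases2)
  case (nonneg n)
  then show ?thesis using length_on_nat_pow[OF assms] by (simp add: int_pow_int)
next
  case (nonpos n)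
  then show ?thesis using length_on_nat_pow[OF assms, of n] length_onD(3)[OF M, of "g [^] n"] g
    by (simp add: int_pow_neg_int)
qed

text \<open>\<open>f\<close> is an invariant with finitely many values that separates left cosets;
  choosing one element for each value gives the covering.\<close>

lemma fin_indexI:
  assumes K: "subgroup K G" and fin: "finite (f ` K)"
    and f: "\<And>x y. x \<in> K \<Longrightarrow> y \<in> K \<Longrightarrow> f x = f y \<Longrightarrow> inv x \<otimes> y \<in> H"
  shows "fin_index G K H"
  unfolding fin_index_def
proof (intro exI[of _ "inv_into K f ` f ` K"] conjI ballI)
  fix k assume k: "k \<in> K"
  define t where "t = inv_into K f (f k)"
  have t: "t \<in> K" "f t = f k" using k by (auto simp: t_def inv_into_into f_inv_into_f)
  have "k = t \<otimes> (inv t \<otimes> k)"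
    using t k subgroup.mem_carrier[OF K] by (simp add: inv_cancel_left)
  then show "\<exists>t\<in>inv_into K f ` f ` K. \<exists>h\<in>H. k = t \<otimes> h"
    using f[OF t(1) k t(2)] k unfolding t_def by blast
qed (use fin in \<open>auto intro: inv_into_into\<close>)

text \<open>The value \<open>f x\<close> represents the left coset of \<open>x\<close>, but it may
  differ between elements of that coset, since the covering set can contain several representatives.
  Equal values do force equal cosets.\<close>

lemma fin_indexE:
  assumes "fin_index G K H" "K \<subseteq> carrier G" "H \<subseteq> carrier G"
  obtains f where "finite (f ` K)" "f ` K \<subseteq> K" "\<And>x. x \<in> K \<Longrightarrow> inv (f x) \<otimes> x \<in> H"
proof -
  obtain T where T: "finite T" "T \<subseteq> K" and "\<forall>k\<in>K. \<exists>t\<in>T. \<exists>h\<in>H. k = t \<otimes> h"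
    using assms(1) unfolding fin_index_def by blast
  then obtain f h where fh: "\<And>k. k \<in> K \<Longrightarrow> f k \<in> T \<and> h k \<in> H \<and> k = f k \<otimes> h k" by metis
  have "inv (f x) \<otimes> x \<in> H" if "x \<in> K" for x
    using fh[OF that] T assms inv_cancel_left(1)[of "f x" "h x"] by (metis subsetD)
  moreover have "f ` K \<subseteq> T" using fh by blast
  ultimately show thesis using T that[of f] by (meson finite_subset order_trans)
qed

lemma fin_index_eq_imp:
  assumes K: "subgroup K G" and H: "subgroup H G" and "f ` K \<subseteq> K"
    and f: "\<And>x. x \<in> K \<Longrightarrow> inv (f x) \<otimes> x \<in> H" and "x \<in> K" "y \<in> K" "f x = f y"
  shows "inv x \<otimes> y \<in> H"
proof -
  have c: "x \<in> carrier G" "y \<in> carrier G" "f x \<in> carrier G"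
    using assms subgroup.mem_carrier[OF K] by auto
  have "inv x \<otimes> y = inv (inv (f x) \<otimes> x) \<otimes> (inv (f x) \<otimes> y)"
    using c by (simp add: inv_mult_group m_assoc inv_cancel_left)
  then show ?thesis
    using f[of x] f[of y] assms subgroup.m_closed[OF H] subgroup.m_inv_closed[OF H] by metis
qed

lemma fin_index_Int:
  assumes K: "subgroup K G" and H: "subgroup H G" "subgroup J G"
    and "fin_index G K H" "fin_index G K J"
  shows "fin_index G K (H \<inter> J)"
proof -
  obtain f where f: "finite (f ` K)" "f ` K \<subseteq> K" "\<And>x. x \<in> K \<Longrightarrow> inv (f x) \<otimes> x \<in> H"
    using fin_indexE[OF assms(4)] K H subgroup.subset by metis
  obtain g where g: "finite (g ` K)" "g ` K \<subseteq> K" "\<And>x. x \<in> K \<Longrightarrow> inv (g x) \<otimes> x \<in> J"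
    using fin_indexE[OF assms(5)] K H subgroup.subset by metis
  show ?thesis
  proof (rule fin_indexI[OF K, of "\<lambda>x. (f x, g x)"])
    have "(\<lambda>x. (f x, g x)) ` K \<subseteq> f ` K \<times> g ` K" by blast
    then show "finite ((\<lambda>x. (f x, g x)) ` K)" using f(1) g(1) finite_subset by blast
  qed (use fin_index_eq_imp[OF K H(1) f(2,3)] fin_index_eq_imp[OF K H(2) g(2,3)] in auto)
qed

lemma fin_index_trans:
  assumes "fin_index G K H" "fin_index G H J" and sub: "K \<subseteq> carrier G" "H \<subseteq> K" "J \<subseteq> carrier G"
    and K: "subgroup K G"
  shows "fin_index G K J"
proof -
  obtain S where S: "finite S" "S \<subseteq> K" "\<forall>k\<in>K. \<exists>t\<in>S. \<exists>h\<in>H. k = t \<otimes> h"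
    using assms(1) unfolding fin_index_def by blast
  obtain T where T: "finite T" "T \<subseteq> H" "\<forall>k\<in>H. \<exists>t\<in>T. \<exists>h\<in>J. k = t \<otimes> h"
    using assms(2) unfolding fin_index_def by blast
  define U where "U = (\<lambda>(s, t). s \<otimes> t) ` (S \<times> T)"
  have "\<exists>u\<in>U. \<exists>j\<in>J. k = u \<otimes> j" if k: "k \<in> K" for k
  proof -
    obtain s h where s: "s \<in> S" "h \<in> H" "k = s \<otimes> h" using S k by blast
    moreover obtain t j where t: "t \<in> T" "j \<in> J" "h = t \<otimes> j" using T s by blast
    moreover have "s \<otimes> (t \<otimes> j) = s \<otimes> t \<otimes> j"
      using s t S T sub by (intro m_assoc[symmetric]) auto
    ultimately show ?thesis unfolding U_def by force
  qed
  moreover have "finite U" using S T by (simp add: U_def)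
  moreover have "U \<subseteq> K"
    using S(2) T(2) sub(2) subgroup.m_closed[OF K] unfolding U_def by fast
  ultimately show ?thesis unfolding fin_index_def by blast
qed

text \<open>Recording the conjugates of all elements of \<open>X\<close> gives an invariant with
  finitely many values, and two elements with the same record differ by something that commutes with
  \<open>X\<close>.\<close>

lemma fin_index_centralizer:
  assumes K: "subgroup K G" and X: "finite X" "X \<subseteq> carrier G"
    and fin: "\<And>x. x \<in> X \<Longrightarrow> finite ((\<lambda>m. m \<otimes> x \<otimes> inv m) ` K)"
  shows "fin_index G K {k \<in> K. \<forall>x\<in>X. k \<otimes> x = x \<otimes> k}"
proof (rule fin_indexI[OF K])
  let ?f = "\<lambda>m. \<lambda>x\<in>X. m \<otimes> x \<otimes> inv m"
  have "?f ` K \<subseteq> (\<Pi>\<^sub>E x\<in>X. (\<lambda>m. m \<otimes> x \<otimes> inv m) ` K)" by auto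
  then show "finite (?f ` K)" by (rule finite_subset) (intro finite_PiE X fin)
  fix k l assume k: "k \<in> K" and l: "l \<in> K" and eq: "?f k = ?f l"
  have kl: "inv k \<otimes> l \<in> K" using k l K by (simp add: subgroup.m_closed subgroup.m_inv_closed)
  have c: "k \<in> carrier G" "l \<in> carrier G" using k l subgroup.mem_carrier[OF K] by auto
  have "(inv k \<otimes> l) \<otimes> x = x \<otimes> (inv k \<otimes> l)" if x: "x \<in> X" for x
  proof -
    have xc: "x \<in> carrier G" using x X by blast
    have "k \<otimes> x \<otimes> inv k = l \<otimes> x \<otimes> inv l" using fun_cong[OF eq, of x] x by simp
    then have "k \<otimes> x \<otimes> inv k \<otimes> l = l \<otimes> x" using c xc by (simp add: m_assoc)
    then have "inv k \<otimes> (k \<otimes> (x \<otimes> (inv k \<otimes> l))) = inv k \<otimes> (l \<otimes> x)"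
      using c xc by (simp add: m_assoc)
    then show ?thesis using c xc by (simp add: inv_cancel_left m_assoc)
  qed
  then show "inv k \<otimes> l \<in> {k \<in> K. \<forall>x\<in>X. k \<otimes> x = x \<otimes> k}" using kl by blast
qed

lemma commute_mult:
  assumes "k \<in> carrier G" "x \<in> carrier G" "y \<in> carrier G" "k \<otimes> x = x \<otimes> k" "k \<otimes> y = y \<otimes> k"
  shows "k \<otimes> (x \<otimes> y) = (x \<otimes> y) \<otimes> k"
  using assms by (metis m_assoc)

lemma commute_inv:
  assumes "k \<in> carrier G" "x \<in> carrier G" "k \<otimes> x = x \<otimes> k"
  shows "k \<otimes> inv x = inv x \<otimes> k"
  using assms by (metis inv_closed inv_solve_left inv_solve_right m_assoc m_closed)

lemma centralizer_subgroup:
  assumes X: "X \<subseteq> carrier G" and K: "subgroup K G"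
  shows "subgroup {k \<in> K. \<forall>x\<in>X. k \<otimes> x = x \<otimes> k} G"
proof
  have KC: "\<And>k. k \<in> K \<Longrightarrow> k \<in> carrier G" using subgroup.mem_carrier[OF K] .
  show "{k \<in> K. \<forall>x\<in>X. k \<otimes> x = x \<otimes> k} \<subseteq> carrier G" using KC by blast
  show "\<one> \<in> {k \<in> K. \<forall>x\<in>X. k \<otimes> x = x \<otimes> k}" using X subgroup.one_closed[OF K] by auto
  show "k \<otimes> l \<in> {k \<in> K. \<forall>x\<in>X. k \<otimes> x = x \<otimes> k}"
    if "k \<in> {k \<in> K. \<forall>x\<in>X. k \<otimes> x = x \<otimes> k}" "l \<in> {k \<in> K. \<forall>x\<in>X. k \<otimes> x = x \<otimes> k}" for k l
    using that commute_mult[of _ k l] X KC subgroup.m_closed[OF K] by (auto simp: subset_eq)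
  show "inv k \<in> {k \<in> K. \<forall>x\<in>X. k \<otimes> x = x \<otimes> k}" if "k \<in> {k \<in> K. \<forall>x\<in>X. k \<otimes> x = x \<otimes> k}" for k
    using that commute_inv[of _ k] X KC subgroup.m_inv_closed[OF K] by (auto simp: subset_eq)
qed

lemma commute_generate:
  assumes k: "k \<in> carrier G" and X: "X \<subseteq> carrier G" and c: "\<And>x. x \<in> X \<Longrightarrow> k \<otimes> x = x \<otimes> k"
    and x: "x \<in> generate G X"
  shows "k \<otimes> x = x \<otimes> k"
proof -
  have "generate G X \<subseteq> {x \<in> carrier G. \<forall>k\<in>{k}. x \<otimes> k = k \<otimes> x}"
    using k X c by (intro generate_subgroup_incl centralizer_subgroup subgroup_self) auto
  then show ?thesis using x by auto
qed

abbreviation conj_class :: "'a \<Rightarrow> 'a set \<Rightarrow> 'a set" where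
  "conj_class x K \<equiv> (\<lambda>m. m \<otimes> x \<otimes> inv m) ` K"

lemma fc_center_iff:
  assumes K: "subgroup K G"
  shows "x \<in> fc_center G K \<longleftrightarrow> x \<in> K \<and> finite (conj_class x K)"
proof (cases "x \<in> K")
  case True
  then have "{y \<in> K. \<exists>m\<in>K. m \<otimes> x = y \<otimes> m} = conj_class x K"
    using subgroup.mem_carrier[OF K] conj_eq_iff
    by (auto simp: image_iff subgroup.m_closed[OF K] subgroup.m_inv_closed[OF K])
  then show ?thesis by (simp add: fc_center_def True)
qed (simp add: fc_center_def)

lemma fc_center_subgroup:
  assumes K: "subgroup K G" shows "subgroup (fc_center G K) G"
proof
  have KC: "\<And>k. k \<in> K \<Longrightarrow> k \<in> carrier G" using subgroup.mem_carrier[OF K] .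
  show "fc_center G K \<subseteq> carrier G" using KC by (auto simp: fc_center_def)
  have "(\<lambda>m. m \<otimes> \<one> \<otimes> inv m) ` K \<subseteq> {\<one>}" using KC by auto
  then show "\<one> \<in> fc_center G K"
    unfolding fc_center_iff[OF K] using subgroup.one_closed[OF K] finite_subset by blast
  show "inv x \<in> fc_center G K" if "x \<in> fc_center G K" for x
  proof -
    have x: "x \<in> K" "finite (conj_class x K)" using that fc_center_iff[OF K] by auto
    have "(\<lambda>m. m \<otimes> inv x \<otimes> inv m) ` K = m_inv G ` conj_class x K"
      using KC x(1) by (simp add: image_image conj_inv)
    then show ?thesis unfolding fc_center_iff[OF K]
      using x subgroup.m_inv_closed[OF K] by simp
  qed
  show "x \<otimes> y \<in> fc_center G K" if "x \<in> fc_center G K" "y \<in> fc_center G K" for x y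
  proof -
    have x: "x \<in> K" "finite (conj_class x K)"
      and y: "y \<in> K" "finite (conj_class y K)"
      using that fc_center_iff[OF K] by auto
    have "(\<lambda>m. m \<otimes> (x \<otimes> y) \<otimes> inv m) ` K
        \<subseteq> (\<lambda>(u, v). u \<otimes> v) ` (conj_class x K \<times> conj_class y K)"
      using KC x(1) y(1) by (force simp: conj_mult)
    then show ?thesis unfolding fc_center_iff[OF K]
      using x y subgroup.m_closed[OF K] by (meson finite_SigmaI finite_imageI finite_subset)
  qed
qed

lemma fc_center_conj:
  assumes "K \<lhd> G" and g: "g \<in> carrier G" and x: "x \<in> fc_center G K"
  shows "g \<otimes> x \<otimes> inv g \<in> fc_center G K"
proof -
  interpret K: normal K G by fact
  have K: "subgroup K G" by (rule K.is_subgroup)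
  have xK: "x \<in> K" and fin: "finite (conj_class x K)"
    using x fc_center_iff[OF K] by auto
  have "(\<lambda>m. m \<otimes> (g \<otimes> x \<otimes> inv g) \<otimes> inv m) ` K
      \<subseteq> (\<lambda>u. g \<otimes> u \<otimes> inv g) ` conj_class x K"
  proof
    fix y assume "y \<in> (\<lambda>m. m \<otimes> (g \<otimes> x \<otimes> inv g) \<otimes> inv m) ` K"
    then obtain m where m: "m \<in> K" "y = m \<otimes> (g \<otimes> x \<otimes> inv g) \<otimes> inv m" by blast
    have m': "inv g \<otimes> m \<otimes> g \<in> K" using K.inv_op_closed1[OF g m(1)] .
    have "y = g \<otimes> ((inv g \<otimes> m \<otimes> g) \<otimes> x \<otimes> inv (inv g \<otimes> m \<otimes> g)) \<otimes> inv g"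
      using m g xK by (simp add: m_assoc inv_mult_group inv_cancel_left)
    then show "y \<in> (\<lambda>u. g \<otimes> u \<otimes> inv g) ` conj_class x K" using m' by blast
  qed
  then show ?thesis
    unfolding fc_center_iff[OF K] using fin K.inv_op_closed2[OF g xK] finite_subset by blast
qed

text \<open>\<open>B\<close> is the centre of the FC-centre \<open>F\<close>, and it is normal
  because \<open>F\<close> is invariant under conjugation. As \<open>F\<close> is finitely
  generated, \<open>B\<close> is the centralizer in \<open>F\<close> of finitely many elements with
  finite conjugacy classes, hence of finite index in \<open>F\<close>.\<close>

lemma center_of_fc_center:
  assumes noeth: "noetherian_group G" and K: "K \<lhd> G"
  obtains B where "B \<lhd> G" "B \<subseteq> fc_center G K" "\<And>a b. a \<in> B \<Longrightarrow> b \<in> B \<Longrightarrow> a \<otimes> b = b \<otimes> a"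
    "fin_index G (fc_center G K) B"
proof
  interpret K: normal K G by fact
  define F where "F = fc_center G K"
  define B where "B = {b \<in> F. \<forall>f\<in>F. b \<otimes> f = f \<otimes> b}"
  have F: "subgroup F G" unfolding F_def by (rule fc_center_subgroup[OF K.is_subgroup])
  interpret F: subgroup F G by (rule F)
  show "B \<lhd> G"
  proof (rule normal_invI)
    show "subgroup B G" unfolding B_def by (rule centralizer_subgroup[OF F.subset F])
    fix g b assume g: "g \<in> carrier G" and b: "b \<in> B"
    then have bF: "b \<in> F" by (simp add: B_def)
    have "g \<otimes> b \<otimes> inv g \<otimes> f = f \<otimes> (g \<otimes> b \<otimes> inv g)" if f: "f \<in> F" for f
    proof -
      have f': "inv g \<otimes> f \<otimes> g \<in> F"
        using fc_center_conj[OF K, of "inv g" f] f g by (simp add: F_def)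
      then have "b \<otimes> (inv g \<otimes> f \<otimes> g) = (inv g \<otimes> f \<otimes> g) \<otimes> b" using b by (simp add: B_def)
      then have "g \<otimes> (b \<otimes> (inv g \<otimes> f \<otimes> g)) \<otimes> inv g = g \<otimes> ((inv g \<otimes> f \<otimes> g) \<otimes> b) \<otimes> inv g"
        by simp
      then show ?thesis using g f bF by (simp add: m_assoc inv_cancel_left)
    qed
    then show "g \<otimes> b \<otimes> inv g \<in> B"
      using fc_center_conj[OF K g] bF by (simp add: B_def F_def)
  qed
  show "B \<subseteq> fc_center G K" by (auto simp: B_def F_def)
  show "a \<otimes> b = b \<otimes> a" if "a \<in> B" "b \<in> B" for a b
    using that unfolding B_def by blast
  obtain X where X: "finite X" "X \<subseteq> F" "generate G X = F"
    using noeth F unfolding noetherian_group_def by blast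
  have FK: "F \<subseteq> K" by (auto simp: F_def fc_center_def)
  have "fin_index G F {k \<in> F. \<forall>x\<in>X. k \<otimes> x = x \<otimes> k}"
  proof (rule fin_index_centralizer[OF F X(1)])
    fix x assume "x \<in> X"
    then have "finite (conj_class x K)"
      using X(2) fc_center_iff[OF K.is_subgroup] by (auto simp: F_def)
    then show "finite ((\<lambda>m. m \<otimes> x \<otimes> inv m) ` F)" by (rule finite_subset[rotated]) (use FK in auto)
  qed (use X F.subset in auto)
  moreover have "{k \<in> F. \<forall>x\<in>X. k \<otimes> x = x \<otimes> k} \<subseteq> B"
  proof
    fix k assume "k \<in> {k \<in> F. \<forall>x\<in>X. k \<otimes> x = x \<otimes> k}"
    then have k: "k \<in> F" "\<And>x. x \<in> X \<Longrightarrow> k \<otimes> x = x \<otimes> k" by auto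
    have "k \<otimes> f = f \<otimes> k" if "f \<in> F" for f
      using commute_generate[where k = k and x = f, OF _ _ k(2)] k(1) X(2,3) F.subset that by blast
    then show "k \<in> B" using k(1) by (simp add: B_def)
  qed
  ultimately show "fin_index G (fc_center G K) B" using fin_index_mono by (auto simp: F_def)
qed

end

text \<open>Induction on the generators: an element of the larger group is
  \<open>x [^] i \<otimes> y\<close>. Splitting off multiples of an \<open>n\<close> with
  \<open>x [^] n \<in> A\<close> from \<open>i\<close> leaves finitely many powers of
  \<open>x\<close> as new factors of the representatives.\<close>

lemma (in comm_group) fin_index_generate_torsion:
  assumes "finite X" and A: "subgroup A G"
    and "X \<subseteq> carrier G" "\<And>x. x \<in> X \<Longrightarrow> \<exists>n>0. x [^] (n::nat) \<in> A"
  shows "\<exists>T. finite T \<and> T \<subseteq> generate G X \<and> (\<forall>k\<in>generate G X. \<exists>t\<in>T. \<exists>h\<in>A. k = t \<otimes> h)"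
  using assms(1,3,4)
proof (induction X)
  case empty
  interpret A: subgroup A G by fact
  have "\<one> = \<one> \<otimes> \<one>" by simp
  then show ?case using generate_empty A.one_closed by (intro exI[of _ "{\<one>}"]) auto
next
  case (insert x X)
  interpret A: subgroup A G by fact
  have x: "x \<in> carrier G" and X: "X \<subseteq> carrier G" using insert.prems by auto
  obtain T where T: "finite T" "T \<subseteq> generate G X" "\<forall>k\<in>generate G X. \<exists>t\<in>T. \<exists>h\<in>A. k = t \<otimes> h"
    using insert.IH insert.prems by auto
  obtain n :: nat where n: "n > 0" "x [^] n \<in> A" using insert.prems by blast
  have gX: "generate G X \<subseteq> carrier G" by (rule generate_incl[OF X])
  define U where "U = (\<lambda>(r, t). x [^] (r::nat) \<otimes> t) ` ({..<n} \<times> T)"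
  have sub: "generate G X \<subseteq> generate G (insert x X)" by (intro mono_generate) auto
  have gen: "subgroup (generate G (insert x X)) G" using x X by (intro generate_is_subgroup) auto
  have xin: "x \<in> generate G (insert x X)" by (auto intro: generate.incl)
  have xp: "x [^] (r::nat) \<in> generate G (insert x X)" for r
    using subgroup_int_pow_closed[OF gen xin, of "int r"] by (simp add: int_pow_int)
  have "generate G (insert x X) \<subseteq> generate G {x} <#> generate G X"
  proof (rule generate_subgroup_incl)
    show "subgroup (generate G {x} <#> generate G X) G"
      using x X by (intro mult_subgroups generate_is_subgroup) auto
    have "x = x \<otimes> \<one>" using x by simp
    moreover have "x \<in> generate G {x}" "\<one> \<in> generate G X" by (auto intro: generate.intros)
    moreover have "y = \<one> \<otimes> y" "y \<in> generate G X" "\<one> \<in> generate G {x}" if "y \<in> X" for y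
      using that X by (auto intro: generate.intros)
    ultimately show "insert x X \<subseteq> generate G {x} <#> generate G X"
      unfolding set_mult_def by blast
  qed
  then have "generate G (insert x X) \<subseteq> {x [^] (i::int) | i. i \<in> UNIV} <#> generate G X"
    unfolding generate_pow[OF x] .
  then have dec: "\<exists>i::int. \<exists>y\<in>generate G X. k = x [^] i \<otimes> y" if "k \<in> generate G (insert x X)" for k
    using that unfolding set_mult_def by blast
  have "\<exists>t\<in>U. \<exists>h\<in>A. k = t \<otimes> h" if "k \<in> generate G (insert x X)" for k
  proof -
    obtain i :: int and y where y: "y \<in> generate G X" and k: "k = x [^] i \<otimes> y"
      using dec \<open>k \<in> generate G (insert x X)\<close> by blast
    obtain t h where t: "t \<in> T" "h \<in> A" "y = t \<otimes> h" using T y by blast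
    have tc: "t \<in> carrier G" "h \<in> carrier G" using t T gX by auto
    \<comment> \<open>The remainder is nonnegative for negative \<open>i\<close> too, so a natural
      exponent below \<open>n\<close> results.\<close>
    define r where "r = nat (i mod int n)"
    have r: "r < n" using n unfolding r_def by (simp add: nat_less_iff)
    have i: "i = int r + int n * (i div int n)" using n unfolding r_def by simp
    have "x [^] i = x [^] int r \<otimes> x [^] (int n * (i div int n))"
      using x by (subst i) (rule int_pow_mult)
    also have "\<dots> = x [^] r \<otimes> (x [^] n) [^] (i div int n)"
      using x by (simp add: int_pow_int int_pow_pow[symmetric])
    finally have xi: "x [^] i = x [^] r \<otimes> (x [^] n) [^] (i div int n)" .
    have pA: "(x [^] n) [^] (i div int n) \<in> A" by (rule subgroup_int_pow_closed[OF A n(2)])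
    have "k = (x [^] r \<otimes> t) \<otimes> ((x [^] n) [^] (i div int n) \<otimes> h)"
      unfolding k xi t(3) using x tc by (simp add: m_ac)
    then show ?thesis using r t pA unfolding U_def by (force intro: A.m_closed)
  qed
  moreover have "finite U" "U \<subseteq> generate G (insert x X)"
    using T(1,2) sub xp by (auto simp: U_def intro!: generate.eng)
  ultimately show ?case by blast
qed

context group
begin

lemma fin_index_torsion:
  assumes B: "subgroup B G" and comm: "\<And>a b. a \<in> B \<Longrightarrow> b \<in> B \<Longrightarrow> a \<otimes> b = b \<otimes> a"
    and X: "finite X" "X \<subseteq> B" "generate G X = B" and A: "subgroup A G" "A \<subseteq> B"
    and tors: "\<And>b. b \<in> B \<Longrightarrow> \<exists>n>0. b [^] (n::nat) \<in> A"
  shows "fin_index G B A"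
proof -
  let ?B = "G\<lparr>carrier := B\<rparr>"
  interpret B: comm_group ?B
    using subgroup.subgroup_is_group[OF B is_group]
    by (rule group.group_comm_groupI) (simp add: comm)
  have "\<exists>T. finite T \<and> T \<subseteq> generate ?B X \<and> (\<forall>k\<in>generate ?B X. \<exists>t\<in>T. \<exists>h\<in>A. k = t \<otimes>\<^bsub>?B\<^esub> h)"
  proof (rule B.fin_index_generate_torsion[OF X(1)])
    show "subgroup A ?B" using A B subgroup_incl by blast
    show "\<exists>n>0. x [^]\<^bsub>?B\<^esub> (n::nat) \<in> A" if "x \<in> X" for x
      using tors[of x] that X(2) nat_pow_consistent[of x] by auto
  qed (use X in auto)
  then show ?thesis using generate_consistent[OF X(2) B] X(3) by (simp add: fin_index_def)
qed

abbreviation torsion :: "'a set \<Rightarrow> 'a set" where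
  "torsion B \<equiv> {b \<in> B. \<exists>n>0. b [^] (n::nat) = \<one>}"

text \<open>The torsion elements of an abelian group form a subgroup, which the maximal condition
  makes finitely generated. All its elements have a power in the trivial subgroup, which therefore
  has finite index in it.\<close>

lemma finite_torsion:
  assumes noeth: "noetherian_group G" and B: "subgroup B G"
    and comm: "\<And>a b. a \<in> B \<Longrightarrow> b \<in> B \<Longrightarrow> a \<otimes> b = b \<otimes> a"
  shows "finite (torsion B)"
    and "subgroup (torsion B) G"
proof -
  define T where "T = torsion B"
  have BC: "\<And>b. b \<in> B \<Longrightarrow> b \<in> carrier G" using subgroup.mem_carrier[OF B] .
  have T: "subgroup T G"
  proof
    show "T \<subseteq> carrier G" using BC by (auto simp: T_def)
    show "\<one> \<in> T" using subgroup.one_closed[OF B] by (auto simp: T_def)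
    show "inv x \<in> T" if "x \<in> T" for x
      using that BC subgroup.m_inv_closed[OF B] by (auto simp: T_def nat_pow_inv)
    show "x \<otimes> y \<in> T" if "x \<in> T" "y \<in> T" for x y
    proof -
      obtain m n :: nat where mn: "m > 0" "x [^] m = \<one>" "n > 0" "y [^] n = \<one>" "x \<in> B" "y \<in> B"
        using \<open>x \<in> T\<close> \<open>y \<in> T\<close> by (auto simp: T_def)
      have "(x \<otimes> y) [^] (m * n) = x [^] (m * n) \<otimes> y [^] (m * n)"
        by (rule pow_mult_distrib[OF comm[OF mn(5,6)] BC[OF mn(5)] BC[OF mn(6)]])
      also have "\<dots> = (x [^] m) [^] n \<otimes> (y [^] n) [^] m"
        using mn(5,6) BC by (simp add: nat_pow_pow mult.commute)
      also have "\<dots> = \<one>" unfolding mn(2,4) by simp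
      finally have "(x \<otimes> y) [^] (m * n) = \<one>" .
      then show ?thesis using mn subgroup.m_closed[OF B] by (auto simp: T_def intro!: exI[of _ "m * n"])
    qed
  qed
  then obtain X where X: "finite X" "X \<subseteq> T" "generate G X = T"
    using noeth unfolding noetherian_group_def by blast
  have "fin_index G T {\<one>}"
  proof (rule fin_index_torsion[OF T _ X triv_subgroup])
    show "a \<otimes> b = b \<otimes> a" if "a \<in> T" "b \<in> T" for a b
      using that comm[of a b] by (simp add: T_def)
    show "{\<one>} \<subseteq> T" using subgroup.one_closed[OF T] by simp
  qed (simp add: T_def)
  then obtain S where S: "finite S" "S \<subseteq> T" "\<forall>k\<in>T. \<exists>t\<in>S. \<exists>h\<in>{\<one>}. k = t \<otimes> h"
    unfolding fin_index_def by blast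
  have "T \<subseteq> S"
  proof
    fix k assume "k \<in> T"
    then obtain t where t: "t \<in> S" "k = t \<otimes> \<one>" using S by blast
    then have "t \<in> carrier G" using S(2) subgroup.subset[OF T] by blast
    then show "k \<in> S" using t by simp
  qed
  then have "finite T" using S(1) finite_subset by blast
  then show "finite (torsion B)"
    "subgroup (torsion B) G"
    using T by (auto simp: T_def)
qed

end

section \<open>Conjugation in groups with extendable lengths\<close>

context group
begin

text \<open>\<open>L\<close> is the word length on \<open>B\<close> modulo
  \<open>K = \<langle>b\<rangle>\<close>, a length because \<open>B\<close> is abelian. It vanishes
  on \<open>K\<close>, so an extension is bounded on \<open>K\<close> and, up to
  \<open>2 * M g\<close>, on the conjugate of \<open>K\<close>. All powers of \<open>c\<close> thus
  lie in finitely many cosets of \<open>K\<close>, and two of them share a coset.\<close>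

lemma conj_pow_in_cyclic:
  assumes ext: "lengths_extend G" and B: "B \<lhd> G"
    and comm: "\<And>a b. a \<in> B \<Longrightarrow> b \<in> B \<Longrightarrow> a \<otimes> b = b \<otimes> a"
    and X: "finite X" "generate G X = B" "X \<subseteq> carrier G" and b: "b \<in> B" and g: "g \<in> carrier G"
  shows "\<exists>n>0. \<exists>i::int. (g \<otimes> b \<otimes> inv g) [^] (n::nat) = b [^] i"
proof -
  interpret B: normal B G by fact
  have bc: "b \<in> carrier G" using b by simp
  define K where "K = generate G {b}"
  have K: "subgroup K G" unfolding K_def using bc by (intro generate_is_subgroup) auto
  interpret K: subgroup K G by (rule K)
  have KB: "K \<subseteq> B"
    unfolding K_def using b by (intro generate_subgroup_incl B.is_subgroup) auto
  define W where "W n = word_ball G X n <#> K" for n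
  have wB: "word_ball G X n \<subseteq> B" for n
    using X generate_eq_Union_word_ball by blast
  define L where "L h = real (LEAST n. h \<in> W n)" for h
  have Wex: "\<exists>n. h \<in> W n" if h: "h \<in> B" for h
  proof -
    obtain n where "h \<in> word_ball G X n" using h X generate_eq_Union_word_ball by blast
    moreover have "h = h \<otimes> \<one>" using h by simp
    ultimately show ?thesis using K.one_closed unfolding W_def set_mult_def by blast
  qed
  have L: "length_on G B L"
    unfolding L_def
  proof (rule length_on_filtration[OF B.is_subgroup Wex])
    have "\<one> = \<one> \<otimes> \<one>" by simp
    then show "\<one> \<in> W 0" using K.one_closed unfolding W_def set_mult_def by auto
    fix n h assume h: "h \<in> B" "h \<in> W n"
    then obtain w k where w: "w \<in> word_ball G X n" "k \<in> K" "h = w \<otimes> k"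
      by (auto simp: W_def set_mult_def)
    have "w \<in> B" "k \<in> B" using w wB KB by auto
    then have "inv h = inv w \<otimes> inv k" using w(3) comm by (simp add: inv_mult_group)
    then show "inv h \<in> W n"
      using word_ball_inv[OF X(3) w(1)] K.m_inv_closed[OF w(2)]
      unfolding W_def set_mult_def by blast
  next
    fix m n g h assume gh: "g \<in> W m" "h \<in> W n"
    then obtain w k v l where w: "w \<in> word_ball G X m" "k \<in> K" "g = w \<otimes> k"
      and v: "v \<in> word_ball G X n" "l \<in> K" "h = v \<otimes> l"
      by (auto simp: W_def set_mult_def)
    have in_B: "w \<in> B" "k \<in> B" "v \<in> B" "l \<in> B" using w v wB KB by auto
    then have c: "w \<in> carrier G" "k \<in> carrier G" "v \<in> carrier G" "l \<in> carrier G" by auto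
    have "g \<otimes> h = w \<otimes> (k \<otimes> v) \<otimes> l" using w v c by (simp add: m_assoc)
    also have "\<dots> = (w \<otimes> v) \<otimes> (k \<otimes> l)" using comm[of k v] in_B c by (simp add: m_assoc)
    finally show "g \<otimes> h \<in> W (m + n)"
      using word_ball_mult[OF X(3) w(1) v(1)] K.m_closed[OF w(2) v(2)]
      unfolding W_def set_mult_def by blast
  qed
  obtain M C where M: "length_on G (carrier G) M" and C: "C > 0"
    and LM: "\<And>h. h \<in> B \<Longrightarrow> L h \<le> C * M h + C" "\<And>h. h \<in> B \<Longrightarrow> M h \<le> C * L h + C"
    using lengths_extendE[OF ext B.is_subgroup L] by metis
  define c where "c = g \<otimes> b \<otimes> inv g"
  have c: "c \<in> B" "c \<in> carrier G" using B.inv_op_closed2[OF g b] by (auto simp: c_def)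
  \<comment> \<open>\<open>C\<close> bounds \<open>M\<close> on \<open>K\<close>, conjugation by
    \<open>g\<close> adds at most \<open>2 * M g\<close>, and passing back from \<open>M\<close> to
    \<open>L\<close> applies the affine bound once more.\<close>
  define D where "D = C * (C + 2 * M g) + C"
  define N where "N = nat \<lfloor>D\<rfloor>"
  have "L (c [^] (n::nat)) \<le> D" for n
  proof -
    have bn: "b [^] n \<in> K"
      using subgroup_int_pow_closed[OF K, of b "int n"] by (auto simp: K_def int_pow_int intro: generate.incl)
    then have "L (b [^] n) = 0"
    proof -
      have "b [^] n \<in> W 0" using bn by (auto simp: W_def set_mult_def)
      then show ?thesis by (simp add: L_def Least_eq_0)
    qed
    then have "M (b [^] n) \<le> C" using LM(2)[of "b [^] n"] bn KB by auto
    moreover have "c [^] n = g \<otimes> b [^] n \<otimes> inv g" unfolding c_def by (rule conj_nat_pow[OF g bc])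
    ultimately have "M (c [^] n) \<le> C + 2 * M g"
      using length_on_conj[OF M g, of "b [^] n"] bc by simp
    moreover have "c [^] n \<in> B"
      using subgroup_int_pow_closed[OF B.is_subgroup c(1), of "int n"] by (simp add: int_pow_int)
    ultimately show ?thesis using LM(1)[of "c [^] n"] C unfolding D_def
      by (smt (verit) mult_left_mono)
  qed
  then have "(LEAST m. c [^] n \<in> W m) \<le> N" for n :: nat
    unfolding L_def N_def by (rule le_nat_floor)
  moreover have "c [^] n \<in> B" for n :: nat
    using subgroup_int_pow_closed[OF B.is_subgroup c(1), of "int n"] by (simp add: int_pow_int)
  then have "c [^] n \<in> W (LEAST m. c [^] n \<in> W m)" for n :: nat
    using Wex by (metis (mono_tags, lifting) LeastI_ex)
  moreover have "W m \<subseteq> W n" if "m \<le> n" for m n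
    using word_ball_mono[OF X(3) that] unfolding W_def set_mult_def by blast
  ultimately have "c [^] n \<in> W N" for n :: nat
    by (meson subsetD)
  then have "\<exists>w k. w \<in> word_ball G X N \<and> k \<in> K \<and> c [^] n = w \<otimes> k" for n :: nat
    unfolding W_def set_mult_def by blast
  then obtain w k where wk: "\<And>n. w n \<in> word_ball G X N" "\<And>n. k n \<in> K"
    "\<And>n :: nat. c [^] n = w n \<otimes> k n" by metis
  \<comment> \<open>Pigeonhole: there are infinitely many exponents, but only the finitely many
    elements of a word ball as coset representatives.\<close>
  have "\<not> inj_on w UNIV"
    using finite_word_ball[OF X(1), of N] wk(1) finite_imageD[of w UNIV] infinite_UNIV_nat
    by (metis finite_subset image_subsetI)
  then obtain p q where pq: "p < q" "w p = w q" unfolding inj_on_def by (metis linorder_neqE_nat)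
  have "c [^] (q - p) = inv (c [^] p) \<otimes> c [^] q"
    using c pq(1) inv_cancel_left(1)[of "c [^] p" "c [^] (q - p)"] by (simp add: nat_pow_mult)
  also have "\<dots> = inv (k p) \<otimes> k q"
  proof -
    have "w q \<in> carrier G" using wk(1) wB by (meson B.mem_carrier subsetD)
    then show ?thesis unfolding wk(3) pq(2) using wk(2)
      by (simp add: inv_mult_group m_assoc inv_cancel_left)
  qed
  finally have "c [^] (q - p) \<in> K" using wk(2) by simp
  then show ?thesis
    using pq(1) generate_pow[OF bc] unfolding K_def c_def by (intro exI[of _ "q - p"]) auto
qed

text \<open>The absolute exponent is a length on an infinite cyclic group, so its extension
  \<open>M\<close> is at least linear on the powers of \<open>b\<close>. Relations that reach
  \<open>b [^] i\<close> in sublinearly many steps are thereby excluded.\<close>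

lemma undistorted_cyclic:
  assumes ext: "lengths_extend G" and b: "b \<in> carrier G"
    and inf: "\<And>n :: nat. n > 0 \<Longrightarrow> b [^] n \<noteq> \<one>"
  obtains M C where "length_on G (carrier G) M" "C > 0"
    "\<And>i :: int. \<bar>real_of_int i\<bar> \<le> C * M (b [^] i) + C"
proof -
  have H: "subgroup (generate G {b}) G" using b by (intro generate_is_subgroup) auto
  have "b [^] (i::int) \<noteq> \<one>" if "i \<noteq> 0" for i
  proof (cases i rule: int_cases2)
    case (nonneg n) then show ?thesis using inf[of n] that by (simp add: int_pow_int)
  next
    case (nonpos n)
    then show ?thesis using inf[of n] that b inv_eq_1_iff by (simp add: int_pow_neg_int)
  qed
  then have inj: "i = j" if "b [^] (i::int) = b [^] (j::int)" for i j
  proof -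
    have "b [^] (i - j) = \<one>" using int_pow_diff[OF b, of i j] that b by simp
    then show ?thesis using \<open>\<And>i. i \<noteq> 0 \<Longrightarrow> b [^] i \<noteq> \<one>\<close>[of "i - j"] by auto
  qed
  define W where "W n = {b [^] i | i :: int. \<bar>i\<bar> \<le> int n}" for n
  have WI: "b [^] i \<in> W n" if "\<bar>i\<bar> \<le> int n" for i n using that by (auto simp: W_def)
  have WD: "\<bar>i\<bar> \<le> int n" if "b [^] i \<in> W n" for i n using that inj by (auto simp: W_def)
  define L where "L h = real (LEAST n. h \<in> W n)" for h
  have ex: "\<exists>n. h \<in> W n" if "h \<in> generate G {b}" for h
  proof -
    obtain i :: int where "h = b [^] i"
      using \<open>h \<in> generate G {b}\<close> generate_pow[OF b] by blast
    then have "h \<in> W (nat \<bar>i\<bar>)" by (simp add: WI)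
    then show ?thesis by blast
  qed
  have L: "length_on G (generate G {b}) L"
    unfolding L_def
  proof (rule length_on_filtration[OF H ex])
    show "\<one> \<in> W 0" using WI[of 0 0] by simp
    show "inv h \<in> W n" if "h \<in> W n" for n h
      using that WI[of "- i" n for i] b by (force simp: W_def int_pow_neg)
    fix m n g h assume "g \<in> W m" "h \<in> W n"
    then obtain i j where ij: "g = b [^] i" "\<bar>i\<bar> \<le> int m" "h = b [^] j" "\<bar>j\<bar> \<le> int n"
      by (auto simp: W_def)
    then have "g \<otimes> h = b [^] (i + j)" using b by (simp add: int_pow_mult)
    then show "g \<otimes> h \<in> W (m + n)" using ij by (simp add: WI)
  qed
  have lower: "\<bar>real_of_int i\<bar> \<le> L (b [^] i)" and inH: "b [^] i \<in> generate G {b}" for i :: int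
  proof -
    show inH: "b [^] i \<in> generate G {b}" using generate_pow[OF b] by blast
    have "\<bar>i\<bar> \<le> int (LEAST n. b [^] i \<in> W n)" by (rule WD[OF LeastI_ex[OF ex[OF inH]]])
    then show "\<bar>real_of_int i\<bar> \<le> L (b [^] i)" unfolding L_def by linarith
  qed
  obtain M C where M: "length_on G (carrier G) M" "C > 0"
    "\<And>h. h \<in> generate G {b} \<Longrightarrow> L h \<le> C * M h + C"
    using lengths_extendE[OF ext H L] by metis
  then show thesis using that[OF M(1,2)] lower inH by (meson order_trans)
qed

text \<open>Iterating the relation \<open>j\<close> times gives a conjugation by
  \<open>g [^] j\<close> with exponents \<open>n ^ j\<close> and \<open>i ^ j\<close>. The length of
  the result is at most of order \<open>\<bar>n\<bar> ^ j\<close> plus a linear term, and at least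
  of order \<open>\<bar>i\<bar> ^ j\<close>.\<close>

lemma conj_pow_abs_le:
  assumes ext: "lengths_extend G" and b: "b \<in> carrier G" and g: "g \<in> carrier G"
    and inf: "\<And>n :: nat. n > 0 \<Longrightarrow> b [^] n \<noteq> \<one>"
    and conj: "g \<otimes> b [^] (n::int) \<otimes> inv g = b [^] (i::int)" and n: "n \<noteq> 0"
  shows "\<bar>i\<bar> \<le> \<bar>n\<bar>"
proof -
  obtain M C where M: "length_on G (carrier G) M" and C: "C > 0"
    and low: "\<And>i :: int. \<bar>real_of_int i\<bar> \<le> C * M (b [^] i) + C"
    using undistorted_cyclic[OF ext b inf] by metis
  have pw: "g [^] j \<otimes> b [^] (n ^ j) \<otimes> inv (g [^] j) = b [^] (i ^ j)" for j :: nat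
  proof (induction j)
    case (Suc j)
    have "g [^] Suc j \<otimes> b [^] (n ^ Suc j) \<otimes> inv (g [^] Suc j)
        = g \<otimes> (g [^] j \<otimes> b [^] (n ^ Suc j) \<otimes> inv (g [^] j)) \<otimes> inv g"
      using conj_conj[of g "g [^] j"] g b nat_pow_Suc2[OF g] by simp
    also have "g [^] j \<otimes> b [^] (n ^ Suc j) \<otimes> inv (g [^] j)
        = (g [^] j \<otimes> b [^] (n ^ j) \<otimes> inv (g [^] j)) [^] n"
      using g b by (simp add: conj_int_pow int_pow_pow mult.commute)
    also have "\<dots> = b [^] (i ^ j * n)" using Suc b by (simp add: int_pow_pow)
    also have "g \<otimes> b [^] (i ^ j * n) \<otimes> inv g = (g \<otimes> b [^] n \<otimes> inv g) [^] (i ^ j)"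
      using g b by (simp add: conj_int_pow int_pow_pow mult.commute)
    also have "\<dots> = b [^] (i ^ Suc j)" unfolding conj using b by (simp add: int_pow_pow)
    finally show ?case .
  qed (use b in simp)
  have nn: "M b \<ge> 0" "M g \<ge> 0" using length_onD(2)[OF M] b g by auto
  have "\<bar>real_of_int i\<bar> ^ j \<le> (C * M b) * \<bar>real_of_int n\<bar> ^ j + (C * 2 * M g) * real j + C" for j
  proof -
    have "M (b [^] (i ^ j)) \<le> M (b [^] (n ^ j)) + 2 * M (g [^] j)"
      using length_on_conj[OF M, of "g [^] j" "b [^] (n ^ j)"] g b pw[of j] by simp
    also have "\<dots> \<le> \<bar>real_of_int (n ^ j)\<bar> * M b + 2 * (real j * M g)"
      using length_on_int_pow[OF M b, of "n ^ j"] length_on_nat_pow[OF M g, of j] by simp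
    finally have "C * M (b [^] (i ^ j)) \<le> C * (\<bar>real_of_int (n ^ j)\<bar> * M b + 2 * (real j * M g))"
      using C by (intro mult_left_mono) auto
    then show ?thesis using low[of "i ^ j"] by (simp add: power_abs algebra_simps)
  qed
  then have "\<bar>real_of_int i\<bar> \<le> \<bar>real_of_int n\<bar>"
    by (rule power_growth_le[rotated 4]) (use n nn C in auto)
  then show ?thesis by linarith
qed

text \<open>Some power of the conjugate is \<open>b [^] i\<close>. Comparing exponents for
  \<open>g\<close> and for its inverse leaves only \<open>i = \<plusminus>n\<close>. If
  \<open>b\<close> has finite order, a power that kills \<open>b\<close> kills the conjugate as
  well.\<close>

lemma conj_pow_eq:
  assumes ext: "lengths_extend G" and noeth: "noetherian_group G" and B: "B \<lhd> G"
    and comm: "\<And>a b. a \<in> B \<Longrightarrow> b \<in> B \<Longrightarrow> a \<otimes> b = b \<otimes> a"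
    and b: "b \<in> B" and g: "g \<in> carrier G"
  shows "\<exists>n>0. (g \<otimes> b \<otimes> inv g) [^] (n::nat) = b [^] n \<or> (g \<otimes> b \<otimes> inv g) [^] n = inv (b [^] n)"
proof (cases "\<exists>n>0. b [^] (n::nat) = \<one>")
  case True
  then obtain n :: nat where n: "n > 0" "b [^] n = \<one>" by blast
  have "b \<in> carrier G" using b B normal_imp_subgroup subgroup.mem_carrier by metis
  then have "(g \<otimes> b \<otimes> inv g) [^] n = b [^] n" using n g by (simp add: conj_nat_pow)
  then show ?thesis using n by blast
next
  case False
  interpret B: normal B G by fact
  have bc: "b \<in> carrier G" using b by simp
  obtain X where X: "finite X" "X \<subseteq> B" "generate G X = B"
    using noeth B.is_subgroup unfolding noetherian_group_def by blast
  obtain n :: nat and i :: int where n: "n > 0" and i: "(g \<otimes> b \<otimes> inv g) [^] n = b [^] i"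
    using conj_pow_in_cyclic[OF ext B comm X(1,3) _ b g] X(2) B.subset by blast
  have eq: "g \<otimes> b [^] int n \<otimes> inv g = b [^] i"
    using i conj_nat_pow[OF g bc] by (simp add: int_pow_int)
  have inf: "\<And>n :: nat. n > 0 \<Longrightarrow> b [^] n \<noteq> \<one>" using False by blast
  have le: "\<bar>i\<bar> \<le> \<bar>int n\<bar>"
    using conj_pow_abs_le[OF ext bc g inf eq] n by auto
  have eq': "inv g \<otimes> b [^] i \<otimes> inv (inv g) = b [^] int n"
    unfolding eq[symmetric] using g bc by (simp add: m_assoc inv_cancel_left)
  \<comment> \<open>The comparison for \<open>inv g\<close> starts from the exponent
    \<open>i\<close>, which has to be nonzero; otherwise \<open>b [^] n\<close> would be
    trivial.\<close>
  have "i \<noteq> 0"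
    using eq' inf[OF n] g by (auto simp: int_pow_int)
  then have "\<bar>int n\<bar> \<le> \<bar>i\<bar>"
    using conj_pow_abs_le[OF ext bc _ inf eq'] g by auto
  then have "i = int n \<or> i = - int n" using le by linarith
  then show ?thesis using n i bc by (auto simp: int_pow_int int_pow_neg)
qed

text \<open>The commutator of \<open>w\<^sup>n\<close> and \<open>x\<^sup>n\<close> is a power of \<open>b\<close> with exponent quadratic in \<open>n\<close>, which
  is incompatible with \<open>b\<close> generating an undistorted infinite cyclic subgroup.\<close>

lemma central_commutator_torsion:
  assumes ext: "lengths_extend G" and c: "w \<in> carrier G" "x \<in> carrier G" "b \<in> carrier G"
    and conj: "w \<otimes> x \<otimes> inv w = x \<otimes> b" and wb: "w \<otimes> b = b \<otimes> w" and xb: "x \<otimes> b = b \<otimes> x"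
  shows "\<exists>n>0. b [^] (n::nat) = \<one>"
proof (rule ccontr)
  assume "\<not> ?thesis"
  then have inf: "\<And>n :: nat. n > 0 \<Longrightarrow> b [^] n \<noteq> \<one>" by blast
  obtain M C where M: "length_on G (carrier G) M" and C: "C > 0"
    and low: "\<And>i :: int. \<bar>real_of_int i\<bar> \<le> C * M (b [^] i) + C"
    using undistorted_cyclic[OF ext c(3) inf] by metis
  have cb: "w \<otimes> b [^] n \<otimes> inv w = b [^] n" for n :: nat
  proof -
    have "w \<otimes> b \<otimes> inv w = b" using c wb by (simp add: inv_solve_right')
    then show ?thesis using conj_nat_pow[OF c(1,3), of n] by simp
  qed
  have w1: "w [^] n \<otimes> x \<otimes> inv (w [^] n) = x \<otimes> b [^] n" for n :: nat
  proof (induction n)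
    case (Suc n)
    have "w [^] Suc n \<otimes> x \<otimes> inv (w [^] Suc n) = w \<otimes> (w [^] n \<otimes> x \<otimes> inv (w [^] n)) \<otimes> inv w"
      using conj_conj[of w "w [^] n" x] c nat_pow_Suc2[OF c(1)] by simp
    also have "\<dots> = (x \<otimes> b) \<otimes> b [^] n" unfolding Suc using c conj cb by (simp add: conj_mult)
    finally show ?case using c nat_pow_Suc2[OF c(3), of n] by (simp add: m_assoc)
  qed (use c in simp)
  have "w [^] n \<otimes> x [^] n \<otimes> inv (w [^] n) = x [^] n \<otimes> b [^] (n * n)" for n :: nat
  proof -
    have "b [^] int n \<in> generate G {b}" using generate_pow[OF c(3)] by blast
    then have "b [^] n \<in> generate G {b}" by (simp add: int_pow_int)
    then have "x \<otimes> b [^] n = b [^] n \<otimes> x"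
      by (rule commute_generate[of x "{b}", rotated 3]) (use c xb in auto)
    then have "(x \<otimes> b [^] n) [^] n = x [^] n \<otimes> (b [^] n) [^] n"
      using c by (intro pow_mult_distrib) auto
    then have "(x \<otimes> b [^] n) [^] n = x [^] n \<otimes> b [^] (n * n)"
      using c by (simp add: nat_pow_pow)
    then show ?thesis using conj_nat_pow[of "w [^] n" x n] w1[of n] c by simp
  qed
  then have eq: "b [^] (n * n) = inv (x [^] n) \<otimes> (w [^] n \<otimes> x [^] n \<otimes> inv (w [^] n))" for n :: nat
    using c by (simp add: inv_cancel_left)
  have "(real n)\<^sup>2 \<le> (C * (2 * M x + 2 * M w)) * real n + C" for n
  proof -
    have "M (b [^] (n * n)) \<le> M (inv (x [^] n)) + M (w [^] n \<otimes> x [^] n \<otimes> inv (w [^] n))"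
      unfolding eq using c by (intro length_onD(4)[OF M]) auto
    also have "\<dots> \<le> M (x [^] n) + (M (x [^] n) + 2 * M (w [^] n))"
      using length_on_conj[OF M, of "w [^] n" "x [^] n"] length_onD(3)[OF M, of "x [^] n"] c by simp
    also have "\<dots> \<le> 2 * (real n * M x) + 2 * (real n * M w)"
      using length_on_nat_pow[OF M, of x n] length_on_nat_pow[OF M, of w n] c by linarith
    finally have "C * M (b [^] (n * n)) \<le> C * (2 * (real n * M x) + 2 * (real n * M w))"
      using C by (intro mult_left_mono) auto
    then show ?thesis using low[of "int (n * n)"]
      unfolding int_pow_int by (simp add: power2_eq_square algebra_simps)
  qed
  then show False by (rule quadratic_growth_contr)
qed

lemma conj_class_finite_fin_index:
  assumes C: "fin_index G (carrier G) C" and x: "x \<in> carrier G" "C \<subseteq> carrier G"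
    and fin: "finite (conj_class x C)"
  shows "finite (conj_class x (carrier G))"
proof -
  obtain T where T: "finite T" "T \<subseteq> carrier G" "\<forall>k\<in>carrier G. \<exists>t\<in>T. \<exists>h\<in>C. k = t \<otimes> h"
    using C unfolding fin_index_def by blast
  have "conj_class x (carrier G)
      \<subseteq> (\<lambda>(t, u). t \<otimes> u \<otimes> inv t) ` (T \<times> conj_class x C)"
  proof
    fix y assume "y \<in> conj_class x (carrier G)"
    then obtain m where m: "m \<in> carrier G" "y = m \<otimes> x \<otimes> inv m" by blast
    obtain t h where t: "t \<in> T" "h \<in> C" "m = t \<otimes> h" using T(3) m(1) by blast
    have "y = t \<otimes> (h \<otimes> x \<otimes> inv h) \<otimes> inv t"
      unfolding m(2) t(3) using t(1,2) T(2) x by (intro conj_conj) auto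
    then show "y \<in> (\<lambda>(t, u). t \<otimes> u \<otimes> inv t) ` (T \<times> conj_class x C)"
      using t by force
  qed
  then show ?thesis using T(1) fin by (meson finite_SigmaI finite_imageI finite_subset)
qed

text \<open>A conjugate of \<open>b\<close> agrees with \<open>b\<close> or \<open>inv b\<close>
  after raising to a power \<open>n\<close>, so it differs from one of them by a torsion element of
  the abelian group \<open>B\<close>. The exponent varies with \<open>g\<close>, but the torsion
  subgroup is finite as a whole.\<close>

lemma abelian_normal_subset_fc_center:
  assumes ext: "lengths_extend G" and noeth: "noetherian_group G" and B: "B \<lhd> G"
    and comm: "\<And>a b. a \<in> B \<Longrightarrow> b \<in> B \<Longrightarrow> a \<otimes> b = b \<otimes> a"
  shows "B \<subseteq> fc_center G (carrier G)"
proof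
  interpret B: normal B G by fact
  define T where "T = torsion B"
  have T: "finite T" unfolding T_def by (rule finite_torsion(1)[OF noeth B.is_subgroup comm])
  fix b assume b: "b \<in> B"
  have bc: "b \<in> carrier G" using b by simp
  have "g \<otimes> b \<otimes> inv g \<in> (\<lambda>t. b \<otimes> t) ` T \<union> (\<lambda>t. inv b \<otimes> t) ` T" if g: "g \<in> carrier G" for g
  proof -
    define c where "c = g \<otimes> b \<otimes> inv g"
    have c: "c \<in> B" "c \<in> carrier G" using B.inv_op_closed2[OF g b] by (auto simp: c_def)
    obtain n :: nat where n: "n > 0" and alt: "c [^] n = b [^] n \<or> c [^] n = inv (b [^] n)"
      using conj_pow_eq[OF ext noeth B comm b g] unfolding c_def by blast
    have "inv u \<otimes> c \<in> T" if u: "u \<in> B" "c [^] n = u [^] n" for u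
    proof -
      have uc: "u \<in> carrier G" using u(1) by simp
      have "(inv u \<otimes> c) [^] n = inv u [^] n \<otimes> c [^] n"
        using comm[of "inv u" c] u c by (intro pow_mult_distrib) auto
      also have "\<dots> = \<one>" using u uc by (simp add: nat_pow_inv)
      finally show ?thesis using n u c unfolding T_def by blast
    qed
    from this[of b] this[of "inv b"] have "inv b \<otimes> c \<in> T \<or> inv (inv b) \<otimes> c \<in> T"
      using alt b bc by (auto simp: nat_pow_inv)
    moreover have "c = b \<otimes> (inv b \<otimes> c)" "c = inv b \<otimes> (inv (inv b) \<otimes> c)"
      using bc c by (simp_all add: inv_cancel_left)
    ultimately show ?thesis unfolding c_def[symmetric] by blast
  qed
  then have "conj_class b (carrier G) \<subseteq> (\<lambda>t. b \<otimes> t) ` T \<union> (\<lambda>t. inv b \<otimes> t) ` T" by blast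
  then show "b \<in> fc_center G (carrier G)"
    unfolding fc_center_iff[OF subgroup_self] using T bc finite_subset by blast
qed

lemma fin_index_vimage:
  assumes "group_hom G Q q" and H: "subgroup H Q" and "fin_index Q (carrier Q) H"
  shows "fin_index G (carrier G) {g \<in> carrier G. q g \<in> H}"
proof -
  interpret q: group_hom G Q q by fact
  obtain f where f: "finite (f ` carrier Q)" "f ` carrier Q \<subseteq> carrier Q"
    "\<And>x. x \<in> carrier Q \<Longrightarrow> inv\<^bsub>Q\<^esub> (f x) \<otimes>\<^bsub>Q\<^esub> x \<in> H"
    using q.H.fin_indexE[OF assms(3) _ subgroup.subset[OF H]] by blast
  show ?thesis
  proof (rule fin_indexI[OF subgroup_self, of "f \<circ> q"])
    have "(f \<circ> q) ` carrier G \<subseteq> f ` carrier Q" by auto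
    then show "finite ((f \<circ> q) ` carrier G)" using f(1) finite_subset by blast
    fix x y assume xy: "x \<in> carrier G" "y \<in> carrier G" "(f \<circ> q) x = (f \<circ> q) y"
    then have "inv\<^bsub>Q\<^esub> (q x) \<otimes>\<^bsub>Q\<^esub> q y \<in> H"
      using q.H.fin_index_eq_imp[OF q.H.subgroup_self H f(2,3)] by simp
    then show "inv x \<otimes> y \<in> {g \<in> carrier G. q g \<in> H}" using xy by simp
  qed
qed

text \<open>Let \<open>B\<close> be the centre of the FC-centre of the kernel \<open>M\<close>. It
  has finite index in \<open>M\<close>, and its centralizer \<open>C\<close> has finite index in
  \<open>G\<close> because generators of \<open>B\<close> have finite classes. For \<open>x\<close>
  in \<open>C\<close> with image in the FC-centre of \<open>Q\<close>, two conjugates of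
  \<open>x\<close> under \<open>C\<close> with the same image lie in one coset of \<open>M\<close>
  and, up to finitely many choices, in one coset of \<open>B\<close>. They then differ by a
  commutator that commutes with \<open>C\<close>; it has finite order, and \<open>B\<close> contains
  only finitely many such elements.\<close>

lemma fc_center_extension:
  assumes ext: "lengths_extend G" and noeth: "noetherian_group G"
    and q: "group_hom G Q q" and surj: "q ` carrier G = carrier Q"
    and kerfc: "fin_index G (kernel G Q q) (fc_center G (kernel G Q q))"
    and quotfc: "fin_index Q (carrier Q) (fc_center Q (carrier Q))"
  shows "fin_index G (carrier G) (fc_center G (carrier G))"
proof -
  interpret q: group_hom G Q q by (rule q)
  define M where "M = kernel G Q q"
  have MN: "M \<lhd> G" unfolding M_def by (rule q.normal_kernel)
  interpret M: normal M G by (rule MN)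
  obtain B where B: "B \<lhd> G" and Bfc: "B \<subseteq> fc_center G M"
    and comm: "\<And>a b. a \<in> B \<Longrightarrow> b \<in> B \<Longrightarrow> a \<otimes> b = b \<otimes> a" and fcB: "fin_index G (fc_center G M) B"
    using center_of_fc_center[OF noeth MN] by metis
  interpret B: normal B G by (rule B)
  have MB: "fin_index G M B"
    using fin_index_trans[OF kerfc[folded M_def] fcB M.subset _ B.subset M.is_subgroup]
    by (auto simp: fc_center_def)
  define T where "T = torsion B"
  have T: "finite T" unfolding T_def by (rule finite_torsion(1)[OF noeth B.is_subgroup comm])
  obtain X where X: "finite X" "X \<subseteq> B" "generate G X = B"
    using noeth B.is_subgroup unfolding noetherian_group_def by blast
  have Xc: "X \<subseteq> carrier G" using X B.subset by blast
  define C where "C = {k \<in> carrier G. \<forall>x\<in>X. k \<otimes> x = x \<otimes> k}"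
  have C: "subgroup C G" unfolding C_def by (rule centralizer_subgroup[OF Xc subgroup_self])
  interpret C: subgroup C G by (rule C)
  have Cidx: "fin_index G (carrier G) C"
    unfolding C_def
  proof (rule fin_index_centralizer[OF subgroup_self X(1) Xc])
    show "finite (conj_class x (carrier G))" if "x \<in> X" for x
      using that X abelian_normal_subset_fc_center[OF ext noeth B comm] fc_center_iff[OF subgroup_self]
      by blast
  qed
  have Ccomm: "k \<otimes> b = b \<otimes> k" if "k \<in> C" "b \<in> B" for k b
  proof (rule commute_generate[OF _ Xc])
    show "b \<in> generate G X" using that(2) X(3) by simp
    show "k \<otimes> x = x \<otimes> k" if "x \<in> X" for x using that \<open>k \<in> C\<close> unfolding C_def by blast
  qed (use that(1) in simp)
  obtain f where f: "finite (f ` M)" "f ` M \<subseteq> M" "\<And>x. x \<in> M \<Longrightarrow> inv (f x) \<otimes> x \<in> B"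
    using fin_indexE[OF MB M.subset B.subset] by blast
  have fc: "finite (conj_class x (carrier G))"
    if xC: "x \<in> C" and xq: "q x \<in> fc_center Q (carrier Q)" for x
  proof (rule conj_class_finite_fin_index[OF Cidx])
    have xc: "x \<in> carrier G" using xC by simp
    define Z where "Z = conj_class x C"
    have Zc: "Z \<subseteq> carrier G" using xc by (auto simp: Z_def)
    have "q ` Z \<subseteq> (\<lambda>m. m \<otimes>\<^bsub>Q\<^esub> q x \<otimes>\<^bsub>Q\<^esub> inv\<^bsub>Q\<^esub> m) ` carrier Q"
      using xc by (auto simp: Z_def)
    then have qZ: "finite (q ` Z)"
      using xq q.H.fc_center_iff[OF q.H.subgroup_self] finite_subset by blast
    define r where "r z = inv_into Z q (q z)" for z
    have r: "r z \<in> Z" "q (r z) = q z" if "z \<in> Z" for z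
      using that by (auto simp: r_def inv_into_into f_inv_into_f)
    have rM: "inv (r z) \<otimes> z \<in> M" if "z \<in> Z" for z
    proof -
      have "r z \<in> carrier G" "z \<in> carrier G" using that r(1) Zc by blast+
      moreover have "q (inv (r z) \<otimes> z) = inv\<^bsub>Q\<^esub> (q (r z)) \<otimes>\<^bsub>Q\<^esub> q z" using calculation by simp
      ultimately show ?thesis unfolding M_def kernel_def r(2)[OF that] by simp
    qed
    \<comment> \<open>Among conjugates with a common image in \<open>Q\<close> the reference
      \<open>r z\<close> is fixed, and \<open>f\<close> names the coset of \<open>B\<close> that
      contains the difference from it. So \<open>F\<close> has finitely many values and each of its
      fibres lies in a single coset of \<open>B\<close>.\<close>
    define F where "F z = (q z, f (inv (r z) \<otimes> z))" for z
    have "F ` Z \<subseteq> q ` Z \<times> f ` M" using rM by (auto simp: F_def)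
    then have FZ: "finite (F ` Z)" using qZ f(1) finite_subset by blast
    define s where "s z = inv_into Z F (F z)" for z
    have s: "s z \<in> Z" "F (s z) = F z" if "z \<in> Z" for z
      using that by (auto simp: s_def inv_into_into f_inv_into_f)
    have "inv (s z) \<otimes> z \<in> T" if z: "z \<in> Z" for z
    proof -
      define y where "y = s z"
      have y: "y \<in> Z" "F y = F z" using s[OF z] by (auto simp: y_def)
      have yz: "y \<in> carrier G" "z \<in> carrier G" "r z \<in> carrier G" using y z Zc r(1)[OF z] by blast+
      have eq: "q y = q z" "f (inv (r y) \<otimes> y) = f (inv (r z) \<otimes> z)" using y(2) by (auto simp: F_def)
      have ry: "r y = r z" unfolding r_def eq(1) ..
      have "inv (inv (r y) \<otimes> y) \<otimes> (inv (r z) \<otimes> z) \<in> B"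
        by (rule fin_index_eq_imp[OF M.is_subgroup B.is_subgroup f(2,3) rM[OF y(1)] rM[OF z] eq(2)])
      then have bB: "inv y \<otimes> z \<in> B"
        using yz by (simp add: ry inv_mult_group m_assoc inv_cancel_left)
      define b where "b = inv y \<otimes> z"
      have b: "b \<in> B" "b \<in> carrier G" using bB by (auto simp: b_def)
      have zy: "z = y \<otimes> b" using yz by (simp add: b_def inv_cancel_left)
      obtain c where c: "c \<in> C" "z = c \<otimes> x \<otimes> inv c" using z by (auto simp: Z_def)
      obtain d where d: "d \<in> C" "y = d \<otimes> x \<otimes> inv d" using y(1) by (auto simp: Z_def)
      have cd: "c \<in> carrier G" "d \<in> carrier G" using c d by auto
      \<comment> \<open>Conjugating \<open>z = y \<otimes> b\<close> back by \<open>d\<close>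
        exhibits \<open>x \<otimes> b\<close> as a conjugate of \<open>x\<close>; the factor
        \<open>b\<close> is unaffected because \<open>d\<close> centralizes
        \<open>B\<close>.\<close>
      have "(inv d \<otimes> c) \<otimes> x \<otimes> inv (inv d \<otimes> c) = inv d \<otimes> (y \<otimes> b) \<otimes> inv (inv d)"
        using conj_conj[of "inv d" c x] cd xc c(2) zy by simp
      also have "\<dots> = inv d \<otimes> (d \<otimes> (x \<otimes> (inv d \<otimes> (b \<otimes> d))))"
        unfolding d(2) using cd xc b by (simp add: m_assoc)
      also have "\<dots> = x \<otimes> (inv d \<otimes> (b \<otimes> d))" using cd xc b by (simp add: inv_cancel_left)
      also have "b \<otimes> d = d \<otimes> b" using Ccomm[OF d(1) b(1)] by simp
      also have "inv d \<otimes> (d \<otimes> b) = b" using cd b by (simp add: inv_cancel_left)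
      finally have cj: "(inv d \<otimes> c) \<otimes> x \<otimes> inv (inv d \<otimes> c) = x \<otimes> b" .
      have "\<exists>n>0. b [^] (n::nat) = \<one>"
        by (rule central_commutator_torsion[OF ext _ xc b(2) cj])
          (use c(1) d(1) b xC in \<open>simp_all add: Ccomm\<close>)
      then show ?thesis using b by (simp add: T_def b_def y_def)
    qed
    moreover have "z = s z \<otimes> (inv (s z) \<otimes> z)" if "z \<in> Z" for z
    proof -
      have "z \<in> carrier G" "s z \<in> carrier G" using s(1) that Zc by blast+
      then show ?thesis by (simp add: inv_cancel_left)
    qed
    ultimately have "Z \<subseteq> (\<lambda>(u, t). u \<otimes> t) ` (s ` Z \<times> T)" by force
    moreover have "finite (s ` Z)"
    proof -
      have "s ` Z = inv_into Z F ` F ` Z" by (auto simp: s_def)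
      then show ?thesis using FZ by simp
    qed
    ultimately have "finite Z" using T by (meson finite_SigmaI finite_imageI finite_subset)
    then show "finite (conj_class x C)" by (simp add: Z_def)
  qed (use xC C.subset in auto)
  define P where "P = {g \<in> carrier G. q g \<in> fc_center Q (carrier Q)}"
  have fcQ: "subgroup (fc_center Q (carrier Q)) Q"
    by (rule q.H.fc_center_subgroup[OF q.H.subgroup_self])
  have P: "subgroup P G" unfolding P_def by (rule q.vimage_subgroup[OF fcQ])
  have "fin_index G (carrier G) P" unfolding P_def by (rule fin_index_vimage[OF q fcQ quotfc])
  then have "fin_index G (carrier G) (C \<inter> P)" by (rule fin_index_Int[OF subgroup_self C P Cidx])
  then show ?thesis
    by (rule fin_index_mono) (use fc fc_center_iff[OF subgroup_self] in \<open>auto simp: P_def\<close>)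
qed

end

section \<open>Elementary amenable groups\<close>

text \<open>The induction keeps all groups in one type, so the quotient is carried by chosen coset
  representatives. The choice depends on the coset alone, which makes two values equal exactly for
  elements of one coset.\<close>

lemma (in group) quotient_in_type:
  assumes N: "N \<lhd> G"
  obtains Q :: "'a monoid" and p where "group_hom G Q p" "p ` carrier G = carrier Q" "kernel G Q p = N"
proof
  interpret N: normal N G by (rule N)
  define f where "f a = (SOME x. x \<in> N #> a)" for a
  have f: "f a \<in> N #> a" if "a \<in> carrier G" for a
    unfolding f_def using rcos_self[OF that N.is_subgroup] by (rule someI)
  have wm: "weak_group_morphism f N G"
  proof (rule weak_group_morphismsI[OF N])
    fix a b assume ab: "a \<in> carrier G" "b \<in> carrier G"
    have iff: "a \<otimes> inv b \<in> N \<longleftrightarrow> N #> a = N #> b"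
      using N.rcos_module[OF is_group ab(2,1)] rcos_self[OF ab(1) N.is_subgroup]
        repr_independence[OF _ ab(2) N.is_subgroup] by metis
    show "f a = f b \<longleftrightarrow> a \<otimes> inv b \<in> N"
    proof
      assume "f a = f b"
      then show "a \<otimes> inv b \<in> N"
        unfolding iff using f[OF ab(1)] f[OF ab(2)] repr_independence[OF _ _ N.is_subgroup] ab by metis
    qed (simp add: iff f_def)
  qed
  show "group_hom G (image_group f G) f"
    by (intro group_hom.intro is_group image_group_is_group[OF wm] group_hom_axioms.intro
        weak_group_morphism_is_hom[OF wm])
  show "f ` carrier G = carrier (image_group f G)" by (simp add: image_group_carrier)
  show "kernel G (image_group f G) f = N" by (rule weak_group_morphism_ker[OF wm])
qed

lemma elementary_amenable_imp_group: "elementary_amenable G \<Longrightarrow> group G"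
proof (induction rule: elementary_amenable.induct)
  case (abelian G)
  then show ?case by (simp add: comm_group.axioms)
next
  case (subgroup G H)
  then show ?case using subgroup.subgroup_is_group by blast
qed

text \<open>A section of a quotient is thereby a section of the group itself: the subgroup of the
  quotient is replaced by its preimage.\<close>

lemma epi_subgroup_vimage:
  assumes "group G" "group Q" and p: "p \<in> epi G Q" and K: "subgroup K Q"
  defines "J \<equiv> {g \<in> carrier G. p g \<in> K}"
  shows "subgroup J G" "p \<in> epi (G\<lparr>carrier := J\<rparr>) (Q\<lparr>carrier := K\<rparr>)"
proof -
  interpret p: group_hom G Q p
    using assms by (auto simp: group_hom_def group_hom_axioms_def epi_def)
  show "subgroup J G" unfolding J_def by (rule p.vimage_subgroup[OF K])
  have "k \<in> p ` J" if k: "k \<in> K" for k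
  proof -
    have "k \<in> p ` carrier G" using p subgroup.mem_carrier[OF K k] by (simp add: epi_def)
    then show ?thesis using k by (auto simp: J_def)
  qed
  then show "p \<in> epi (G\<lparr>carrier := J\<rparr>) (Q\<lparr>carrier := K\<rparr>)"
    by (auto simp: epi_def hom_def J_def)
qed

text \<open>The maximal condition and the extension of lengths are assumed for \<open>Q\<close>
  only, which is an arbitrary quotient of an arbitrary subgroup of \<open>G\<close>. Subgroups and
  quotients merely change the presentation of \<open>Q\<close> as a section, and in a directed union
  the finite generation of \<open>Q\<close> leads to a single member. Extensions are where
  \<open>fc_center_extension\<close> enters.\<close>

lemma elementary_amenable_section_virtually_fc:
  fixes Q :: "'a monoid"
  assumes "elementary_amenable (G :: 'a monoid)" "subgroup K G" "group Q" "p \<in> epi (G\<lparr>carrier := K\<rparr>) Q"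
    "noetherian_group Q" "lengths_extend Q"
  shows "fin_index Q (carrier Q) (fc_center Q (carrier Q))"
  using assms
proof (induction arbitrary: K Q p rule: elementary_amenable.induct)
  case (finite G)
  interpret Q: group Q by fact
  have "finite K" using finite subgroup.subset finite_subset by metis
  then have fin: "finite (carrier Q)" using \<open>p \<in> epi _ _\<close> by (auto simp: epi_def dest: sym)
  show ?case
  proof (rule Q.fin_indexI[OF Q.subgroup_self])
    show "finite (id ` carrier Q)" using fin by simp
    show "inv\<^bsub>Q\<^esub> x \<otimes>\<^bsub>Q\<^esub> y \<in> fc_center Q (carrier Q)"
      if "x \<in> carrier Q" "y \<in> carrier Q" for x y
      using that fin Q.fc_center_iff[OF Q.subgroup_self] by simp
  qed
next
  case (abelian G)
  interpret Q: group Q by fact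
  interpret G: comm_group G by fact
  have pc: "p ` K = carrier Q" and ph: "\<And>x y. x \<in> K \<Longrightarrow> y \<in> K \<Longrightarrow> p (x \<otimes>\<^bsub>G\<^esub> y) = p x \<otimes>\<^bsub>Q\<^esub> p y"
    using \<open>p \<in> epi _ _\<close> by (auto simp: epi_def hom_def)
  have KG: "\<And>x. x \<in> K \<Longrightarrow> x \<in> carrier G" using subgroup.mem_carrier[OF \<open>subgroup K G\<close>] .
  have comm: "x \<otimes>\<^bsub>Q\<^esub> y = y \<otimes>\<^bsub>Q\<^esub> x" if "x \<in> carrier Q" "y \<in> carrier Q" for x y
  proof -
    obtain a b where "a \<in> K" "b \<in> K" "x = p a" "y = p b"
      using \<open>x \<in> carrier Q\<close> \<open>y \<in> carrier Q\<close> pc by blast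
    then show ?thesis using ph G.m_comm KG by metis
  qed
  have "(\<lambda>m. m \<otimes>\<^bsub>Q\<^esub> x \<otimes>\<^bsub>Q\<^esub> inv\<^bsub>Q\<^esub> m) ` carrier Q \<subseteq> {x}" if "x \<in> carrier Q" for x
  proof clarify
    fix m assume m: "m \<in> carrier Q"
    have "m \<otimes>\<^bsub>Q\<^esub> x \<otimes>\<^bsub>Q\<^esub> inv\<^bsub>Q\<^esub> m = x \<otimes>\<^bsub>Q\<^esub> (m \<otimes>\<^bsub>Q\<^esub> inv\<^bsub>Q\<^esub> m)"
      unfolding comm[OF m that] using m that by (simp add: Q.m_assoc)
    then show "m \<otimes>\<^bsub>Q\<^esub> x \<otimes>\<^bsub>Q\<^esub> inv\<^bsub>Q\<^esub> m = x" using m that by simp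
  qed
  then have "x \<in> fc_center Q (carrier Q)" if "x \<in> carrier Q" for x
    using that Q.fc_center_iff[OF Q.subgroup_self] finite_subset by blast
  then show ?case
    by (intro Q.fin_indexI[OF Q.subgroup_self, of "\<lambda>_. ()"]) auto
next
  case (subgroup G H)
  interpret G: group G by (rule elementary_amenable_imp_group[OF subgroup.hyps(1)])
  have "subgroup K G" using subgroup.hyps(2) subgroup.prems(1) by (rule G.incl_subgroup)
  then show ?case using subgroup.IH subgroup.prems by simp
next
  case (quotient G Q' \<pi>)
  have G: "group G" by (rule elementary_amenable_imp_group[OF quotient.hyps(1)])
  define J where "J = {g \<in> carrier G. \<pi> g \<in> K}"
  note J = epi_subgroup_vimage[OF G quotient.hyps(2,3) quotient.prems(1), folded J_def]
  show ?case
    by (rule quotient.IH[OF J(1) quotient.prems(2) epi_compose[OF J(2) quotient.prems(3)]])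
      (use quotient.prems in auto)
next
  case (extension G Q0 \<pi>)
  let ?N = "kernel G Q0 \<pi>" and ?K = "G\<lparr>carrier := K\<rparr>"
  interpret G: group G by fact
  interpret Q: group Q by fact
  interpret \<pi>: group_hom G Q0 \<pi>
    using extension.hyps by (auto simp: group_hom_def group_hom_axioms_def epi_def)
  note K = \<open>subgroup K G\<close>
  interpret K: subgroup K G by (rule K)
  interpret p: group_hom ?K Q p
    using extension.prems G.subgroup_imp_group[OF K]
    by (auto simp: group_hom_def group_hom_axioms_def epi_def)
  have pK: "p ` K = carrier Q" using extension.prems(3) by (simp add: epi_def)
  have ph: "\<And>x y. x \<in> K \<Longrightarrow> y \<in> K \<Longrightarrow> p (x \<otimes>\<^bsub>G\<^esub> y) = p x \<otimes>\<^bsub>Q\<^esub> p y" using p.hom_mult by simp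
  have p\<pi>: "p (inv\<^bsub>G\<^esub> x) = inv\<^bsub>Q\<^esub> p x" if "x \<in> K" for x
    using p.hom_inv[of x] that G.m_inv_consistent[OF K that] by simp
  have N: "?N \<lhd> G" by (rule \<pi>.normal_kernel)
  have Nsub: "subgroup ?N G" by (rule \<pi>.subgroup_kernel)
  have KN: "K \<inter> ?N \<lhd> ?K" using G.normal_Int_subgroup[OF K N] by (simp add: Int_commute)
  \<comment> \<open>This is the part of \<open>Q\<close> that comes from the kernel: it is a section
    of \<open>?N\<close>, while \<open>Q\<close> modulo \<open>M\<close> is a section of
    \<open>Q0\<close>.\<close>
  define M where "M = p ` (K \<inter> ?N)"
  have M: "M \<lhd> Q"
    unfolding M_def using normal.surj_hom_normal_subgroup[OF KN p.group_hom_axioms] pK by simp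
  have Msub: "subgroup M Q" by (rule normal_imp_subgroup[OF M])
  have "fin_index (Q\<lparr>carrier := M\<rparr>) (carrier (Q\<lparr>carrier := M\<rparr>))
      (fc_center (Q\<lparr>carrier := M\<rparr>) (carrier (Q\<lparr>carrier := M\<rparr>)))"
  proof (rule extension.IH(1))
    show "subgroup (K \<inter> ?N) (G\<lparr>carrier := ?N\<rparr>)"
      by (intro G.subgroup_incl G.subgroups_Inter_pair K Nsub) auto
    show "p \<in> epi (G\<lparr>carrier := ?N\<rparr>\<lparr>carrier := K \<inter> ?N\<rparr>) (Q\<lparr>carrier := M\<rparr>)"
      using ph by (auto simp: epi_def hom_def M_def)
  qed (use Q.subgroup_imp_group[OF Msub] Q.noetherian_subgroup[OF _ Msub]
      Q.lengths_extend_subgroup[OF _ Msub] extension.prems in auto)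
  then have Mfc: "fin_index Q M (fc_center Q M)" by (simp add: fin_index_def fc_center_def)
  obtain Q1 :: "'a monoid" and q where q: "group_hom Q Q1 q" "q ` carrier Q = carrier Q1"
    "kernel Q Q1 q = M"
    using Q.quotient_in_type[OF M] by metis
  interpret q: group_hom Q Q1 q by (rule q(1))
  \<comment> \<open>The map that \<open>q \<circ> p\<close> induces on the image of \<open>K\<close>
    in \<open>Q0\<close>. It does not depend on the preimage, since two preimages differ by an
    element of \<open>K \<inter> ?N\<close>, which \<open>p\<close> sends into the kernel
    \<open>M\<close> of \<open>q\<close>.\<close>
  define \<sigma> where "\<sigma> y = q (p (inv_into K \<pi> y))" for y
  have \<sigma>: "\<sigma> (\<pi> k) = q (p k)" if k: "k \<in> K" for k
  proof -
    define l where "l = inv_into K \<pi> (\<pi> k)"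
    have l: "l \<in> K" "\<pi> l = \<pi> k" using k by (auto simp: l_def inv_into_into f_inv_into_f)
    have "l \<otimes>\<^bsub>G\<^esub> inv\<^bsub>G\<^esub> k \<in> K \<inter> ?N" using l k by (simp add: kernel_def)
    then have "p (l \<otimes>\<^bsub>G\<^esub> inv\<^bsub>G\<^esub> k) \<in> kernel Q Q1 q" unfolding q(3) M_def by blast
    moreover have "p l \<in> carrier Q" "p k \<in> carrier Q" using l k pK by blast+
    ultimately have "q (p l) \<otimes>\<^bsub>Q1\<^esub> inv\<^bsub>Q1\<^esub> q (p k) = \<one>\<^bsub>Q1\<^esub>"
      using l k by (simp add: kernel_def ph p\<pi>)
    then have "q (p l) = q (p k)"
      using \<open>p l \<in> _\<close> \<open>p k \<in> _\<close> by (simp add: q.H.inv_solve_right')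
    then show ?thesis by (simp add: \<sigma>_def l_def)
  qed
  have "fin_index Q1 (carrier Q1) (fc_center Q1 (carrier Q1))"
  proof (rule extension.IH(2))
    show "subgroup (\<pi> ` K) Q0" by (rule \<pi>.subgroup_img_is_subgroup[OF K])
    have "\<sigma> ` \<pi> ` K = q ` p ` K" using \<sigma> by (auto simp: image_image)
    then have im: "\<sigma> ` \<pi> ` K = carrier Q1" using pK q(2) by simp
    moreover have "\<sigma> (\<pi> k \<otimes>\<^bsub>Q0\<^esub> \<pi> l) = \<sigma> (\<pi> k) \<otimes>\<^bsub>Q1\<^esub> \<sigma> (\<pi> l)" if kl: "k \<in> K" "l \<in> K" for k l
    proof -
      have "p k \<in> carrier Q" "p l \<in> carrier Q" using kl pK by blast+
      moreover have "\<pi> k \<otimes>\<^bsub>Q0\<^esub> \<pi> l = \<pi> (k \<otimes>\<^bsub>G\<^esub> l)" using kl by simp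
      moreover have "\<sigma> (\<pi> (k \<otimes>\<^bsub>G\<^esub> l)) = q (p (k \<otimes>\<^bsub>G\<^esub> l))"
        by (rule \<sigma>) (use kl in simp)
      ultimately show ?thesis using kl ph \<sigma> by (metis q.hom_mult)
    qed
    ultimately show "\<sigma> \<in> epi (Q0\<lparr>carrier := \<pi> ` K\<rparr>) Q1"
      by (fastforce simp: epi_def hom_def)
  qed (use q.H.is_group q.noetherian_epi q.lengths_extend_epi q(2) extension.prems in auto)
  then show ?case
    using Mfc by (intro Q.fc_center_extension[OF _ _ q(1,2)]) (use extension.prems q(3) in auto)
next
  case (directed_union G \<K>)
  interpret G: group G by fact
  interpret Q: group Q by fact
  note K = \<open>subgroup K G\<close>
  have pK: "p ` K = carrier Q" and ph: "\<And>x y. x \<in> K \<Longrightarrow> y \<in> K \<Longrightarrow> p (x \<otimes>\<^bsub>G\<^esub> y) = p x \<otimes>\<^bsub>Q\<^esub> p y"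
    using \<open>p \<in> epi _ _\<close> by (auto simp: epi_def hom_def)
  obtain X where X: "finite X" "X \<subseteq> carrier Q" "generate Q X = carrier Q"
    using directed_union.prems(4) Q.subgroup_self unfolding noetherian_group_def by blast
  \<comment> \<open>By directedness, lifts of finitely many generators lie in one member
    \<open>L\<close>, so \<open>Q\<close> is already a section of \<open>L\<close>.\<close>
  have "\<exists>L\<in>\<K>. X \<subseteq> p ` (K \<inter> L)"
    using X(1,2)
  proof (induction X)
    case empty
    then show ?case using \<open>\<K> \<noteq> {}\<close> by auto
  next
    case (insert x X)
    then obtain L where L: "L \<in> \<K>" "X \<subseteq> p ` (K \<inter> L)" by auto
    have "x \<in> p ` K" using insert pK by auto
    then obtain k where k: "k \<in> K" "x = p k" by blast
    then have "k \<in> \<Union>\<K>" using subgroup.mem_carrier[OF K] directed_union.hyps(5) by auto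
    then obtain L' where L': "L' \<in> \<K>" "k \<in> L'" by blast
    obtain L'' where L'': "L'' \<in> \<K>" "L \<subseteq> L''" "L' \<subseteq> L''"
      using directed_union.hyps(4)[OF L(1) L'(1)] by blast
    have "insert x X \<subseteq> p ` (K \<inter> L'')" using L k L' L'' by blast
    then show ?case using L''(1) by blast
  qed
  then obtain L where L: "L \<in> \<K>" "X \<subseteq> p ` (K \<inter> L)" by blast
  have Lsub: "subgroup L G" by (rule directed_union.hyps(3)[OF L(1)])
  have KL: "subgroup (K \<inter> L) G" by (rule G.subgroups_Inter_pair[OF K Lsub])
  interpret p: group_hom "G\<lparr>carrier := K \<inter> L\<rparr>" Q p
    using G.subgroup_imp_group[OF KL] Q.is_group ph pK
    by (auto simp: group_hom_def group_hom_axioms_def hom_def)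
  have "carrier Q \<subseteq> p ` (K \<inter> L)"
    using Q.generate_subgroup_incl[OF L(2)] p.img_is_subgroup X(3) by simp
  then have "p \<in> epi (G\<lparr>carrier := L\<rparr>\<lparr>carrier := K \<inter> L\<rparr>) Q"
    using ph pK by (auto simp: epi_def hom_def)
  moreover have "subgroup (K \<inter> L) (G\<lparr>carrier := L\<rparr>)"
    by (rule G.subgroup_incl[OF KL Lsub]) auto
  ultimately show ?case
    using directed_union.IH[OF L(1)] directed_union.prems by blast
qed

section \<open>Isometric actions and their displacement lengths\<close>

lemma group_actionI:
  assumes "group G"
    and closed: "\<And>g x. g \<in> carrier G \<Longrightarrow> x \<in> E \<Longrightarrow> \<phi> g x \<in> E"
    and one: "\<And>x. x \<in> E \<Longrightarrow> \<phi> \<one>\<^bsub>G\<^esub> x = x"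
    and mult: "\<And>g h x. g \<in> carrier G \<Longrightarrow> h \<in> carrier G \<Longrightarrow> x \<in> E \<Longrightarrow> \<phi> (g \<otimes>\<^bsub>G\<^esub> h) x = \<phi> g (\<phi> h x)"
    and ext: "\<And>g. g \<in> carrier G \<Longrightarrow> \<phi> g \<in> extensional E"
  shows "group_action G E \<phi>"
proof -
  interpret group G by fact
  have "\<phi> g \<in> Bij E" if g: "g \<in> carrier G" for g
  proof -
    have "bij_betw (\<phi> g) E E"
      using g closed mult[of "inv\<^bsub>G\<^esub> g" g] mult[of g "inv\<^bsub>G\<^esub> g"] one
      by (intro bij_betw_byWitness[where f' = "\<phi> (inv\<^bsub>G\<^esub> g)"]) auto
    then show ?thesis using ext[OF g] by (simp add: Bij_def)
  qed
  moreover have "\<phi> (g \<otimes>\<^bsub>G\<^esub> h) = compose E (\<phi> g) (\<phi> h)"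
    if "g \<in> carrier G" "h \<in> carrier G" for g h
    by (rule extensionalityI[of _ E]) (use that ext mult in \<open>auto simp: compose_def\<close>)
  ultimately have "\<phi> \<in> hom G (BijGroup E)" by (auto simp: hom_def BijGroup_def)
  then show ?thesis
    by (simp add: group_action_def group_hom_def group_hom_axioms_def group_BijGroup is_group)
qed

lemma isometric_actionD:
  assumes "isometric_action G S d \<phi>"
  shows "Metric_space S d" "\<And>g x. g \<in> carrier G \<Longrightarrow> x \<in> S \<Longrightarrow> \<phi> g x \<in> S"
    "\<And>x. x \<in> S \<Longrightarrow> \<phi> \<one>\<^bsub>G\<^esub> x = x"
    "\<And>g h x. g \<in> carrier G \<Longrightarrow> h \<in> carrier G \<Longrightarrow> x \<in> S \<Longrightarrow> \<phi> (g \<otimes>\<^bsub>G\<^esub> h) x = \<phi> g (\<phi> h x)"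
    "\<And>g x y. g \<in> carrier G \<Longrightarrow> x \<in> S \<Longrightarrow> y \<in> S \<Longrightarrow> d (\<phi> g x) (\<phi> g y) = d x y"
proof -
  interpret group_action G S \<phi> using assms by (simp add: isometric_action_def)
  show "Metric_space S d" "\<And>g x y. g \<in> carrier G \<Longrightarrow> x \<in> S \<Longrightarrow> y \<in> S \<Longrightarrow> d (\<phi> g x) (\<phi> g y) = d x y"
    using assms by (simp_all add: isometric_action_def)
  show "\<And>g x. g \<in> carrier G \<Longrightarrow> x \<in> S \<Longrightarrow> \<phi> g x \<in> S" using element_image by blast
  show "\<And>x. x \<in> S \<Longrightarrow> \<phi> \<one>\<^bsub>G\<^esub> x = x" using id_eq_one by (metis restrict_apply')
  show "\<And>g h x. g \<in> carrier G \<Longrightarrow> h \<in> carrier G \<Longrightarrow> x \<in> S \<Longrightarrow> \<phi> (g \<otimes>\<^bsub>G\<^esub> h) x = \<phi> g (\<phi> h x)"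
    using composition_rule by blast
qed

text \<open>\<open>H\<close> acts on itself by left translation with a distance built from
  \<open>L (inv g \<otimes> h)\<close>; countability allows a copy of \<open>H\<close> inside
  \<open>'r\<close>. An extension to \<open>G\<close> yields the displacement \<open>N\<close> of
  the image of the base point, and coarse equivariance at that one point compares \<open>N\<close>
  with \<open>L\<close>.\<close>

lemma (in group) extension_problem_solvable_imp_lengths_extend:
  assumes count: "countable (carrier G)" and inf: "infinite (UNIV :: 'r set)"
    and solv: "\<And>H. subgroup H G \<Longrightarrow> extension_problem_solvable TYPE('r) G H"
  shows "lengths_extend G"
  unfolding lengths_extend_def
proof (intro allI impI)
  fix H L assume H: "subgroup H G" and L: "length_on G H L"
  interpret H: subgroup H G by (rule H)
  let ?H = "G\<lparr>carrier := H\<rparr>"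
  obtain u :: "nat \<Rightarrow> 'r" where u: "inj u" using infinite_countable_subset[OF inf] by blast
  have "countable H" using count H.subset countable_subset by blast
  then obtain v :: "'a \<Rightarrow> nat" where "inj_on v H" by (auto simp: countable_def)
  then have inj: "inj_on (u \<circ> v) H" using u by (simp add: comp_inj_on inj_on_subset)
  define e where "e = u \<circ> v"
  define R where "R = e ` H"
  define i where "i = inv_into H e"
  have ie: "i (e h) = h" if "h \<in> H" for h
    unfolding i_def using inv_into_f_f[OF inj[folded e_def] that] .
  have eR: "e h \<in> R" if "h \<in> H" for h using that by (simp add: R_def)
  have iH: "i r \<in> H" and ei: "e (i r) = r" if "r \<in> R" for r
    using that by (auto simp: R_def i_def inv_into_into f_inv_into_f)
  \<comment> \<open>\<open>L\<close> may vanish off the identity, so one is added between distinct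
    points to obtain a metric.\<close>
  define d where "d r s = (if r \<in> R \<and> s \<in> R \<and> r \<noteq> s then L (inv (i r) \<otimes> i s) + 1 else 0)" for r s
  define \<phi> where "\<phi> h = (\<lambda>r\<in>R. e (h \<otimes> i r))" for h
  have Lnn: "0 \<le> L h" if "h \<in> H" for h using length_onD(2)[OF L that] .
  have Linv: "L (inv g \<otimes> h) = L (inv h \<otimes> g)" if "g \<in> H" "h \<in> H" for g h
    using length_onD(3)[OF L, of "inv g \<otimes> h"] that by (simp add: inv_mult_group)
  have Ltri: "L (inv g \<otimes> k) \<le> L (inv g \<otimes> h) + L (inv h \<otimes> k)" if "g \<in> H" "h \<in> H" "k \<in> H" for g h k
    using length_onD(4)[OF L, of "inv g \<otimes> h" "inv h \<otimes> k"] that by (simp add: m_assoc inv_cancel_left)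
  have M: "Metric_space R d"
  proof
    show "0 \<le> d r s" for r s
      using Lnn[of "inv (i r) \<otimes> i s"] iH by (auto simp: d_def)
    show "d r s = d s r" for r s using Linv iH by (auto simp: d_def)
    show "d r s = 0 \<longleftrightarrow> r = s" if "r \<in> R" "s \<in> R" for r s
      using Lnn[of "inv (i r) \<otimes> i s"] iH that by (auto simp: d_def)
    show "d r t \<le> d r s + d s t" if "r \<in> R" "s \<in> R" "t \<in> R" for r s t
      using Lnn[of "inv (i r) \<otimes> i s"] Lnn[of "inv (i s) \<otimes> i t"] Ltri[of "i r" "i s" "i t"] iH that
      by (auto simp: d_def)
  qed
  have \<phi>R: "\<phi> h r \<in> R" "i (\<phi> h r) = h \<otimes> i r" if "h \<in> H" "r \<in> R" for h r
    using that iH eR ie by (auto simp: \<phi>_def)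
  have "group_action ?H R \<phi>"
  proof (rule group_actionI)
    show "group ?H" by (rule subgroup_imp_group[OF H])
    show "\<phi> g r \<in> R" if "g \<in> carrier ?H" "r \<in> R" for g r using that \<phi>R by simp
    show "\<phi> \<one>\<^bsub>?H\<^esub> r = r" if "r \<in> R" for r using that ei iH by (simp add: \<phi>_def)
    show "\<phi> (g \<otimes>\<^bsub>?H\<^esub> h) r = \<phi> g (\<phi> h r)"
      if "g \<in> carrier ?H" "h \<in> carrier ?H" "r \<in> R" for g h r
    proof -
      have "\<phi> g (\<phi> h r) = e (g \<otimes> (h \<otimes> i r))" using that \<phi>R by (simp add: \<phi>_def[of g])
      then show ?thesis using that iH by (simp add: \<phi>_def m_assoc)
    qed
    show "\<phi> g \<in> extensional R" for g by (simp add: \<phi>_def)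
  qed
  moreover have "d (\<phi> h r) (\<phi> h s) = d r s" if "h \<in> H" "r \<in> R" "s \<in> R" for h r s
  proof -
    have "\<phi> h r = \<phi> h s \<longleftrightarrow> r = s"
      using \<phi>R[OF that(1,2)] \<phi>R[OF that(1,3)] that iH ei by (metis H.mem_carrier inv_cancel_left(1))
    moreover have "inv (h \<otimes> i r) \<otimes> (h \<otimes> i s) = inv (i r) \<otimes> i s"
      using that iH by (simp add: inv_mult_group m_assoc inv_cancel_left)
    ultimately show ?thesis using \<phi>R that by (simp add: d_def)
  qed
  ultimately have "isometric_action ?H R d \<phi>" using M by (simp add: isometric_action_def)
  then obtain S :: "('a \<times> 'r) set" and dS \<psi> where "extends_action G H R d \<phi> S dS \<psi>"
    using solv[OF H] unfolding extension_problem_solvable_def by blast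
  then obtain f where iso: "isometric_action G S dS \<psi>" and ce: "coarsely_equivariant H R \<phi> dS \<psi> f"
    and qi: "quasi_isometric_embedding R d S dS f"
    unfolding extends_action_def by blast
  interpret S: Metric_space S dS using iso by (rule isometric_actionD)
  note \<psi>S = isometric_actionD(2)[OF iso] and \<psi>1 = isometric_actionD(3)[OF iso]
    and \<psi>m = isometric_actionD(4)[OF iso] and isom = isometric_actionD(5)[OF iso]
  obtain C where fS: "f \<in> R \<rightarrow> S" and C: "C > 0"
    and q: "\<And>x y. x \<in> R \<Longrightarrow> y \<in> R \<Longrightarrow> 1 / C * d x y - C \<le> dS (f x) (f y) \<and> dS (f x) (f y) \<le> C * d x y + C"
    using qi unfolding quasi_isometric_embedding_def by metis
  define x0 where "x0 = e \<one>"
  define s where "s = f x0"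
  have x0: "x0 \<in> R" "i x0 = \<one>" using eR ie by (auto simp: x0_def)
  have s: "s \<in> S" using fS x0 by (auto simp: s_def)
  define N where "N g = dS s (\<psi> g s)" for g
  obtain D where D: "\<And>h. h \<in> H \<Longrightarrow> dS (f (\<phi> h x0)) (\<psi> h s) \<le> D"
    using ce x0 unfolding coarsely_equivariant_def bdd_above_def s_def by blast
  have D0: "0 \<le> D" by (rule order_trans[OF S.nonneg D[OF H.one_closed]])
  have N: "length_on G (carrier G) N"
    unfolding length_on_def
  proof (intro conjI ballI)
    show "N \<one> = 0" using s by (simp add: N_def \<psi>1)
    fix g assume g: "g \<in> carrier G"
    show "0 \<le> N g" by (simp add: N_def)
    show "N (inv g) = N g"
    proof -
      have "N (inv g) = dS (\<psi> g s) (\<psi> g (\<psi> (inv g) s))"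
        unfolding N_def using isom[of g s "\<psi> (inv g) s"] g s \<psi>S by simp
      also have "\<psi> g (\<psi> (inv g) s) = s" using \<psi>m[of g "inv g" s] g s \<psi>1 by simp
      finally show ?thesis by (simp add: N_def S.commute)
    qed
    fix h assume h: "h \<in> carrier G"
    have "N (g \<otimes> h) \<le> dS s (\<psi> g s) + dS (\<psi> g s) (\<psi> g (\<psi> h s))"
      unfolding N_def using \<psi>m[OF g h s] S.triangle[of s "\<psi> g s" "\<psi> g (\<psi> h s)"] s \<psi>S g h by simp
    then show "N (g \<otimes> h) \<le> N g + N h" using isom[of g s "\<psi> h s"] g h s \<psi>S by (simp add: N_def)
  qed
  \<comment> \<open>One constant serves both affine bounds: their slopes are \<open>C\<close>, their
    offsets \<open>C * (C + D)\<close> and \<open>2 * C + D\<close>. In the latter, one of the two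
    \<open>C\<close> stems from the one added to the metric.\<close>
  define C' where "C' = C + C * (C + D) + 2 * C + D"
  have C': "C' > 0" "C \<le> C'" "C * (C + D) \<le> C'" "2 * C + D \<le> C'"
    using C D0 by (auto simp: C'_def intro!: add_pos_nonneg)
  have "L h \<le> C' * N h + C' \<and> N h \<le> C' * L h + C'" if h: "h \<in> H" for h
  proof -
    have hx: "\<phi> h x0 \<in> R" "i (\<phi> h x0) = h" using \<phi>R[OF h x0(1)] x0 h by auto
    have hs: "\<psi> h s \<in> S" "f (\<phi> h x0) \<in> S" using \<psi>S h s fS hx by auto
    have "L \<one> = 0" by (rule length_onD(1)[OF L])
    then have d: "L h \<le> d x0 (\<phi> h x0)" "d x0 (\<phi> h x0) \<le> L h + 1"
      using x0 hx h Lnn[OF h] by (auto simp: d_def)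
    have nn: "0 \<le> N h" "0 \<le> L h" using Lnn[OF h] by (auto simp: N_def)
    have 1: "1 / C * d x0 (\<phi> h x0) - C \<le> dS s (f (\<phi> h x0))" "dS s (f (\<phi> h x0)) \<le> C * d x0 (\<phi> h x0) + C"
      using q[OF x0(1) hx(1)] by (auto simp: s_def)
    have 2: "dS s (f (\<phi> h x0)) \<le> N h + D"
      using S.triangle[of s "\<psi> h s" "f (\<phi> h x0)"] D[OF h] s hs S.commute[of "f (\<phi> h x0)" "\<psi> h s"]
      by (simp add: N_def)
    have 3: "N h \<le> dS s (f (\<phi> h x0)) + D"
      using S.triangle[of s "f (\<phi> h x0)" "\<psi> h s"] D[OF h] s hs by (simp add: N_def)
    have "1 / C * d x0 (\<phi> h x0) \<le> N h + D + C" using 1(1) 2 by linarith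
    then have "d x0 (\<phi> h x0) \<le> C * (N h + D + C)" using C by (simp add: field_simps)
    then have "L h \<le> C * N h + C * (C + D)" using d(1) by (simp add: algebra_simps)
    also have "\<dots> \<le> C' * N h + C'" using C' nn by (intro add_mono mult_right_mono) auto
    finally have L: "L h \<le> C' * N h + C'" .
    have "C * d x0 (\<phi> h x0) \<le> C * (L h + 1)" using d(2) C by (intro mult_left_mono) auto
    then have "N h \<le> C * L h + (2 * C + D)" using 3 1(2) by (simp add: algebra_simps)
    also have "\<dots> \<le> C' * L h + C'" using C' nn by (intro add_mono mult_right_mono) auto
    finally show ?thesis using L by blast
  qed
  then show "\<exists>M C. length_on G (carrier G) M \<and> C > 0 \<and>
      (\<forall>h\<in>H. L h \<le> C * M h + C \<and> M h \<le> C * L h + C)"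
    using N C' by blast
qed

section \<open>Free abelian subgroups of finite index\<close>

context comm_group
begin

text \<open>Descent on \<open>\<Sum>s\<in>S. \<bar>c s\<bar>\<close>: if two exponents \<open>c s\<close>, \<open>c t\<close> are nonzero and
  \<open>\<bar>c t\<bar> \<le> \<bar>c s\<bar>\<close>, replacing the generator \<open>t\<close> by \<open>t s\<^sup>\<plusminus>\<^sup>1\<close> lowers \<open>\<bar>c s\<bar>\<close>.\<close>

lemma minimal_generating_independent:
  assumes tf: "\<And>x n. x \<in> carrier G \<Longrightarrow> n > 0 \<Longrightarrow> x [^] (n::nat) = \<one> \<Longrightarrow> x = \<one>"
    and min: "\<And>S. finite S \<Longrightarrow> S \<subseteq> carrier G \<Longrightarrow> generate G S = carrier G \<Longrightarrow> n \<le> card S"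
  shows "\<lbrakk>finite S; S \<subseteq> carrier G; generate G S = carrier G; card S = n;
    (\<Otimes>s\<in>S. s [^] (c s :: int)) = \<one>; s \<in> S\<rbrakk> \<Longrightarrow> c s = 0"
proof (induction "\<Sum>s\<in>S. nat \<bar>c s\<bar>" arbitrary: S c s rule: less_induct)
  case less
  note S = less.prems(1-4) and rel = less.prems(5)
  have gen: "generate G S' = carrier G" if "S' \<subseteq> carrier G" "S \<subseteq> generate G S'" for S'
    using generate_subgroup_incl[OF that(2) generate_is_subgroup[OF that(1)]] generate_incl[OF that(1)] S(3)
    by blast
  have fp: "(\<Otimes>u\<in>insert a V. u [^] f u) = a [^] f a \<otimes> (\<Otimes>u\<in>V. u [^] f u)"
    if "finite V" "a \<notin> V" "a \<in> carrier G" "V \<subseteq> carrier G" for a V and f :: "'a \<Rightarrow> int"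
    using that by (intro finprod_insert) auto
  have step: False
    if st: "s \<in> S" "t \<in> S" "s \<noteq> t" "c t \<noteq> 0" "\<bar>c t\<bar> \<le> \<bar>c s\<bar>" for s t
  proof -
    have sc: "s \<in> carrier G" "t \<in> carrier G" using st S(2) by auto
    define U where "U = S - {s, t}"
    have U: "finite U" "s \<notin> U" "t \<notin> U" "S = insert s (insert t U)" "U \<subseteq> carrier G"
      using S st by (auto simp: U_def)
    \<comment> \<open>With this sign, \<open>e * c t\<close> has the sign of \<open>c s\<close> and
      modulus \<open>\<bar>c t\<bar>\<close>, so \<open>c s - e * c t\<close> has modulus
      \<open>\<bar>c s\<bar> - \<bar>c t\<bar>\<close>.\<close>
    define e where "e = sgn (c s) * sgn (c t)"
    define t' where "t' = t \<otimes> s [^] e"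
    have t'c: "t' \<in> carrier G" using sc by (simp add: t'_def)
    define S' where "S' = insert s (insert t' U)"
    have S': "finite S'" "S' \<subseteq> carrier G" using U sc t'c by (auto simp: S'_def)
    have gS': "generate G S' = carrier G"
    proof (rule gen[OF S'(2)])
      have "s \<in> generate G S'" "t' \<in> generate G S'" and US: "U \<subseteq> generate G S'"
        by (auto simp: S'_def intro: generate.incl)
      moreover have "t = t' \<otimes> inv (s [^] e)"
        using sc by (simp add: t'_def m_assoc)
      ultimately have "t \<in> generate G S'"
        using generate_is_subgroup[OF S'(2)] subgroup_int_pow_closed
        by (metis generate.eng subgroup.m_inv_closed)
      then show "S \<subseteq> generate G S'"
        using \<open>s \<in> generate G S'\<close> US U(4) by blast
    qed
    have cS: "card S = Suc (Suc (card U))" using U st(3) by simp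
    \<comment> \<open>If the new generator coincided with an old one, \<open>S'\<close> would
      generate with fewer than \<open>n\<close> elements.\<close>
    have t'U: "t' \<notin> insert s U"
    proof
      assume "t' \<in> insert s U"
      then have "S' = insert s U" by (auto simp: S'_def)
      then have "card S' < card S" using cS U by simp
      then show False using min[OF S' gS'] S(4) by simp
    qed
    have st': "s \<noteq> t'" "s \<notin> insert t' U" "t' \<notin> U" using t'U U by auto
    define c' where "c' = c(s := c s - e * c t, t' := c t)"
    have c': "c' s = c s - e * c t" "c' t' = c t" "\<And>u. u \<in> U \<Longrightarrow> c' u = c u"
      using t'U U st by (auto simp: c'_def)
    have pw: "s [^] c s \<otimes> t [^] c t = s [^] c' s \<otimes> t' [^] c' t'"
    proof -
      have "t' [^] c t = t [^] c t \<otimes> s [^] (e * c t)"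
        using sc by (simp add: t'_def int_pow_distrib int_pow_pow)
      then have "s [^] c' s \<otimes> t' [^] c' t' = (s [^] (c s - e * c t) \<otimes> s [^] (e * c t)) \<otimes> t [^] c t"
        using sc c' by (simp add: m_ac)
      also have "s [^] (c s - e * c t) \<otimes> s [^] (e * c t) = s [^] c s"
        using sc by (simp add: int_pow_mult[symmetric])
      finally show ?thesis by simp
    qed
    have "(\<Otimes>u\<in>S'. u [^] c' u) = s [^] c' s \<otimes> (t' [^] c' t' \<otimes> (\<Otimes>u\<in>U. u [^] c' u))"
      unfolding S'_def using fp[of "insert t' U" s c'] fp[of U t' c'] U(1,2,5) t'U sc t'c by auto
    also have "(\<Otimes>u\<in>U. u [^] c' u) = (\<Otimes>u\<in>U. u [^] c u)"
      using U(5) c'(3) by (intro finprod_cong') auto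
    also have "s [^] c' s \<otimes> (t' [^] c' t' \<otimes> (\<Otimes>u\<in>U. u [^] c u))
        = s [^] c s \<otimes> (t [^] c t \<otimes> (\<Otimes>u\<in>U. u [^] c u))"
    proof -
      define p where "p = (\<Otimes>u\<in>U. u [^] c u)"
      have "p \<in> carrier G" unfolding p_def using U(5) by (intro finprod_closed) auto
      then show ?thesis
        using pw sc t'c m_assoc[of "s [^] c' s" "t' [^] c' t'" p] m_assoc[of "s [^] c s" "t [^] c t" p]
        unfolding p_def[symmetric] by simp
    qed
    also have "\<dots> = (\<Otimes>u\<in>S. u [^] c u)"
      unfolding U(4) using fp[of "insert t U" s c] fp[of U t c] U(1,2,3,5) st(3) sc by auto
    finally have rel': "(\<Otimes>u\<in>S'. u [^] c' u) = \<one>" using rel by simp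
    have "\<bar>c s - e * c t\<bar> < \<bar>c s\<bar>"
      using st(4,5) unfolding e_def
      by (cases "c s > 0"; cases "c t > 0") (simp_all add: sgn_if)
    then have "nat \<bar>c' s\<bar> < nat \<bar>c s\<bar>" using c' by simp
    moreover have "(\<Sum>u\<in>U. nat \<bar>c' u\<bar>) = (\<Sum>u\<in>U. nat \<bar>c u\<bar>)" using c'(3) by simp
    ultimately have lt: "(\<Sum>u\<in>S'. nat \<bar>c' u\<bar>) < (\<Sum>u\<in>S. nat \<bar>c u\<bar>)"
      unfolding S'_def U(4) using U(1-3) st' st(3) c'(2) by simp
    have "card S' = n" using cS st' U(1) S(4) by (simp add: S'_def)
    \<comment> \<open>The exponent of \<open>t'\<close> is still the nonzero \<open>c t\<close>, but
      the induction hypothesis for the smaller sum makes it zero.\<close>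
    then have "c' t' = 0" by (rule less.hyps[OF lt S' gS' _ rel']) (simp add: S'_def)
    then show False using c'(2) st(4) by simp
  qed
  show ?case
  proof (rule ccontr)
    assume cs: "c s \<noteq> 0"
    have sc: "s \<in> carrier G" using less.prems by auto
    show False
    proof (cases "\<exists>t\<in>S. t \<noteq> s \<and> c t \<noteq> 0")
      case True
      then obtain t where t: "t \<in> S" "t \<noteq> s" "c t \<noteq> 0" by blast
      show False
      proof (cases "\<bar>c t\<bar> \<le> \<bar>c s\<bar>")
        case True
        then show False using step[OF less.prems(6) t(1)] t by blast
      next
        case False
        then show False using step[OF t(1) less.prems(6) t(2) cs] by linarith
      qed
    next
      case False
      then have "(\<Otimes>u\<in>S. u [^] c u) = (\<Otimes>u\<in>S. if s = u then u [^] c u else \<one>)"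
        using S(2) sc by (intro finprod_cong') auto
      also have "\<dots> = s [^] c s"
        using S(1,2) less.prems(6) by (intro finprod_singleton) auto
      finally have "s [^] c s = \<one>" using rel by simp
      then have "s [^] \<bar>c s\<bar> = \<one>" using sc by (auto simp: abs_if int_pow_neg)
      then have "s [^] nat \<bar>c s\<bar> = \<one>" by (simp flip: int_pow_int)
      then have "s = \<one>" using tf[OF sc, of "nat \<bar>c s\<bar>"] cs by simp
      then have "S \<subseteq> generate G (S - {s})" by (auto intro: generate.intros)
      then have "generate G (S - {s}) = carrier G" using S(2) by (intro gen) auto
      then have "n \<le> card (S - {s})" using S by (intro min) auto
      moreover have "card (S - {s}) < n" using card_Diff1_less[OF S(1) less.prems(6)] S(4) by metis
      ultimately show False by linarith
    qed
  qed
qed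

text \<open>A generating set of least cardinality is a basis: evaluation on the free abelian group
  over it is onto by generation and injective by independence. The basis lies in the group itself,
  as \<open>free_abelian\<close> demands.\<close>

lemma free_abelian_if_torsion_free:
  assumes fg: "finite X" "X \<subseteq> carrier G" "generate G X = carrier G"
    and tf: "\<And>x n. x \<in> carrier G \<Longrightarrow> n > 0 \<Longrightarrow> x [^] (n::nat) = \<one> \<Longrightarrow> x = \<one>"
  shows "free_abelian G"
proof -
  define P where "P S \<longleftrightarrow> finite S \<and> S \<subseteq> carrier G \<and> generate G S = carrier G" for S
  define S where "S = arg_min card P"
  have "P X" using fg by (simp add: P_def)
  then have PS: "P S" and min: "\<And>S'. P S' \<Longrightarrow> card S \<le> card S'"
    unfolding S_def using arg_min_nat_lemma[of P X card] by auto
  have S: "finite S" "S \<subseteq> carrier G" "generate G S = carrier G" using PS by (auto simp: P_def)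
  let ?F = "free_Abelian_group S"
  define h where "h x = (\<Otimes>s\<in>S. s [^] Poly_Mapping.lookup x s)" for x :: "'a \<Rightarrow>\<^sub>0 int"
  have hom: "h \<in> hom ?F G"
  proof (rule homI)
    show "h x \<in> carrier G" for x unfolding h_def using S by (intro finprod_closed) auto
    show "h (x \<otimes>\<^bsub>?F\<^esub> y) = h x \<otimes> h y" for x y
    proof -
      have "h (x \<otimes>\<^bsub>?F\<^esub> y)
          = (\<Otimes>s\<in>S. s [^] Poly_Mapping.lookup x s \<otimes> s [^] Poly_Mapping.lookup y s)"
        unfolding h_def using S(2)
        by (intro finprod_cong') (auto simp: lookup_add int_pow_mult)
      also have "\<dots> = h x \<otimes> h y" unfolding h_def using S(2) by (intro finprod_multf) auto
      finally show ?thesis .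
    qed
  qed
  interpret h: group_hom ?F G h
    using hom by (simp add: group_hom_def group_hom_axioms_def)
  have h_of: "h (frag_of s) = s" if s: "s \<in> S" for s
  proof -
    have "h (frag_of s) = (\<Otimes>u\<in>S. if s = u then u else \<one>)"
      unfolding h_def using S(2) by (intro finprod_cong') auto
    also have "\<dots> = s" using S(1,2) s by (intro finprod_singleton) auto
    finally show ?thesis .
  qed
  have "S \<subseteq> h ` carrier ?F"
  proof
    fix s assume "s \<in> S"
    moreover from this have "frag_of s \<in> carrier ?F" by simp
    ultimately show "s \<in> h ` carrier ?F" using h_of by (metis imageI)
  qed
  then have "carrier G \<subseteq> h ` carrier ?F"
    using generate_subgroup_incl[OF _ h.img_is_subgroup] S(3) by blast
  then have surj: "h ` carrier ?F = carrier G" by auto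
  have "x = 0" if x: "x \<in> carrier ?F" "h x = \<one>" for x
  proof (rule poly_mapping_eqI)
    fix s
    show "Poly_Mapping.lookup x s = Poly_Mapping.lookup 0 s"
    proof (cases "s \<in> S")
      case True
      have "Poly_Mapping.lookup x s = 0"
        by (rule minimal_generating_independent[OF tf _ S refl _ True, where c = "Poly_Mapping.lookup x"])
          (use min x in \<open>auto simp: P_def h_def\<close>)
      then show ?thesis by simp
    next
      case False
      then have "s \<notin> Poly_Mapping.keys x" using x(1) by auto
      then show ?thesis by (simp add: in_keys_iff)
    qed
  qed
  then have "kernel ?F G h = {\<one>\<^bsub>?F\<^esub>}" using h.hom_one by (auto simp: kernel_def)
  then have "inj_on h (carrier ?F)" by (simp add: h.inj_iff_trivial_ker)
  then have "h \<in> iso ?F G" using hom surj by (simp add: iso_def bij_betw_def)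
  then have "?F \<cong> G" by (rule is_isoI)
  then have "G \<cong> ?F" by (rule group.iso_sym[OF group_free_Abelian_group])
  then show ?thesis unfolding free_abelian_def by blast
qed

end

section \<open>The free abelian subgroup and its sign\<close>

context group
begin

text \<open>Normality identifies right cosets with the left cosets that \<open>fin_index\<close>
  counts.\<close>

lemma finite_rcosets_iff_fin_index:
  assumes A: "A \<lhd> G"
  shows "finite (rcosets A) \<longleftrightarrow> fin_index G (carrier G) A"
proof
  interpret A: normal A G by fact
  have iff: "A #> x = A #> y \<longleftrightarrow> inv y \<otimes> x \<in> A" if xy: "x \<in> carrier G" "y \<in> carrier G" for x y
  proof -
    have "A #> x = A #> y \<longleftrightarrow> x \<otimes> inv y \<in> A"
      using A.rcos_module[OF is_group xy(2,1)] rcos_self[OF xy(1) A.is_subgroup]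
        repr_independence[OF _ xy(2) A.is_subgroup] by metis
    also have "\<dots> \<longleftrightarrow> inv y \<otimes> x \<in> A"
    proof
      assume "x \<otimes> inv y \<in> A"
      from A.inv_op_closed1[OF xy(2) this] show "inv y \<otimes> x \<in> A" using xy by (simp add: m_assoc)
    next
      assume "inv y \<otimes> x \<in> A"
      from A.inv_op_closed2[OF xy(2) this] show "x \<otimes> inv y \<in> A" using xy by (simp add: inv_cancel_left)
    qed
    finally show ?thesis .
  qed
  show "fin_index G (carrier G) A" if "finite (rcosets A)"
  proof (rule fin_indexI[OF subgroup_self, of "\<lambda>x. A #> x"])
    show "finite ((\<lambda>x. A #> x) ` carrier G)"
      using that by (simp add: RCOSETS_def UNION_singleton_eq_range)
  qed (metis iff)
  assume "fin_index G (carrier G) A"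
  then obtain f where f: "finite (f ` carrier G)" "f ` carrier G \<subseteq> carrier G"
    "\<And>x. x \<in> carrier G \<Longrightarrow> inv (f x) \<otimes> x \<in> A"
    using fin_indexE[OF _ _ A.subset] by blast
  have "rcosets A \<subseteq> (\<lambda>x. A #> x) ` f ` carrier G"
  proof
    fix R assume "R \<in> rcosets A"
    then obtain x where x: "x \<in> carrier G" "R = A #> x" by (auto simp: RCOSETS_def)
    then have "R = A #> f x" using iff[of x "f x"] f by blast
    then show "R \<in> (\<lambda>x. A #> x) ` f ` carrier G" using x by blast
  qed
  then show "finite (rcosets A)" using f(1) finite_subset by blast
qed

text \<open>\<open>A\<close> consists of the \<open>e\<close>-th powers in the centre
  \<open>B\<close> of the FC-centre, where \<open>e\<close> is the order of the torsion subgroup: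
  this removes torsion and keeps normality and finite index. In a torsion-free abelian group
  \<open>c [^] n = u [^] n\<close> forces \<open>c = u\<close>, so conjugation fixes or inverts each
  single element of \<open>A\<close>; that it treats all of them alike is seen on products.\<close>

lemma virtually_fc_imp_conj_by_sign:
  assumes noeth: "noetherian_group G" and ext: "lengths_extend G"
    and fc: "fin_index G (carrier G) (fc_center G (carrier G))"
  shows "\<exists>A. A \<lhd> G \<and> finite (rcosets A) \<and> free_abelian (G\<lparr>carrier := A\<rparr>) \<and>
    (\<exists>\<epsilon>\<in>hom G sign_img. \<forall>g\<in>carrier G. \<forall>a\<in>A. g \<otimes> a \<otimes> inv g = a [^] \<epsilon> g)"
proof -
  obtain B where B: "B \<lhd> G" and Bfc: "B \<subseteq> fc_center G (carrier G)"
    and comm: "\<And>a b. a \<in> B \<Longrightarrow> b \<in> B \<Longrightarrow> a \<otimes> b = b \<otimes> a"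
    and fcB: "fin_index G (fc_center G (carrier G)) B"
    using center_of_fc_center[OF noeth normal_self] by metis
  interpret B: normal B G by (rule B)
  have GB: "fin_index G (carrier G) B"
    using fin_index_trans[OF fc fcB _ _ B.subset subgroup_self] by (auto simp: fc_center_def)
  define T where "T = torsion B"
  have T: "finite T" "subgroup T G"
    unfolding T_def using finite_torsion[OF noeth B.is_subgroup comm] by blast+
  define e where "e = card T"
  have "\<one> \<in> T" using subgroup.one_closed[OF T(2)] .
  then have e: "e > 0" using T(1) by (auto simp: e_def card_gt_0_iff)
  have Te: "t [^] e = \<one>" if "t \<in> T" for t
  proof -
    interpret T: group "G\<lparr>carrier := T\<rparr>" by (rule subgroup_imp_group[OF T(2)])
    have "t [^]\<^bsub>G\<lparr>carrier := T\<rparr>\<^esub> e = \<one>"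
      using T.pow_order_eq_1[of t] that by (simp add: order_def e_def)
    then show ?thesis by (simp flip: nat_pow_consistent)
  qed
  have Bpow: "b [^] (n::nat) \<in> B" if "b \<in> B" for b n
    using subgroup_int_pow_closed[OF B.is_subgroup that, of "int n"] by (simp add: int_pow_int)
  define A where "A = (\<lambda>b. b [^] e) ` B"
  have AB: "A \<subseteq> B" using Bpow by (auto simp: A_def)
  have A: "A \<lhd> G"
  proof (rule normal_invI)
    show "subgroup A G"
    proof
      show "A \<subseteq> carrier G" using AB B.subset by blast
      have "\<one> = \<one> [^] e" by simp
      then show "\<one> \<in> A" unfolding A_def using B.one_closed by blast
      show "inv x \<in> A" if x: "x \<in> A" for x
      proof -
        obtain b where b: "b \<in> B" "x = b [^] e" using x by (auto simp: A_def)
        then have "inv x = inv b [^] e" by (simp add: nat_pow_inv)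
        then show ?thesis using b by (auto simp: A_def)
      qed
      show "x \<otimes> y \<in> A" if xy: "x \<in> A" "y \<in> A" for x y
      proof -
        obtain b c where b: "b \<in> B" "x = b [^] e" and c: "c \<in> B" "y = c [^] e"
          using xy by (auto simp: A_def)
        then have "x \<otimes> y = (b \<otimes> c) [^] e" using pow_mult_distrib[OF comm[OF b(1) c(1)]] by simp
        then show ?thesis using b c by (auto simp: A_def)
      qed
    qed
    fix g a assume g: "g \<in> carrier G" and "a \<in> A"
    then obtain b where b: "b \<in> B" "a = b [^] e" by (auto simp: A_def)
    then have "g \<otimes> a \<otimes> inv g = (g \<otimes> b \<otimes> inv g) [^] e" using g by (simp add: conj_nat_pow)
    then show "g \<otimes> a \<otimes> inv g \<in> A" using B.inv_op_closed2[OF g b(1)] by (simp add: A_def)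
  qed
  interpret A: normal A G by (rule A)
  have Acomm: "a \<otimes> b = b \<otimes> a" if "a \<in> A" "b \<in> A" for a b using comm that AB by blast
  \<comment> \<open>An \<open>e\<close>-th power of finite order comes from a torsion element, whose
    \<open>e\<close>-th power is trivial.\<close>
  have tf: "a = \<one>" if a: "a \<in> A" "n > 0" "a [^] (n::nat) = \<one>" for a n
  proof -
    obtain b where b: "b \<in> B" "a = b [^] e" using a by (auto simp: A_def)
    then have "b [^] (e * n) = \<one>" using a by (simp add: nat_pow_pow)
    moreover have "0 < e * n" using e a by simp
    ultimately have "b \<in> T" using b unfolding T_def by blast
    then show ?thesis using Te b by simp
  qed
  obtain X where X: "finite X" "X \<subseteq> B" "generate G X = B"
    using noeth B.is_subgroup unfolding noetherian_group_def by blast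
  have "fin_index G B A"
    by (rule fin_index_torsion[OF B.is_subgroup comm X A.is_subgroup AB]) (use e in \<open>auto simp: A_def\<close>)
  then have "fin_index G (carrier G) A"
    using fin_index_trans[OF GB _ _ B.subset A.subset subgroup_self] by simp
  then have fin: "finite (rcosets A)" using finite_rcosets_iff_fin_index[OF A] by simp
  have free: "free_abelian (G\<lparr>carrier := A\<rparr>)"
  proof -
    interpret CA: comm_group "G\<lparr>carrier := A\<rparr>"
      by (rule group.group_comm_groupI[OF subgroup_imp_group[OF A.is_subgroup]]) (simp add: Acomm)
    obtain Y where Y: "finite Y" "Y \<subseteq> A" "generate G Y = A"
      using noeth A.is_subgroup unfolding noetherian_group_def by blast
    show ?thesis
    proof (rule CA.free_abelian_if_torsion_free[OF Y(1)])
      show "generate (G\<lparr>carrier := A\<rparr>) Y = carrier (G\<lparr>carrier := A\<rparr>)"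
        using generate_consistent[OF Y(2) A.is_subgroup] Y(3) by simp
      show "x = \<one>\<^bsub>G\<lparr>carrier := A\<rparr>\<^esub>"
        if "x \<in> carrier (G\<lparr>carrier := A\<rparr>)" "n > 0"
          "x [^]\<^bsub>G\<lparr>carrier := A\<rparr>\<^esub> (n::nat) = \<one>\<^bsub>G\<lparr>carrier := A\<rparr>\<^esub>" for x n
        using tf[of x n] that by (simp flip: nat_pow_consistent)
    qed (use Y in simp)
  qed
  define fixed_by where "fixed_by g \<longleftrightarrow> (\<forall>a\<in>A. g \<otimes> a \<otimes> inv g = a)" for g
  have pm: "g \<otimes> a \<otimes> inv g = a \<or> g \<otimes> a \<otimes> inv g = inv a" if g: "g \<in> carrier G" and a: "a \<in> A" for g a
  proof -
    define c where "c = g \<otimes> a \<otimes> inv g"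
    have c: "c \<in> A" using A.inv_op_closed2[OF g a] by (simp add: c_def)
    obtain n :: nat where n: "n > 0" and alt: "c [^] n = a [^] n \<or> c [^] n = inv (a [^] n)"
      using conj_pow_eq[OF ext noeth A Acomm a g] unfolding c_def by blast
    have "c = u" if u: "u \<in> A" "c [^] n = u [^] n" for u
    proof -
      have "(inv u \<otimes> c) [^] n = inv u [^] n \<otimes> c [^] n"
        using Acomm[of "inv u" c] u c by (intro pow_mult_distrib) auto
      also have "\<dots> = \<one>" using u by (simp add: nat_pow_inv)
      finally have "inv u \<otimes> c = \<one>" using tf[OF _ n] u c by blast
      then show ?thesis using u c by (simp add: inv_solve_left')
    qed
    then show ?thesis using alt a unfolding c_def[symmetric] by (auto simp: nat_pow_inv)
  qed
  have inverts: "g \<otimes> a \<otimes> inv g = inv a" if g: "g \<in> carrier G" and nf: "\<not> fixed_by g" and a: "a \<in> A" for g a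
  proof (rule ccontr)
    assume na: "g \<otimes> a \<otimes> inv g \<noteq> inv a"
    then have ga: "g \<otimes> a \<otimes> inv g = a" using pm[OF g a] by blast
    obtain b where b: "b \<in> A" "g \<otimes> b \<otimes> inv g \<noteq> b" using nf by (auto simp: fixed_by_def)
    then have gb: "g \<otimes> b \<otimes> inv g = inv b" using pm[OF g b(1)] by blast
    \<comment> \<open>If \<open>g\<close> fixes \<open>a\<close> and inverts \<open>b\<close>, the
      product goes to \<open>a \<otimes> inv b\<close>. For this to be the product or its inverse,
      \<open>a\<close> or \<open>b\<close> has to be its own inverse.\<close>
    have ab: "g \<otimes> (a \<otimes> b) \<otimes> inv g = a \<otimes> inv b" using a b g ga gb by (simp add: conj_mult)
    have "inv (a \<otimes> b) = inv a \<otimes> inv b" using a b Acomm[of a b] by (simp add: inv_mult_group)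
    then have "a \<otimes> inv b = a \<otimes> b \<or> a \<otimes> inv b = inv a \<otimes> inv b"
      using pm[OF g, of "a \<otimes> b"] a b ab by simp
    then have "inv b = b \<or> a = inv a" using a b by simp
    then show False using na ga gb b by auto
  qed
  \<comment> \<open>On a trivial \<open>A\<close>, fixing and inverting coincide. Giving precedence
    to fixing makes the sign multiplicative in that case too.\<close>
  define \<epsilon> :: "'a \<Rightarrow> int" where "\<epsilon> g = (if fixed_by g then 1 else -1)" for g
  have eq: "g \<otimes> a \<otimes> inv g = a [^] \<epsilon> g" if "g \<in> carrier G" "a \<in> A" for g a
    using that inverts by (auto simp: \<epsilon>_def fixed_by_def int_pow_neg)
  have "fixed_by (g \<otimes> h) \<longleftrightarrow> (fixed_by g \<longleftrightarrow> fixed_by h)" if g: "g \<in> carrier G" and h: "h \<in> carrier G" for g h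
  proof -
    have gh: "(g \<otimes> h) \<otimes> a \<otimes> inv (g \<otimes> h) = g \<otimes> (h \<otimes> a \<otimes> inv h) \<otimes> inv g" if "a \<in> A" for a
      using g h that by (simp add: conj_conj)
    have hA: "h \<otimes> a \<otimes> inv h \<in> A" if "a \<in> A" for a using A.inv_op_closed2[OF h that] .
    show ?thesis
    proof (cases "fixed_by g")
      case True
      then have "(g \<otimes> h) \<otimes> a \<otimes> inv (g \<otimes> h) = h \<otimes> a \<otimes> inv h" if "a \<in> A" for a
        using gh[OF that] hA[OF that] by (simp add: fixed_by_def)
      then show ?thesis using True by (simp add: fixed_by_def)
    next
      case False
      then have ghi: "(g \<otimes> h) \<otimes> a \<otimes> inv (g \<otimes> h) = inv (h \<otimes> a \<otimes> inv h)" if "a \<in> A" for a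
        using gh[OF that] hA[OF that] inverts[OF g] by simp
      obtain b where b: "b \<in> A" "inv b \<noteq> b"
        using False inverts[OF g False] unfolding fixed_by_def by metis
      show ?thesis
      proof (cases "fixed_by h")
        case True
        then have "(g \<otimes> h) \<otimes> b \<otimes> inv (g \<otimes> h) = inv b"
          using ghi[OF b(1)] b(1) by (simp add: fixed_by_def)
        then show ?thesis using b True False by (auto simp: fixed_by_def)
      next
        case F: False
        have "(g \<otimes> h) \<otimes> a \<otimes> inv (g \<otimes> h) = a" if "a \<in> A" for a
          using ghi[OF that] inverts[OF h F that] that by simp
        then have "fixed_by (g \<otimes> h)" by (simp add: fixed_by_def)
        then show ?thesis using F False by simp
      qed
    qed
  qed
  then have "\<epsilon> \<in> hom G sign_img"
    by (auto simp: hom_def sign_img_def \<epsilon>_def)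
  then show ?thesis using A fin free eq by blast
qed

end

section \<open>Extending actions from a normal subgroup of finite index\<close>

text \<open>Conjugation enters only through displacements of the base point. The condition
  \<open>base_conj\<close> holds when conjugation fixes or inverts each element of \<open>K\<close>,
  because \<open>k\<close> and \<open>inv k\<close> displace \<open>x0\<close> by the same
  distance.\<close>

locale induced_action = normal K G for K and G (structure) +
  fixes R :: "'r set" and d :: "'r \<Rightarrow> 'r \<Rightarrow> real" and \<rho> :: "'a \<Rightarrow> 'r \<Rightarrow> 'r" and x0 :: 'r
  assumes commute: "\<And>a b. a \<in> K \<Longrightarrow> b \<in> K \<Longrightarrow> a \<otimes> b = b \<otimes> a"
    and finite_index: "fin_index G (carrier G) K"
    and act: "isometric_action (G\<lparr>carrier := K\<rparr>) R d \<rho>"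
    and base: "x0 \<in> R"
    and base_conj: "\<And>g k. g \<in> carrier G \<Longrightarrow> k \<in> K \<Longrightarrow>
      d x0 (\<rho> (inv g \<otimes> k \<otimes> g) x0) = d x0 (\<rho> k x0)"

context induced_action
begin

lemmas K_one = subgroup.one_closed[OF subgroup_axioms]
lemmas K_mult = subgroup.m_closed[OF subgroup_axioms]

lemma metric: "Metric_space R d"
  using act by (rule isometric_actionD(1))

lemma rho_closed: "k \<in> K \<Longrightarrow> x \<in> R \<Longrightarrow> \<rho> k x \<in> R"
  using isometric_actionD(2)[OF act] by simp

lemma rho_mult: "k \<in> K \<Longrightarrow> l \<in> K \<Longrightarrow> x \<in> R \<Longrightarrow> \<rho> (k \<otimes> l) x = \<rho> k (\<rho> l x)"
  using isometric_actionD(4)[OF act] by simp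

lemma rho_isometry: "k \<in> K \<Longrightarrow> x \<in> R \<Longrightarrow> y \<in> R \<Longrightarrow> d (\<rho> k x) (\<rho> k y) = d x y"
  using isometric_actionD(5)[OF act] by simp

lemmas d_nonneg = Metric_space.nonneg[OF metric]
lemmas d_commute = Metric_space.commute[OF metric]
lemmas d_triangle = Metric_space.triangle[OF metric]

lemma d_self: "x \<in> R \<Longrightarrow> d x x = 0"
  using Metric_space.zero[OF metric] by blast

definition pt :: "'a \<Rightarrow> 'r" where "pt k = \<rho> k x0"

text \<open>A right action, so that passing from the coset of \<open>g\<close> to that of
  \<open>g \<otimes> u\<close> and on to that of \<open>g \<otimes> u \<otimes> v\<close> composes
  the glueing maps in this order.\<close>

definition conjug :: "'a \<Rightarrow> 'a \<Rightarrow> 'a" where "conjug u a = inv u \<otimes> a \<otimes> u"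

lemma pt_closed: "k \<in> K \<Longrightarrow> pt k \<in> R"
  unfolding pt_def using rho_closed base by blast

lemma rho_pt: "k \<in> K \<Longrightarrow> l \<in> K \<Longrightarrow> \<rho> k (pt l) = pt (k \<otimes> l)"
  unfolding pt_def using rho_mult base by simp

lemma conjug_closed: "u \<in> carrier G \<Longrightarrow> a \<in> K \<Longrightarrow> conjug u a \<in> K"
  unfolding conjug_def by (rule inv_op_closed1)

lemma conjug_mult:
  "u \<in> carrier G \<Longrightarrow> a \<in> K \<Longrightarrow> b \<in> K \<Longrightarrow> conjug u (a \<otimes> b) = conjug u a \<otimes> conjug u b"
  unfolding conjug_def by (simp add: m_assoc inv_cancel_left)

lemma conjug_inv: "u \<in> carrier G \<Longrightarrow> a \<in> K \<Longrightarrow> conjug u (inv a) = inv (conjug u a)"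
  unfolding conjug_def by (simp add: inv_mult_group m_assoc)

lemma conjug_conjug:
  "u \<in> carrier G \<Longrightarrow> v \<in> carrier G \<Longrightarrow> a \<in> K \<Longrightarrow> conjug v (conjug u a) = conjug (u \<otimes> v) a"
  unfolding conjug_def by (simp add: inv_mult_group m_assoc)

lemma conjug_triv:
  assumes "u \<in> K" "a \<in> K" shows "conjug u a = a"
proof -
  have "conjug u a = inv u \<otimes> (u \<otimes> a)"
    unfolding conjug_def using assms commute[OF assms(2,1)] by (simp add: m_assoc)
  then show ?thesis using assms by (simp add: inv_cancel_left)
qed

lemma d_pt:
  assumes "a \<in> K" "b \<in> K" shows "d (pt a) (pt b) = d x0 (pt (inv a \<otimes> b))"
proof -
  have "d (pt a) (pt b) = d (\<rho> a x0) (\<rho> a (pt (inv a \<otimes> b)))"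
    using assms by (simp add: rho_pt inv_cancel_left flip: pt_def)
  then show ?thesis using rho_isometry assms base pt_closed by simp
qed

text \<open>Distances in the orbit depend only on \<open>inv a \<otimes> b\<close>, to which
  \<open>base_conj\<close> applies. The glueing maps are therefore isometries of the orbit.\<close>

lemma d_pt_conjug:
  assumes "u \<in> carrier G" "a \<in> K" "b \<in> K"
  shows "d (pt (conjug u a)) (pt (conjug u b)) = d (pt a) (pt b)"
proof -
  have "inv (conjug u a) \<otimes> conjug u b = conjug u (inv a \<otimes> b)"
    using assms by (simp add: conjug_mult conjug_inv)
  then have "d (pt (conjug u a)) (pt (conjug u b)) = d x0 (pt (conjug u (inv a \<otimes> b)))"
    using assms conjug_closed by (simp add: d_pt)
  also have "\<dots> = d x0 (pt (inv a \<otimes> b))"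
    unfolding pt_def conjug_def using base_conj[OF assms(1), of "inv a \<otimes> b"] assms by simp
  finally show ?thesis using assms by (simp add: d_pt)
qed

text \<open>As \<open>K\<close> is abelian, \<open>c\<close> displaces all points of the orbit of
  \<open>x0\<close> by the same distance \<open>d x0 (pt c)\<close>, so acting by \<open>c\<close>
  increases distances to the orbit by no more than that.\<close>

lemma d_rho_pt_le:
  assumes "c \<in> K" "x \<in> R" "a \<in> K"
  shows "d (\<rho> c x) (pt a) \<le> d x (pt a) + d x0 (pt c)"
proof -
  have "inv c \<otimes> inv a \<otimes> a = inv c" using assms by (simp add: m_assoc)
  then have "inv (c \<otimes> a) \<otimes> a = inv c"
    using assms commute[of c a] by (simp add: inv_mult_group)
  then have "d (pt (c \<otimes> a)) (pt a) = d x0 (pt (inv c))" using assms by (simp add: d_pt)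
  also have "\<dots> = d (pt c) (pt \<one>)" using assms by (simp add: d_pt)
  also have "\<dots> = d x0 (pt c)"
    using d_commute[of "pt c"] isometric_actionD(3)[OF act] base by (simp add: pt_def)
  finally have "d (\<rho> c (pt a)) (pt a) = d x0 (pt c)" using assms by (simp add: rho_pt)
  moreover have "d (\<rho> c x) (pt a) \<le> d (\<rho> c x) (\<rho> c (pt a)) + d (\<rho> c (pt a)) (pt a)"
    using assms rho_closed pt_closed by (intro d_triangle) auto
  ultimately show ?thesis using rho_isometry assms pt_closed by simp
qed

text \<open>The length of a shortest path from \<open>x\<close> to \<open>y\<close> in different copies of \<open>R\<close>, indexed by
  cosets differing by \<open>u\<close>, when \<open>pt a\<close> in the first copy is glued to \<open>pt (conjug u a)\<close> in
  the second one.\<close>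

definition bridge :: "'a \<Rightarrow> 'r \<Rightarrow> 'r \<Rightarrow> real" where
  "bridge u x y = (INF a\<in>K. d x (pt a) + d y (pt (conjug u a)))"

lemma bridge_le: "a \<in> K \<Longrightarrow> bridge u x y \<le> d x (pt a) + d y (pt (conjug u a))"
  unfolding bridge_def by (intro cINF_lower bdd_belowI2[of _ 0]) (simp add: d_nonneg)

lemma bridge_ge: "(\<And>a. a \<in> K \<Longrightarrow> t \<le> d x (pt a) + d y (pt (conjug u a))) \<Longrightarrow> t \<le> bridge u x y"
  unfolding bridge_def by (intro cINF_greatest) (use K_one in blast)+

lemma bridge_inv_le:
  assumes "u \<in> carrier G" shows "bridge (inv u) y x \<le> bridge u x y"
proof (rule bridge_ge)
  fix a assume a: "a \<in> K"
  have "conjug (inv u) (conjug u a) = a" using assms a by (simp add: conjug_def m_assoc inv_cancel_left)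
  then show "bridge (inv u) y x \<le> d x (pt a) + d y (pt (conjug u a))"
    using bridge_le[OF conjug_closed[OF assms a], of "inv u" y x] by simp
qed

lemma bridge_commute: "u \<in> carrier G \<Longrightarrow> bridge (inv u) y x = bridge u x y"
  using bridge_inv_le[of u y x] bridge_inv_le[of "inv u" x y] by simp

definition gap :: "'a \<Rightarrow> 'r \<Rightarrow> 'r \<Rightarrow> real" where
  "gap u x y = (if u \<in> K then d x y else bridge u x y)"

lemma gap_nonneg: "0 \<le> gap u x y"
  unfolding gap_def using d_nonneg bridge_ge[of 0 x y u] by (simp add: add_nonneg_nonneg)

lemma gap_commute: "u \<in> carrier G \<Longrightarrow> gap (inv u) y x = gap u x y"
  unfolding gap_def using bridge_commute d_commute[of x y] m_inv_closed[of u] m_inv_closed[of "inv u"]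
  by auto

lemma gap_triangle:
  assumes u: "u \<in> carrier G" and v: "v \<in> carrier G" and R: "x \<in> R" "y \<in> R" "z \<in> R"
  shows "gap (u \<otimes> v) x z \<le> gap u x y + gap v y z"
proof -
  have uv: "u \<otimes> v \<in> carrier G" using u v by simp
  have left: "u \<otimes> v \<in> K \<longleftrightarrow> v \<in> K" if uK: "u \<in> K"
  proof
    assume "u \<otimes> v \<in> K"
    then have "inv u \<otimes> (u \<otimes> v) \<in> K" by (rule K_mult[OF m_inv_closed[OF uK]])
    then show "v \<in> K" using u v by (simp add: inv_cancel_left)
  qed (rule K_mult[OF uK])
  have right: "u \<otimes> v \<in> K \<longleftrightarrow> u \<in> K" if vK: "v \<in> K"
  proof
    assume "u \<otimes> v \<in> K"
    then have "u \<otimes> v \<otimes> inv v \<in> K" by (rule K_mult[OF _ m_inv_closed[OF vK]])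
    then show "u \<in> K" using u v by (simp add: m_assoc)
  qed (rule K_mult[OF _ vK])
  consider "u \<in> K" "v \<in> K" | "u \<in> K" "v \<notin> K" | "u \<notin> K" "v \<in> K"
    | "u \<notin> K" "v \<notin> K" "u \<otimes> v \<in> K" | "u \<notin> K" "v \<notin> K" "u \<otimes> v \<notin> K" by blast
  then show ?thesis
  proof cases
    case 1
    then show ?thesis using left d_triangle[OF R] by (simp add: gap_def)
  next
    case 2
    have "bridge (u \<otimes> v) x z - d x y \<le> bridge v y z"
    proof (rule bridge_ge)
      fix a assume a: "a \<in> K"
      have "conjug (u \<otimes> v) a = conjug v a"
        using conjug_conjug[OF u v a] conjug_triv[OF 2(1) a] by simp
      then show "bridge (u \<otimes> v) x z - d x y \<le> d y (pt a) + d z (pt (conjug v a))"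
        using bridge_le[OF a, of "u \<otimes> v" x z] d_triangle[OF R(1,2) pt_closed[OF a]] by simp
    qed
    then show ?thesis using 2 left by (simp add: gap_def)
  next
    case 3
    have "bridge (u \<otimes> v) x z - d y z \<le> bridge u x y"
    proof (rule bridge_ge)
      fix a assume a: "a \<in> K"
      have ua: "conjug u a \<in> K" by (rule conjug_closed[OF u a])
      have "conjug (u \<otimes> v) a = conjug u a"
        using conjug_conjug[OF u v a] conjug_triv[OF 3(2) ua] by simp
      then show "bridge (u \<otimes> v) x z - d y z \<le> d x (pt a) + d y (pt (conjug u a))"
        using bridge_le[OF a, of "u \<otimes> v" x z] d_triangle[OF R(3,2) pt_closed[OF ua]]
          d_commute[of z y] by simp
    qed
    then show ?thesis using 3 right by (simp add: gap_def)
  next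
    \<comment> \<open>The path leaves a copy and returns to it. As \<open>u \<otimes> v\<close> lies
      in the abelian group \<open>K\<close>, the two glueings compose to the identity, and the leg
      through the copy of \<open>y\<close> is carried back isometrically by
      \<open>d_pt_conjug\<close>: there is no shortcut.\<close>
    case 4
    have "d x z - bridge v y z \<le> bridge u x y"
    proof (rule bridge_ge)
      fix a assume a: "a \<in> K"
      have ua: "conjug u a \<in> K" by (rule conjug_closed[OF u a])
      have "d x z - (d x (pt a) + d y (pt (conjug u a))) \<le> bridge v y z"
      proof (rule bridge_ge)
        fix b assume b: "b \<in> K"
        have vb: "conjug v b \<in> K" by (rule conjug_closed[OF v b])
        have "conjug v (conjug u a) = a"
          using conjug_conjug[OF u v a] conjug_triv[OF 4(3) a] by simp
        then have "d (pt a) (pt (conjug v b)) = d (pt (conjug u a)) (pt b)"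
          using d_pt_conjug[OF v ua b] by simp
        moreover have "d (pt (conjug u a)) (pt b) \<le> d y (pt (conjug u a)) + d y (pt b)"
          using d_triangle[OF pt_closed[OF ua] R(2) pt_closed[OF b]] d_commute[of y] by simp
        moreover have "d x z \<le> d x (pt a) + (d (pt a) (pt (conjug v b)) + d z (pt (conjug v b)))"
          using d_triangle[OF R(1) pt_closed[OF a] R(3)]
            d_triangle[OF pt_closed[OF a] pt_closed[OF vb] R(3)] d_commute[of z] by simp
        ultimately show "d x z - (d x (pt a) + d y (pt (conjug u a))) \<le> d y (pt b) + d z (pt (conjug v b))"
          by linarith
      qed
      then show "d x z - bridge v y z \<le> d x (pt a) + d y (pt (conjug u a))" by linarith
    qed
    then show ?thesis using 4 by (simp add: gap_def)
  next
    \<comment> \<open>Two crossings are replaced by one: the leg between glueing points in the copy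
      of \<open>y\<close> is moved into the copy of \<open>z\<close>.\<close>
    case 5
    have "bridge (u \<otimes> v) x z - bridge v y z \<le> bridge u x y"
    proof (rule bridge_ge)
      fix a assume a: "a \<in> K"
      have ua: "conjug u a \<in> K" by (rule conjug_closed[OF u a])
      have "bridge (u \<otimes> v) x z - (d x (pt a) + d y (pt (conjug u a))) \<le> bridge v y z"
      proof (rule bridge_ge)
        fix b assume b: "b \<in> K"
        have vb: "conjug v b \<in> K" by (rule conjug_closed[OF v b])
        have uva: "conjug (u \<otimes> v) a = conjug v (conjug u a)" using conjug_conjug[OF u v a] by simp
        have "d (pt (conjug v b)) (pt (conjug (u \<otimes> v) a)) = d (pt b) (pt (conjug u a))"
          unfolding uva by (rule d_pt_conjug[OF v b ua])
        moreover have "d (pt b) (pt (conjug u a)) \<le> d y (pt b) + d y (pt (conjug u a))"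
          using d_triangle[OF pt_closed[OF b] R(2) pt_closed[OF ua]] d_commute[of y] by simp
        moreover have "d z (pt (conjug (u \<otimes> v) a))
            \<le> d z (pt (conjug v b)) + d (pt (conjug v b)) (pt (conjug (u \<otimes> v) a))"
          by (rule d_triangle[OF R(3) pt_closed[OF vb] pt_closed[OF conjug_closed[OF uv a]]])
        ultimately show "bridge (u \<otimes> v) x z - (d x (pt a) + d y (pt (conjug u a)))
            \<le> d y (pt b) + d z (pt (conjug v b))"
          using bridge_le[OF a, of "u \<otimes> v" x z] by linarith
      qed
      then show "bridge (u \<otimes> v) x z - bridge v y z \<le> d x (pt a) + d y (pt (conjug u a))" by linarith
    qed
    then show ?thesis using 5 by (simp add: gap_def)
  qed
qed

text \<open>\<open>\<tau>\<close> chooses representatives of left cosets, \<open>\<kappa> g\<close>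
  is the coordinate of \<open>g\<close> in \<open>K\<close> relative to them, and
  \<open>\<gamma>\<close> is the cocycle that measures how far \<open>\<tau>\<close> is from being
  multiplicative. Since \<open>\<tau>\<close> has finitely many values, so has
  \<open>\<gamma>\<close>.\<close>

lemma coset_coordinates:
  obtains \<kappa> \<gamma> c where "\<And>g. g \<in> carrier G \<Longrightarrow> \<kappa> g \<in> K"
    "\<And>g k. g \<in> carrier G \<Longrightarrow> k \<in> K \<Longrightarrow> \<kappa> (g \<otimes> k) = \<kappa> g \<otimes> k"
    "\<And>g h. g \<in> carrier G \<Longrightarrow> h \<in> carrier G \<Longrightarrow> \<gamma> g h \<in> K"
    "\<And>g h. g \<in> carrier G \<Longrightarrow> h \<in> carrier G \<Longrightarrow> \<kappa> (g \<otimes> h) = \<gamma> g h \<otimes> (conjug h (\<kappa> g) \<otimes> \<kappa> h)"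
    "\<And>g h. g \<in> carrier G \<Longrightarrow> h \<in> carrier G \<Longrightarrow> d x0 (pt (\<gamma> g h)) \<le> c"
proof -
  define \<tau> where "\<tau> g = (SOME x. x \<in> carrier G \<and> inv g \<otimes> x \<in> K)" for g
  have \<tau>: "\<tau> g \<in> carrier G" "inv g \<otimes> \<tau> g \<in> K" if "g \<in> carrier G" for g
  proof -
    have "g \<in> carrier G \<and> inv g \<otimes> g \<in> K" using that K_one by simp
    then have "\<tau> g \<in> carrier G \<and> inv g \<otimes> \<tau> g \<in> K" unfolding \<tau>_def by (rule someI)
    then show "\<tau> g \<in> carrier G" "inv g \<otimes> \<tau> g \<in> K" by auto
  qed
  have \<tau>K: "\<tau> (g \<otimes> k) = \<tau> g" if g: "g \<in> carrier G" and k: "k \<in> K" for g k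
  proof -
    have "inv (g \<otimes> k) \<otimes> x \<in> K \<longleftrightarrow> inv g \<otimes> x \<in> K" if x: "x \<in> carrier G" for x
    proof -
      have eq: "inv (g \<otimes> k) \<otimes> x = inv k \<otimes> (inv g \<otimes> x)" "inv g \<otimes> x = k \<otimes> (inv (g \<otimes> k) \<otimes> x)"
        using g k x by (simp_all add: inv_mult_group m_assoc inv_cancel_left)
      show ?thesis
        using eq K_mult k by (metis m_inv_closed)
    qed
    then show ?thesis unfolding \<tau>_def by meson
  qed
  obtain f where f: "finite (f ` carrier G)" "f ` carrier G \<subseteq> carrier G"
    "\<And>x. x \<in> carrier G \<Longrightarrow> inv (f x) \<otimes> x \<in> K"
    using fin_indexE[OF finite_index _ subset] by blast
  have "\<tau> ` carrier G \<subseteq> \<tau> ` f ` carrier G"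
  proof
    fix t assume "t \<in> \<tau> ` carrier G"
    then obtain g where g: "g \<in> carrier G" "t = \<tau> g" by blast
    have fg: "f g \<in> carrier G" using f(2) g(1) by blast
    have "\<tau> (f g \<otimes> (inv (f g) \<otimes> g)) = \<tau> (f g)" by (rule \<tau>K[OF fg f(3)[OF g(1)]])
    then have "t = \<tau> (f g)" using fg g by (simp add: inv_cancel_left)
    then show "t \<in> \<tau> ` f ` carrier G" using g by blast
  qed
  then have fin: "finite (\<tau> ` carrier G)" using f(1) finite_subset by blast
  define \<kappa> where "\<kappa> g = inv (\<tau> g) \<otimes> g" for g
  define \<gamma> where "\<gamma> g h = inv (\<tau> (g \<otimes> h)) \<otimes> (\<tau> g \<otimes> \<tau> h)" for g h
  have \<kappa>: "\<kappa> g \<in> K" if g: "g \<in> carrier G" for g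
  proof -
    have "\<kappa> g = inv (inv g \<otimes> \<tau> g)" using g \<tau>(1)[OF g] by (simp add: \<kappa>_def inv_mult_group)
    then show ?thesis using \<tau>(2)[OF g] by simp
  qed
  have \<kappa>mult: "\<kappa> (g \<otimes> k) = \<kappa> g \<otimes> k" if "g \<in> carrier G" "k \<in> K" for g k
    using that \<tau>(1)[of g] by (simp add: \<kappa>_def \<tau>K m_assoc)
  have eq: "\<kappa> (g \<otimes> h) = \<gamma> g h \<otimes> (conjug h (\<kappa> g) \<otimes> \<kappa> h)"
    if g: "g \<in> carrier G" and h: "h \<in> carrier G" for g h
  proof -
    have t: "\<tau> g \<in> carrier G" "\<tau> h \<in> carrier G" "\<tau> (g \<otimes> h) \<in> carrier G" using \<tau>(1) g h by auto
    have h_eq: "\<tau> h \<otimes> \<kappa> h = h" using h t by (simp add: \<kappa>_def inv_cancel_left)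
    have "conjug (\<kappa> h) (conjug (\<tau> h) (\<kappa> g)) = conjug h (\<kappa> g)"
      using conjug_conjug[OF t(2) _ \<kappa>[OF g], of "\<kappa> h"] \<kappa>[OF h] h_eq by simp
    then have "conjug h (\<kappa> g) = conjug (\<tau> h) (\<kappa> g)"
      using conjug_triv[OF \<kappa>[OF h] conjug_closed[OF t(2) \<kappa>[OF g]]] by simp
    then have "\<gamma> g h \<otimes> (conjug h (\<kappa> g) \<otimes> \<kappa> h)
        = inv (\<tau> (g \<otimes> h)) \<otimes> (\<tau> g \<otimes> \<tau> h) \<otimes> (inv (\<tau> h) \<otimes> (inv (\<tau> g) \<otimes> g) \<otimes> \<tau> h \<otimes> (inv (\<tau> h) \<otimes> h))"
      by (simp add: \<gamma>_def conjug_def \<kappa>_def)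
    also have "\<dots> = \<kappa> (g \<otimes> h)" using g h t by (simp add: \<kappa>_def m_assoc inv_cancel_left)
    finally show ?thesis by simp
  qed
  have \<gamma>: "\<gamma> g h \<in> K" if g: "g \<in> carrier G" and h: "h \<in> carrier G" for g h
  proof -
    have t: "\<gamma> g h \<in> carrier G" using \<tau>(1) g h by (simp add: \<gamma>_def)
    define k where "k = conjug h (\<kappa> g) \<otimes> \<kappa> h"
    have k: "k \<in> K" unfolding k_def using g h conjug_closed \<kappa> by simp
    have "\<gamma> g h = \<kappa> (g \<otimes> h) \<otimes> inv k" using eq[OF g h] t k by (simp add: k_def[symmetric] m_assoc)
    then show ?thesis using k \<kappa>[of "g \<otimes> h"] g h by simp
  qed
  define T where "T = \<tau> ` carrier G"
  define V where "V = (\<lambda>(a, b, e). inv a \<otimes> (b \<otimes> e)) ` (T \<times> T \<times> T)"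
  have V: "finite V" using fin by (simp add: V_def T_def)
  have \<gamma>V: "\<gamma> g h \<in> V" if "g \<in> carrier G" "h \<in> carrier G" for g h
  proof -
    have "(\<tau> (g \<otimes> h), \<tau> g, \<tau> h) \<in> T \<times> T \<times> T" using that by (simp add: T_def)
    then show ?thesis unfolding V_def \<gamma>_def by (rule rev_image_eqI) simp
  qed
  have "d x0 (pt (\<gamma> g h)) \<le> Max ((\<lambda>v. d x0 (pt v)) ` V)" if "g \<in> carrier G" "h \<in> carrier G" for g h
    using V \<gamma>V[OF that] by (intro Max_ge) auto
  then show thesis using that[OF \<kappa> \<kappa>mult \<gamma> eq] by blast
qed

text \<open>A pair \<open>(g, x)\<close> stands for the point \<open>\<rho> (\<kappa> g) x\<close>
  in the copy of \<open>R\<close> that belongs to the coset of \<open>g\<close>, and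
  \<open>G\<close> translates the first component. Apart from isometries, translation alters
  coordinates only by values of \<open>\<gamma>\<close>, so the glued distance \<open>D\<close> is
  almost invariant. The supremum \<open>E\<close> over all translates is invariant and within
  \<open>2 * c\<close> of \<open>D\<close>.\<close>

theorem extends: "\<exists>(S :: ('a \<times> 'r) set) dS \<psi>. extends_action G K R d \<rho> S dS \<psi>"
proof -
  obtain \<kappa> \<gamma> c where \<kappa>: "\<And>g. g \<in> carrier G \<Longrightarrow> \<kappa> g \<in> K"
    and \<kappa>K: "\<And>g k. g \<in> carrier G \<Longrightarrow> k \<in> K \<Longrightarrow> \<kappa> (g \<otimes> k) = \<kappa> g \<otimes> k"
    and \<gamma>: "\<And>g h. g \<in> carrier G \<Longrightarrow> h \<in> carrier G \<Longrightarrow> \<gamma> g h \<in> K"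
    and \<kappa>mult: "\<And>g h. g \<in> carrier G \<Longrightarrow> h \<in> carrier G \<Longrightarrow>
      \<kappa> (g \<otimes> h) = \<gamma> g h \<otimes> (conjug h (\<kappa> g) \<otimes> \<kappa> h)"
    and \<gamma>c: "\<And>g h. g \<in> carrier G \<Longrightarrow> h \<in> carrier G \<Longrightarrow> d x0 (pt (\<gamma> g h)) \<le> c"
    using coset_coordinates by blast
  have c0: "0 \<le> c" using \<gamma>c[OF one_closed one_closed] d_nonneg order_trans by blast
  define S where "S = carrier G \<times> R"
  define D where "D p q = gap (inv (fst p) \<otimes> fst q) (\<rho> (\<kappa> (fst p)) (snd p)) (\<rho> (\<kappa> (fst q)) (snd q))"
    for p q
  define mv where "mv w p = (w \<otimes> fst p, snd p)" for w and p :: "'a \<times> 'r"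
  have mvS: "mv w p \<in> S" if "w \<in> carrier G" "p \<in> S" for w p using that by (auto simp: mv_def S_def)
  have hat: "\<rho> (\<kappa> (fst p)) (snd p) \<in> R" if "p \<in> S" for p
    using that \<kappa> by (auto simp: S_def intro: rho_closed)
  have D0: "0 \<le> D p q" for p q by (simp add: D_def gap_nonneg)
  have Dsym: "D p q = D q p" if "p \<in> S" "q \<in> S" for p q
  proof -
    have c: "fst p \<in> carrier G" "fst q \<in> carrier G" using that by (auto simp: S_def)
    then have "inv (fst q) \<otimes> fst p = inv (inv (fst p) \<otimes> fst q)" by (simp add: inv_mult_group)
    then show ?thesis unfolding D_def using gap_commute[of "inv (fst p) \<otimes> fst q"] c by simp
  qed
  have Dtri: "D p r \<le> D p q + D q r" if "p \<in> S" "q \<in> S" "r \<in> S" for p q r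
  proof -
    have c: "fst p \<in> carrier G" "fst q \<in> carrier G" "fst r \<in> carrier G" using that by (auto simp: S_def)
    then have "inv (fst p) \<otimes> fst r = (inv (fst p) \<otimes> fst q) \<otimes> (inv (fst q) \<otimes> fst r)"
      by (simp add: m_assoc inv_cancel_left)
    then show ?thesis unfolding D_def
      using gap_triangle[OF _ _ hat[OF that(1)] hat[OF that(2)] hat[OF that(3)]] c by simp
  qed
  have Dmv: "D (mv w p) (mv w q) \<le> D p q + 2 * c" if w: "w \<in> carrier G" and pq: "p \<in> S" "q \<in> S" for w p q
  proof -
    obtain g x where p: "p = (g, x)" "g \<in> carrier G" "x \<in> R" using pq by (auto simp: S_def)
    obtain h y where q: "q = (h, y)" "h \<in> carrier G" "y \<in> R" using pq by (auto simp: S_def)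
    define u where "u = inv g \<otimes> h"
    have u: "u \<in> carrier G" "h = g \<otimes> u" using p q by (auto simp: u_def inv_cancel_left)
    have wu: "inv (w \<otimes> g) \<otimes> (w \<otimes> h) = u"
      using w p q by (simp add: u_def inv_mult_group m_assoc inv_cancel_left)
    show ?thesis
    proof (cases "u \<in> K")
      case True
      have eq: "d (\<rho> (\<kappa> g') x) (\<rho> (\<kappa> (g' \<otimes> u)) y) = d x (\<rho> u y)" if g': "g' \<in> carrier G" for g'
        using \<kappa>[OF g'] \<kappa>K[OF g' True] rho_mult[OF _ True q(3)] rho_isometry[OF _ p(3) rho_closed[OF True q(3)]]
        by simp
      have "w \<otimes> h = w \<otimes> g \<otimes> u" using w p u by (simp add: m_assoc)
      then have "D (mv w p) (mv w q) = d (\<rho> (\<kappa> (w \<otimes> g)) x) (\<rho> (\<kappa> (w \<otimes> g \<otimes> u)) y)"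
        using True wu by (simp add: D_def mv_def p(1) q(1) gap_def)
      moreover have "D p q = d (\<rho> (\<kappa> g) x) (\<rho> (\<kappa> (g \<otimes> u)) y)"
        using True unfolding D_def p(1) q(1) fst_conv snd_conv u_def[symmetric] u(2)[symmetric]
        by (simp add: gap_def)
      ultimately have "D (mv w p) (mv w q) = D p q"
        using eq[OF p(2)] eq[of "w \<otimes> g"] w p(2) by simp
      then show ?thesis using c0 by simp
    next
      case False
      define m where "m = conjug g (\<kappa> w)"
      have m: "m \<in> K" unfolding m_def by (rule conjug_closed[OF p(2) \<kappa>[OF w]])
      have um: "conjug u m = conjug h (\<kappa> w)"
        unfolding m_def u(2) by (rule conjug_conjug[OF p(2) u(1) \<kappa>[OF w]])
      \<comment> \<open>Translation by \<open>w\<close> carries a glueing point along with the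
        coordinate, up to the cocycle. Each end of the bridge contributes one
        \<open>c\<close>.\<close>
      have ineq: "d (\<rho> (\<kappa> (w \<otimes> g')) z) (pt (conjug g' (\<kappa> w) \<otimes> a)) \<le> d (\<rho> (\<kappa> g') z) (pt a) + c"
        if g': "g' \<in> carrier G" and z: "z \<in> R" and a: "a \<in> K" for g' z a
      proof -
        define n where "n = conjug g' (\<kappa> w)"
        have n: "n \<in> K" unfolding n_def by (rule conjug_closed[OF g' \<kappa>[OF w]])
        have z': "\<rho> (\<kappa> g') z \<in> R" using rho_closed \<kappa>[OF g'] z by blast
        have "\<rho> (\<kappa> (w \<otimes> g')) z = \<rho> (\<gamma> w g') (\<rho> n (\<rho> (\<kappa> g') z))"
          unfolding \<kappa>mult[OF w g'] n_def[symmetric]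
          using n z \<gamma>[OF w g'] \<kappa>[OF g'] by (simp add: rho_mult)
        then have "d (\<rho> (\<kappa> (w \<otimes> g')) z) (pt (n \<otimes> a))
            \<le> d (\<rho> n (\<rho> (\<kappa> g') z)) (pt (n \<otimes> a)) + d x0 (pt (\<gamma> w g'))"
          using d_rho_pt_le[OF \<gamma>[OF w g'] rho_closed[OF n z'], of "n \<otimes> a"] n a by simp
        also have "d (\<rho> n (\<rho> (\<kappa> g') z)) (pt (n \<otimes> a)) = d (\<rho> (\<kappa> g') z) (pt a)"
          using rho_isometry[OF n z' pt_closed[OF a]] rho_pt[OF n a] by simp
        finally show ?thesis using \<gamma>c[OF w g'] by (simp add: n_def)
      qed
      have "D (mv w p) (mv w q) - 2 * c \<le> bridge u (\<rho> (\<kappa> g) x) (\<rho> (\<kappa> h) y)"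
      proof (rule bridge_ge)
        fix a assume a: "a \<in> K"
        have "D (mv w p) (mv w q) = bridge u (\<rho> (\<kappa> (w \<otimes> g)) x) (\<rho> (\<kappa> (w \<otimes> h)) y)"
          using False wu by (simp add: D_def mv_def p(1) q(1) gap_def)
        also have "\<dots> \<le> d (\<rho> (\<kappa> (w \<otimes> g)) x) (pt (m \<otimes> a)) + d (\<rho> (\<kappa> (w \<otimes> h)) y) (pt (conjug u (m \<otimes> a)))"
          using m a by (intro bridge_le) simp
        also have "conjug u (m \<otimes> a) = conjug h (\<kappa> w) \<otimes> conjug u a"
          using conjug_mult[OF u(1) m a] um by simp
        finally show "D (mv w p) (mv w q) - 2 * c \<le> d (\<rho> (\<kappa> g) x) (pt a) + d (\<rho> (\<kappa> h) y) (pt (conjug u a))"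
          using ineq[OF p(2,3) a] ineq[OF q(2,3) conjug_closed[OF u(1) a]] unfolding m_def by linarith
      qed
      then show ?thesis using False by (simp add: D_def p(1) q(1) gap_def u_def[symmetric])
    qed
  qed
  define E where "E p q = (SUP w\<in>carrier G. D (mv w p) (mv w q))" for p q
  have Eub: "D (mv w p) (mv w q) \<le> E p q" if "w \<in> carrier G" "p \<in> S" "q \<in> S" for w p q
    unfolding E_def using that Dmv by (intro cSUP_upper bdd_aboveI2[where M = "D p q + 2 * c"]) auto
  have Ele: "E p q \<le> t" if "\<And>w. w \<in> carrier G \<Longrightarrow> D (mv w p) (mv w q) \<le> t" for p q t
    unfolding E_def using that one_closed by (intro cSUP_least) auto
  have mv1: "mv \<one> p = p" if "p \<in> S" for p using that by (auto simp: mv_def S_def)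
  have mvm: "mv (w \<otimes> v) p = mv w (mv v p)" if "w \<in> carrier G" "v \<in> carrier G" "p \<in> S" for w v p
    using that by (auto simp: mv_def S_def m_assoc)
  have DE: "D p q \<le> E p q" if "p \<in> S" "q \<in> S" for p q
    using Eub[OF _ that, of \<one>] mv1 that by simp
  have ED: "E p q \<le> D p q + 2 * c" if "p \<in> S" "q \<in> S" for p q using Dmv that by (intro Ele) auto
  have E0: "0 \<le> E p q" if "p \<in> S" "q \<in> S" for p q using DE[OF that] D0 order_trans by blast
  have Esym: "E p q = E q p" if "p \<in> S" "q \<in> S" for p q
    unfolding E_def using that Dsym mvS by (intro SUP_cong) auto
  have Etri: "E p r \<le> E p q + E q r" if "p \<in> S" "q \<in> S" "r \<in> S" for p q r
  proof (rule Ele)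
    fix w assume w: "w \<in> carrier G"
    show "D (mv w p) (mv w r) \<le> E p q + E q r"
      using Dtri[of "mv w p" "mv w q" "mv w r"] Eub[OF w that(1,2)] Eub[OF w that(2,3)] mvS[OF w] that
      by fastforce
  qed
  have Einv_le: "E (mv v p) (mv v q) \<le> E p q" if v: "v \<in> carrier G" and pq: "p \<in> S" "q \<in> S" for v p q
  proof (rule Ele)
    fix w assume w: "w \<in> carrier G"
    show "D (mv w (mv v p)) (mv w (mv v q)) \<le> E p q"
      using Eub[of "w \<otimes> v" p q] v w pq by (simp add: mvm)
  qed
  have Einv: "E (mv v p) (mv v q) = E p q" if v: "v \<in> carrier G" and pq: "p \<in> S" "q \<in> S" for v p q
  proof (rule antisym)
    have "mv (inv v) (mv v p) = p" if "p \<in> S" for p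
      using mvm[OF _ v that, of "inv v"] v mv1[OF that] by simp
    then show "E p q \<le> E (mv v p) (mv v q)"
      using Einv_le[of "inv v" "mv v p" "mv v q"] v pq mvS by simp
  qed (rule Einv_le[OF that])
  \<comment> \<open>Different pairs may represent the same point, such as
    \<open>(g \<otimes> k, x)\<close> and \<open>(g, \<rho> k x)\<close>; one is added off the
    diagonal to obtain a metric without passing to a quotient.\<close>
  define dS where "dS p q = (if p \<in> S \<and> q \<in> S \<and> p \<noteq> q then E p q + 1 else 0)" for p q
  define \<psi> where "\<psi> w = (\<lambda>p\<in>S. mv w p)" for w
  have "Metric_space S dS"
  proof
    show "0 \<le> dS p q" for p q using E0[of p q] by (simp add: dS_def)
    show "dS p q = dS q p" for p q using Esym by (auto simp: dS_def)
    show "dS p q = 0 \<longleftrightarrow> p = q" if "p \<in> S" "q \<in> S" for p q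
      using E0[OF that] that by (simp add: dS_def)
    show "dS p r \<le> dS p q + dS q r" if "p \<in> S" "q \<in> S" "r \<in> S" for p q r
      using Etri[OF that] E0[OF that(1,2)] E0[OF that(2,3)] that by (auto simp: dS_def)
  qed
  moreover have "group_action G S \<psi>"
  proof (rule group_actionI[OF is_group])
    show "\<psi> (g \<otimes> h) p = \<psi> g (\<psi> h p)" if "g \<in> carrier G" "h \<in> carrier G" "p \<in> S" for g h p
      using that mvS[OF that(2,3)] mvm[OF that] by (simp add: \<psi>_def)
  qed (use mvS mv1 in \<open>simp_all add: \<psi>_def\<close>)
  moreover have "dS (\<psi> w p) (\<psi> w q) = dS p q" if "w \<in> carrier G" "p \<in> S" "q \<in> S" for w p q
  proof -
    have "mv w p = mv w q \<longleftrightarrow> p = q"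
      using that mvm[of "inv w" w] mv1 by (metis inv_closed l_inv)
    then show ?thesis using that mvS Einv by (simp add: dS_def \<psi>_def)
  qed
  ultimately have iso: "isometric_action G S dS \<psi>" by (simp add: isometric_action_def)
  define f where "f x = (\<one>, x)" for x :: 'r
  have fS: "f x \<in> S" if "x \<in> R" for x using that by (simp add: f_def S_def)
  have dSE: "dS p q \<le> E p q + 1" if "p \<in> S" "q \<in> S" for p q using E0[OF that] by (simp add: dS_def)
  have "dS (f (\<rho> k x)) (\<psi> k (f x)) \<le> 2 * c + 1" if k: "k \<in> K" and x: "x \<in> R" for k x
  proof -
    have kx: "f (\<rho> k x) \<in> S" "\<psi> k (f x) \<in> S" "\<psi> k (f x) = (k, x)"
      using k x fS rho_closed mvS[of k "f x"] by (simp_all add: \<psi>_def mv_def) (simp_all add: f_def)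
    have "\<rho> (\<kappa> \<one>) (\<rho> k x) = \<rho> (\<kappa> k) x"
      using \<kappa>K[of \<one> k] \<kappa>[of \<one>] k x by (simp add: rho_mult)
    moreover have "\<rho> (\<kappa> k) x \<in> R" using k x \<kappa> rho_closed by simp
    ultimately have "D (f (\<rho> k x)) (\<psi> k (f x)) = 0"
      unfolding kx(3) using k by (simp add: D_def f_def gap_def d_self)
    then show ?thesis using ED[OF kx(1,2)] dSE[OF kx(1,2)] by linarith
  qed
  then have ce: "coarsely_equivariant K R \<rho> dS \<psi> f"
    unfolding coarsely_equivariant_def by (auto intro!: bdd_aboveI2[where M = "2 * c + 1"])
  \<comment> \<open>The upper error is \<open>2 * c\<close> from the supremum plus one off the
    diagonal; distances never shrink.\<close>
  have "1 / (2 * c + 2) * d x y - (2 * c + 2) \<le> dS (f x) (f y)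
      \<and> dS (f x) (f y) \<le> (2 * c + 2) * d x y + (2 * c + 2)" if x: "x \<in> R" and y: "y \<in> R" for x y
  proof -
    have "D (f x) (f y) = d x y"
      using x y \<kappa>[OF one_closed] by (simp add: D_def f_def gap_def rho_isometry)
    then have E: "d x y \<le> E (f x) (f y)" "E (f x) (f y) \<le> d x y + 2 * c"
      using DE[OF fS[OF x] fS[OF y]] ED[OF fS[OF x] fS[OF y]] by auto
    have d: "0 \<le> d x y" by (rule d_nonneg)
    have "1 / (2 * c + 2) * d x y \<le> 1 * d x y"
      using c0 d by (intro mult_right_mono) auto
    moreover have "d x y \<le> dS (f x) (f y)"
      using E fS x y d_self by (auto simp: dS_def f_def)
    moreover have "1 * d x y \<le> (2 * c + 2) * d x y"
      using c0 d by (intro mult_right_mono) auto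
    ultimately show ?thesis using dSE[OF fS[OF x] fS[OF y]] E c0 by linarith
  qed
  then have "quasi_isometric_embedding R d S dS f"
    unfolding quasi_isometric_embedding_def using fS c0
    by (intro conjI exI[of _ "2 * c + 2"]) auto
  then show ?thesis using iso ce unfolding extends_action_def by blast
qed

end

section \<open>Extending actions from arbitrary subgroups\<close>

text \<open>Zorn's lemma gives a subgroup \<open>B\<close> maximal among those meeting
  \<open>A\<close> trivially. Adjoining \<open>x\<close> either keeps the intersection trivial, so
  that \<open>x\<close> is in \<open>B\<close>, or produces a nontrivial element
  \<open>b \<otimes> x [^] i\<close> of \<open>A\<close>, where \<open>i\<close> is nonzero because
  \<open>B\<close> meets \<open>A\<close> trivially.\<close>

lemma (in comm_group) complement_up_to_torsion:
  assumes A: "subgroup A G"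
  obtains B where "subgroup B G" "B \<inter> A = {\<one>}"
    "\<And>x. x \<in> carrier G \<Longrightarrow> \<exists>n>0. x [^] (n::nat) \<in> A <#> B"
proof -
  interpret A: subgroup A G by fact
  define \<B> where "\<B> = {B. subgroup B G \<and> B \<inter> A = {\<one>}}"
  have "{\<one>} \<in> \<B>" using triv_subgroup A.one_closed by (auto simp: \<B>_def)
  moreover have "\<Union>\<C> \<in> \<B>" if ne: "\<C> \<noteq> {}" and chain: "subset.chain \<B> \<C>" for \<C>
  proof -
    have \<C>: "\<And>B. B \<in> \<C> \<Longrightarrow> subgroup B G \<and> B \<inter> A = {\<one>}"
      using chain by (auto simp: subset.chain_def \<B>_def)
    have "subgroup (\<Union>\<C>) G"
    proof
      show "\<Union>\<C> \<subseteq> carrier G" using \<C> subgroup.subset by blast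
      show "\<one> \<in> \<Union>\<C>" using ne \<C> subgroup.one_closed by blast
      show "inv x \<in> \<Union>\<C>" if x: "x \<in> \<Union>\<C>" for x
      proof -
        obtain B where B: "B \<in> \<C>" "x \<in> B" using x by blast
        then show ?thesis using subgroup.m_inv_closed[of B G x] \<C>[OF B(1)] by blast
      qed
      show "x \<otimes> y \<in> \<Union>\<C>" if xy: "x \<in> \<Union>\<C>" "y \<in> \<Union>\<C>" for x y
      proof -
        obtain B B' where B: "B \<in> \<C>" "x \<in> B" "B' \<in> \<C>" "y \<in> B'" using xy by blast
        have "B \<subseteq> B' \<or> B' \<subseteq> B" using chain B by (auto simp: subset.chain_def)
        then show ?thesis
        proof
          assume "B \<subseteq> B'"
          then have "x \<otimes> y \<in> B'" using B \<C>[OF B(3)] subgroup.m_closed[of B' G x y] by blast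
          then show ?thesis using B by blast
        next
          assume "B' \<subseteq> B"
          then have "x \<otimes> y \<in> B" using B \<C>[OF B(1)] subgroup.m_closed[of B G x y] by blast
          then show ?thesis using B by blast
        qed
      qed
    qed
    moreover have "\<Union>\<C> \<inter> A = {\<one>}" using \<C> ne by blast
    ultimately show ?thesis by (simp add: \<B>_def)
  qed
  ultimately obtain B where B: "B \<in> \<B>" and max: "\<And>B'. B' \<in> \<B> \<Longrightarrow> B \<subseteq> B' \<Longrightarrow> B' = B"
    using subset_Zorn_nonempty[of \<B>] by blast
  have Bsub: "subgroup B G" and BA: "B \<inter> A = {\<one>}" using B by (auto simp: \<B>_def)
  interpret B: subgroup B G by (rule Bsub)
  interpret AB: subgroup "A <#> B" G by (rule mult_subgroups[OF A Bsub])
  have "\<exists>n>0. x [^] (n::nat) \<in> A <#> B" if x: "x \<in> carrier G" for x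
  proof (cases "(B <#> generate G {x}) \<inter> A = {\<one>}")
    case True
    have gx: "subgroup (generate G {x}) G" using x by (intro generate_is_subgroup) auto
    have one_gx: "\<one> \<in> generate G {x}" by (rule generate.one)
    have "B <#> generate G {x} \<in> \<B>" using True mult_subgroups[OF Bsub gx] by (simp add: \<B>_def)
    moreover have "B \<subseteq> B <#> generate G {x}"
    proof
      fix b assume b: "b \<in> B"
      then have "b = b \<otimes> \<one>" by simp
      then show "b \<in> B <#> generate G {x}" using b one_gx unfolding set_mult_def by blast
    qed
    ultimately have eq: "B <#> generate G {x} = B" by (rule max)
    have "x = \<one> \<otimes> x" using x by simp
    moreover have "x \<in> generate G {x}" by (auto intro: generate.incl)
    ultimately have "x \<in> B <#> generate G {x}" using B.one_closed unfolding set_mult_def by blast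
    then have "x \<in> B" unfolding eq .
    moreover have "x [^] (1::nat) = \<one> \<otimes> x" using x by simp
    ultimately have "x [^] (1::nat) \<in> A <#> B" using A.one_closed unfolding set_mult_def by blast
    then show ?thesis by (intro exI[of _ 1]) simp
  next
    case False
    have "\<one> = \<one> \<otimes> \<one>" by simp
    then have "\<one> \<in> (B <#> generate G {x}) \<inter> A"
      using B.one_closed A.one_closed generate.one[of G "{x}"] unfolding set_mult_def by blast
    then obtain z where z: "z \<in> A" "z \<noteq> \<one>" "z \<in> B <#> generate G {x}" using False by blast
    then obtain b and i :: int where b: "b \<in> B" "z = b \<otimes> x [^] i"
      using generate_pow[OF x] unfolding set_mult_def by auto
    have "i \<noteq> 0"
    proof
      assume "i = 0"
      then have "z \<in> B \<inter> A" using z b by simp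
      then show False using BA z(2) by blast
    qed
    have "x [^] i = z \<otimes> inv b" using x b A.mem_carrier[OF z(1)] by (simp add: m_comm inv_cancel_left)
    then have xi: "x [^] i \<in> A <#> B" using z(1) b(1) B.m_inv_closed unfolding set_mult_def by blast
    have "x [^] \<bar>i\<bar> \<in> A <#> B"
      using xi AB.m_inv_closed[OF xi] x by (cases "i \<ge> 0") (simp_all add: int_pow_neg)
    then have "x [^] nat \<bar>i\<bar> \<in> A <#> B" by (simp flip: int_pow_int)
    then show ?thesis using \<open>i \<noteq> 0\<close> by (intro exI[of _ "nat \<bar>i\<bar>"]) simp
  qed
  then show thesis using that Bsub BA by blast
qed

section \<open>Schreier generators and the passage to arbitrary subgroups\<close>

context group
begin

text \<open>Schreier generators: \<open>T\<close> times the subgroup generated by \<open>Y\<close>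
  contains the identity and is stable under left multiplication by the generators of
  \<open>G\<close> and their inverses, so it is all of \<open>G\<close>. In this direction finite
  generation of \<open>A\<close> has to come from that of \<open>G\<close>.\<close>

lemma finitely_generated_fin_index:
  assumes fg: "finitely_generated G" and A: "subgroup A G" and fin: "fin_index G (carrier G) A"
  obtains Y where "finite Y" "Y \<subseteq> A" "generate G Y = A"
proof -
  interpret A: subgroup A G by fact
  obtain X where X: "finite X" "X \<subseteq> carrier G" "generate G X = carrier G"
    using fg unfolding finitely_generated_def by blast
  obtain f where f: "finite (f ` carrier G)" "f ` carrier G \<subseteq> carrier G"
    "\<And>x. x \<in> carrier G \<Longrightarrow> inv (f x) \<otimes> x \<in> A"
    using fin_indexE[OF fin _ A.subset] by blast
  define T where "T = insert \<one> (f ` carrier G)"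
  define Z where "Z = X \<union> m_inv G ` X"
  \<comment> \<open>\<open>T\<close> may contain elements of \<open>A\<close> other than the
    identity. They have to be generators as well, because they occur when an element of
    \<open>A\<close> is written as \<open>t \<otimes> w\<close>.\<close>
  define Y where "Y = (\<lambda>(z, t). inv (f (z \<otimes> t)) \<otimes> (z \<otimes> t)) ` (Z \<times> T) \<union> (T \<inter> A)"
  have T: "finite T" "T \<subseteq> carrier G" using f by (auto simp: T_def)
  have Z: "finite Z" "Z \<subseteq> carrier G" using X by (auto simp: Z_def)
  have Y: "finite Y" using T Z by (simp add: Y_def)
  have "inv (f (z \<otimes> t)) \<otimes> (z \<otimes> t) \<in> A" if "z \<in> Z" "t \<in> T" for z t
    using that T(2) Z(2) by (intro f(3)) auto
  then have YA: "Y \<subseteq> A" by (auto simp: Y_def)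
  have Yc: "Y \<subseteq> carrier G" using YA A.subset by blast
  have gY: "generate G Y \<subseteq> carrier G" by (rule generate_incl[OF Yc])
  define U where "U = T <#> generate G Y"
  have step: "z \<otimes> u \<in> U" if z: "z \<in> Z" and u: "u \<in> U" for z u
  proof -
    obtain t w where t: "t \<in> T" "w \<in> generate G Y" "u = t \<otimes> w"
      using u unfolding U_def set_mult_def by blast
    have c: "z \<in> carrier G" "t \<in> carrier G" "w \<in> carrier G" using z t T Z gY by auto
    have fc: "f (z \<otimes> t) \<in> carrier G" using f(2) c by blast
    define y where "y = inv (f (z \<otimes> t)) \<otimes> (z \<otimes> t)"
    have "(z, t) \<in> Z \<times> T" using z t by simp
    then have "y \<in> Y" unfolding Y_def y_def by (intro UnI1) (rule rev_image_eqI, auto)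
    then have "y \<otimes> w \<in> generate G Y" using t(2) by (intro generate.eng[OF generate.incl])
    moreover have "z \<otimes> u = f (z \<otimes> t) \<otimes> (y \<otimes> w)"
      unfolding y_def t(3) using c fc by (simp add: m_assoc inv_cancel_left)
    moreover have "f (z \<otimes> t) \<in> T" using c by (simp add: T_def)
    ultimately show ?thesis unfolding U_def set_mult_def by blast
  qed
  have Uc: "U \<subseteq> carrier G" unfolding U_def using T gY by (auto simp: set_mult_def)
  have "\<forall>u\<in>U. h \<otimes> u \<in> U" if "h \<in> generate G X" for h
    using that
  proof induction
    case one
    then show ?case using Uc by auto
  next
    case (eng g h)
    then have "g \<in> carrier G" "h \<in> carrier G" using X by auto
    then show ?case using eng Uc by (auto simp: m_assoc subset_eq)
  qed (use step in \<open>auto simp: Z_def\<close>)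
  moreover have "\<one> \<in> U"
  proof -
    have "\<one> = \<one> \<otimes> \<one>" by simp
    then show ?thesis unfolding U_def T_def set_mult_def using generate.one[of G Y] by blast
  qed
  ultimately have GU: "g \<in> U" if "g \<in> carrier G" for g using that X(3) by force
  have "A \<subseteq> generate G Y"
  proof
    fix a assume a: "a \<in> A"
    then obtain t w where t: "t \<in> T" "w \<in> generate G Y" "a = t \<otimes> w"
      using GU[of a] unfolding U_def set_mult_def by auto
    have wA: "w \<in> A" using t(2) generate_subgroup_incl[OF YA A] by blast
    have "t = a \<otimes> inv w" using t T wA by (auto simp: m_assoc)
    then have "t \<in> Y" using a wA t(1) by (simp add: Y_def)
    then show "a \<in> generate G Y" unfolding t(3) using t(2) by (intro generate.eng[OF generate.incl])
  qed
  then have "generate G Y = A" using generate_subgroup_incl[OF YA A] by blast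
  then show thesis using that Y YA by blast
qed

text \<open>The bound in the definition of coarse equivariance may depend on the point, so finitely many
  cosets are harmless.\<close>

lemma coarsely_equivariant_fin_index:
  assumes H: "subgroup H G" and J: "J \<subseteq> H" and T: "finite T" "T \<subseteq> H"
    and dec: "\<And>h. h \<in> H \<Longrightarrow> \<exists>a\<in>J. \<exists>t\<in>T. h = a \<otimes> t"
    and R: "isometric_action (G\<lparr>carrier := H\<rparr>) R dR \<phi>" and S: "isometric_action G S dS \<psi>"
    and f: "f \<in> R \<rightarrow> S" and ce: "coarsely_equivariant J R \<phi> dS \<psi> f"
  shows "coarsely_equivariant H R \<phi> dS \<psi> f"
  unfolding coarsely_equivariant_def
proof
  interpret S: Metric_space S dS using S by (rule isometric_actionD)
  fix x assume x: "x \<in> R"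
  have HC: "\<And>h. h \<in> H \<Longrightarrow> h \<in> carrier G" using subgroup.mem_carrier[OF H] .
  have \<phi>R: "\<phi> h y \<in> R" if "h \<in> H" "y \<in> R" for h y using isometric_actionD(2)[OF R] that by simp
  have fS: "f y \<in> S" if "y \<in> R" for y using f that by blast
  have "\<exists>M. \<forall>a\<in>J. dS (f (\<phi> a y)) (\<psi> a (f y)) \<le> M" if "y \<in> R" for y
    using ce that by (auto simp: coarsely_equivariant_def bdd_above_def)
  then obtain M where M: "\<And>y a. y \<in> R \<Longrightarrow> a \<in> J \<Longrightarrow> dS (f (\<phi> a y)) (\<psi> a (f y)) \<le> M y" by metis
  define b where "b t = M (\<phi> t x) + dS (f (\<phi> t x)) (\<psi> t (f x))" for t
  have "dS (f (\<phi> h x)) (\<psi> h (f x)) \<le> Max (b ` T)" if h: "h \<in> H" for h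
  proof -
    obtain a t where at: "a \<in> J" "t \<in> T" "h = a \<otimes> t" using dec[OF h] by blast
    have aH: "a \<in> H" "t \<in> H" using at J T by auto
    have tx: "\<phi> t x \<in> R" by (rule \<phi>R[OF aH(2) x])
    have \<psi>S: "\<psi> t (f x) \<in> S" "\<psi> a (f (\<phi> t x)) \<in> S" "\<psi> a (\<psi> t (f x)) \<in> S"
      using isometric_actionD(2)[OF S] HC aH fS x tx by auto
    have "f (\<phi> h x) = f (\<phi> a (\<phi> t x))" "\<psi> h (f x) = \<psi> a (\<psi> t (f x))"
      unfolding at(3)
      using isometric_actionD(4)[OF R, of a t x] isometric_actionD(4)[OF S, of a t "f x"] aH x HC fS
      by auto
    then have "dS (f (\<phi> h x)) (\<psi> h (f x))
        \<le> dS (f (\<phi> a (\<phi> t x))) (\<psi> a (f (\<phi> t x))) + dS (\<psi> a (f (\<phi> t x))) (\<psi> a (\<psi> t (f x)))"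
      using S.triangle[of "f (\<phi> a (\<phi> t x))" "\<psi> a (f (\<phi> t x))" "\<psi> a (\<psi> t (f x))"]
        fS[OF \<phi>R[OF aH(1) tx]] \<psi>S by simp
    also have "dS (\<psi> a (f (\<phi> t x))) (\<psi> a (\<psi> t (f x))) = dS (f (\<phi> t x)) (\<psi> t (f x))"
      using isometric_actionD(5)[OF S] HC aH fS tx \<psi>S by blast
    also have "dS (f (\<phi> a (\<phi> t x))) (\<psi> a (f (\<phi> t x))) \<le> M (\<phi> t x)" by (rule M[OF tx at(1)])
    finally have "dS (f (\<phi> h x)) (\<psi> h (f x)) \<le> b t" by (simp add: b_def)
    also have "\<dots> \<le> Max (b ` T)" using T at by (intro Max_ge) auto
    finally show ?thesis .
  qed
  then show "bdd_above ((\<lambda>h. dS (f (\<phi> h x)) (\<psi> h (f x))) ` H)" by (rule bdd_aboveI2)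
qed

text \<open>An empty \<open>R\<close> has no base point along which copies could be glued, so it is
  treated separately, with an empty \<open>S\<close>.\<close>

lemma empty_extends_action:
  assumes H: "subgroup H G"
  shows "\<exists>(S :: ('a \<times> 'r) set) dS \<psi>. extends_action G H ({} :: 'r set) dR \<phi> S dS \<psi>"
proof -
  define \<psi> :: "'a \<Rightarrow> 'a \<times> 'r \<Rightarrow> 'a \<times> 'r" where "\<psi> g = (\<lambda>x\<in>{}. x)" for g
  have "group_action G {} \<psi>" by (rule group_actionI[OF is_group]) (auto simp: \<psi>_def)
  moreover have "Metric_space {} (\<lambda>x y :: 'a \<times> 'r. 0)" by unfold_locales auto
  ultimately have "isometric_action G {} (\<lambda>x y :: 'a \<times> 'r. 0) \<psi>" by (simp add: isometric_action_def)
  then have "extends_action G H ({} :: 'r set) dR \<phi> {} (\<lambda>x y :: 'a \<times> 'r. 0) \<psi>"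
    unfolding extends_action_def coarsely_equivariant_def quasi_isometric_embedding_def
    by (auto intro!: exI[of _ 1])
  then show ?thesis by blast
qed

text \<open>\<open>J\<close> may have infinite index in \<open>G\<close>, so the glueing is applied
  to \<open>K = J B\<close>, with \<open>B\<close> acting trivially. Every subgroup of
  \<open>A\<close> is normal in \<open>G\<close> because conjugation fixes or inverts its elements.
  The embedding \<open>f\<close> is kept throughout: only its equivariance is transferred from
  \<open>K\<close> to \<open>J\<close> and from there to \<open>H\<close>.\<close>

lemma conj_by_sign_imp_extension_problem_solvable:
  assumes fg: "finitely_generated G" and A: "A \<lhd> G" and fin: "fin_index G (carrier G) A"
    and comm: "\<And>a b. a \<in> A \<Longrightarrow> b \<in> A \<Longrightarrow> a \<otimes> b = b \<otimes> a"
    and sign: "\<And>g a. g \<in> carrier G \<Longrightarrow> a \<in> A \<Longrightarrow> g \<otimes> a \<otimes> inv g = a \<or> g \<otimes> a \<otimes> inv g = inv a"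
    and H: "subgroup H G"
  shows "extension_problem_solvable TYPE('r) G H"
  unfolding extension_problem_solvable_def
proof (intro allI impI)
  fix R :: "'r set" and dR \<phi> assume R: "isometric_action (G\<lparr>carrier := H\<rparr>) R dR \<phi>"
  show "\<exists>(S :: ('a \<times> 'r) set) dS \<psi>. extends_action G H R dR \<phi> S dS \<psi>"
  proof (cases "R = {}")
    case True
    then show ?thesis using empty_extends_action[OF H] by simp
  next
    case False
    then obtain x0 where x0: "x0 \<in> R" by blast
    interpret A: normal A G by (rule A)
    interpret H: subgroup H G by (rule H)
    let ?A = "G\<lparr>carrier := A\<rparr>"
    interpret CA: comm_group ?A
      by (rule group.group_comm_groupI[OF subgroup_imp_group[OF A.is_subgroup]]) (simp add: comm)
    define J where "J = A \<inter> H"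
    have J: "subgroup J G" unfolding J_def by (rule subgroups_Inter_pair[OF A.is_subgroup H])
    interpret J: subgroup J G by (rule J)
    have JA: "subgroup J ?A" by (rule subgroup_incl[OF J A.is_subgroup]) (simp add: J_def)
    obtain B where BA: "subgroup B ?A" and BJ: "B \<inter> J = {\<one>}"
      and tors: "\<And>x. x \<in> A \<Longrightarrow> \<exists>n>0. x [^]\<^bsub>?A\<^esub> (n::nat) \<in> J <#>\<^bsub>?A\<^esub> B"
      using CA.complement_up_to_torsion[OF JA] by auto
    have B: "subgroup B G" by (rule incl_subgroup[OF A.is_subgroup BA])
    interpret B: subgroup B G by (rule B)
    have sub: "J \<subseteq> A" "J \<subseteq> H" "B \<subseteq> A" using subgroup.subset[OF BA] by (auto simp: J_def)
    define K where "K = J <#> B"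
    have KA: "K \<subseteq> A" using sub by (auto simp: K_def set_mult_def)
    have "subgroup (J <#>\<^bsub>?A\<^esub> B) ?A" by (rule CA.mult_subgroups[OF JA BA])
    then have "subgroup K ?A" by (simp add: K_def set_mult_def)
    then have K: "subgroup K G" by (rule incl_subgroup[OF A.is_subgroup])
    interpret K: subgroup K G by (rule K)
    have KN: "K \<lhd> G"
    proof (rule normal_invI[OF K])
      show "g \<otimes> k \<otimes> inv g \<in> K" if "g \<in> carrier G" "k \<in> K" for g k
        using sign[OF that(1) subsetD[OF KA that(2)]] that(2) K.m_inv_closed[OF that(2)] by auto
    qed
    have tors': "\<exists>n>0. x [^] (n::nat) \<in> K" if "x \<in> A" for x
      using tors[OF that] by (simp add: K_def set_mult_def flip: nat_pow_consistent)
    obtain X where X: "finite X" "X \<subseteq> A" "generate G X = A"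
      using finitely_generated_fin_index[OF fg A.is_subgroup fin] by blast
    have "fin_index G A K" by (rule fin_index_torsion[OF A.is_subgroup comm X K KA tors'])
    then have Kfin: "fin_index G (carrier G) K"
      using fin_index_trans[OF fin _ _ A.subset K.subset subgroup_self] by simp
    have "\<forall>k\<in>K. \<exists>a. a \<in> J \<and> (\<exists>b\<in>B. k = a \<otimes> b)" by (auto simp: K_def set_mult_def)
    \<comment> \<open>\<open>r\<close> is the projection of \<open>K\<close> to \<open>J\<close>
      along \<open>B\<close>: unique since \<open>B \<inter> J\<close> is trivial, multiplicative
      since \<open>A\<close> is abelian.\<close>
    then obtain r where r: "\<And>k. k \<in> K \<Longrightarrow> r k \<in> J" "\<And>k. k \<in> K \<Longrightarrow> \<exists>b\<in>B. k = r k \<otimes> b" by metis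
    have uniq: "a = a'" if a: "a \<in> J" "b \<in> B" "a' \<in> J" "b' \<in> B" "a \<otimes> b = a' \<otimes> b'" for a b a' b'
    proof -
      have c: "a \<in> carrier G" "b \<in> carrier G" "a' \<in> carrier G" "b' \<in> carrier G" using a by auto
      have "b \<otimes> inv b' = inv a \<otimes> (a \<otimes> b) \<otimes> inv b'" using c by (simp add: inv_cancel_left)
      also have "\<dots> = inv a \<otimes> a'" unfolding a(5) using c by (simp add: m_assoc)
      finally have "b \<otimes> inv b' = inv a \<otimes> a'" .
      then have "inv a \<otimes> a' \<in> B \<inter> J" using a by (metis B.m_closed B.m_inv_closed IntI J.m_closed J.m_inv_closed)
      then have "inv a \<otimes> a' = \<one>" using BJ by blast
      then show ?thesis using c by (simp add: inv_solve_left')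
    qed
    have r_eq: "r (a \<otimes> b) = a" if "a \<in> J" "b \<in> B" for a b
    proof -
      have k: "a \<otimes> b \<in> K" using that by (auto simp: K_def set_mult_def)
      obtain b' where b': "b' \<in> B" "a \<otimes> b = r (a \<otimes> b) \<otimes> b'" using r(2)[OF k] by blast
      show ?thesis using uniq[OF that r(1)[OF k] b'] by simp
    qed
    have rJ: "r a = a" if "a \<in> J" for a using r_eq[OF that B.one_closed] that by simp
    have rm: "r (k \<otimes> l) = r k \<otimes> r l" if kl: "k \<in> K" "l \<in> K" for k l
    proof -
      obtain b where b: "b \<in> B" "k = r k \<otimes> b" using r(2)[OF kl(1)] by blast
      obtain c where c: "c \<in> B" "l = r l \<otimes> c" using r(2)[OF kl(2)] by blast
      have m: "r k \<in> carrier G" "r l \<in> carrier G" "b \<in> carrier G" "c \<in> carrier G"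
        using r(1)[OF kl(1)] r(1)[OF kl(2)] b c by auto
      have "b \<otimes> r l = r l \<otimes> b" using b r(1)[OF kl(2)] sub by (intro comm) auto
      then have "(r k \<otimes> b) \<otimes> (r l \<otimes> c) = (r k \<otimes> r l) \<otimes> (b \<otimes> c)"
        using m by (metis m_assoc m_closed)
      then have "k \<otimes> l = (r k \<otimes> r l) \<otimes> (b \<otimes> c)" using b(2) c(2) by simp
      then show ?thesis using r_eq r(1)[OF kl(1)] r(1)[OF kl(2)] b(1) c(1) by simp
    qed
    define \<rho> where "\<rho> k = \<phi> (r k)" for k
    have rH: "r k \<in> H" if "k \<in> K" for k using r(1)[OF that] sub by blast
    note \<phi>D = isometric_actionD[OF R, simplified]
    have \<phi>ext: "\<phi> h \<in> extensional R" if "h \<in> H" for h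
      using R group_action.bij_prop0[of "G\<lparr>carrier := H\<rparr>" R \<phi> h] that
      by (simp add: isometric_action_def Bij_def)
    have "group_action (G\<lparr>carrier := K\<rparr>) R \<rho>"
      by (rule group_actionI[OF subgroup_imp_group[OF K]])
        (use \<phi>D(2-4) \<phi>ext rH rm rJ in \<open>auto simp: \<rho>_def\<close>)
    then have act: "isometric_action (G\<lparr>carrier := K\<rparr>) R dR \<rho>"
      using \<phi>D(1,5) rH by (simp add: isometric_action_def \<rho>_def)
    interpret I: induced_action K G R dR \<rho> x0
    proof (intro induced_action.intro[OF KN] induced_action_axioms.intro)
      show "a \<otimes> b = b \<otimes> a" if "a \<in> K" "b \<in> K" for a b using that KA by (intro comm) auto
      show "dR x0 (\<rho> (inv g \<otimes> k \<otimes> g) x0) = dR x0 (\<rho> k x0)" if g: "g \<in> carrier G" and k: "k \<in> K" for g k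
      proof -
        note \<rho>D = isometric_actionD[OF act, simplified]
        \<comment> \<open>Moving the pair \<open>x0\<close>, \<open>\<rho> (inv k) x0\<close> by
          \<open>k\<close> shows that \<open>k\<close> and \<open>inv k\<close> displace the base
          point equally.\<close>
        have "\<rho> k (\<rho> (inv k) x0) = x0" using \<rho>D(3,4) k x0 by (metis K.m_inv_closed K.mem_carrier r_inv)
        then have "dR x0 (\<rho> (inv k) x0) = dR x0 (\<rho> k x0)"
          using \<rho>D(5)[OF k x0 \<rho>D(2)[OF K.m_inv_closed[OF k] x0]] Metric_space.commute[OF \<rho>D(1)] by metis
        moreover have "inv g \<otimes> k \<otimes> g = k \<or> inv g \<otimes> k \<otimes> g = inv k"
          using sign[OF inv_closed[OF g] subsetD[OF KA k]] g by simp
        ultimately show ?thesis by auto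
      qed
    qed (use Kfin act x0 in auto)
    obtain S :: "('a \<times> 'r) set" and dS \<psi> where "extends_action G K R dR \<rho> S dS \<psi>"
      using I.extends by blast
    then obtain f where S: "isometric_action G S dS \<psi>" and ce: "coarsely_equivariant K R \<rho> dS \<psi> f"
      and qi: "quasi_isometric_embedding R dR S dS f"
      unfolding extends_action_def by blast
    have JK: "J \<subseteq> K"
    proof
      fix a assume a: "a \<in> J"
      then have "a = a \<otimes> \<one>" by simp
      then show "a \<in> K" using a B.one_closed unfolding K_def set_mult_def by blast
    qed
    have ceJ: "coarsely_equivariant J R \<phi> dS \<psi> f"
      unfolding coarsely_equivariant_def
    proof
      fix x assume "x \<in> R"
      then have "bdd_above ((\<lambda>h. dS (f (\<rho> h x)) (\<psi> h (f x))) ` J)"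
        using ce JK unfolding coarsely_equivariant_def by (meson bdd_above_mono image_mono)
      then show "bdd_above ((\<lambda>h. dS (f (\<phi> h x)) (\<psi> h (f x))) ` J)"
        by (simp add: \<rho>_def rJ cong: image_cong_simp)
    qed
    obtain t where t: "finite (t ` carrier G)" "t ` carrier G \<subseteq> carrier G"
      "\<And>x. x \<in> carrier G \<Longrightarrow> inv (t x) \<otimes> x \<in> A"
      using fin_indexE[OF fin _ A.subset] by blast
    have "fin_index G H J"
    proof (rule fin_indexI[OF H])
      show "finite (t ` H)" using t(1) H.subset by (meson finite_subset image_mono)
      show "inv x \<otimes> y \<in> J" if "x \<in> H" "y \<in> H" "t x = t y" for x y
        using fin_index_eq_imp[OF subgroup_self A.is_subgroup t(2,3)] that by (simp add: J_def)
    qed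
    then obtain T where T: "finite T" "T \<subseteq> H" "\<forall>k\<in>H. \<exists>t\<in>T. \<exists>h\<in>J. k = t \<otimes> h"
      unfolding fin_index_def by blast
    \<comment> \<open>The element of \<open>J\<close> has to stand on the left, so that it acts
      last; inversion turns left cosets of \<open>J\<close> into right cosets.\<close>
    have dec: "\<exists>a\<in>J. \<exists>t\<in>m_inv G ` T. h = a \<otimes> t" if h: "h \<in> H" for h
    proof -
      obtain t a where ta: "t \<in> T" "a \<in> J" "inv h = t \<otimes> a" using T(3) h H.m_inv_closed by blast
      have "h = inv (inv h)" using h by simp
      also have "\<dots> = inv a \<otimes> inv t" unfolding ta(3) using ta T(2) by (intro inv_mult_group) auto
      finally show ?thesis using ta by blast
    qed
    have "coarsely_equivariant H R \<phi> dS \<psi> f"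
    proof (rule coarsely_equivariant_fin_index[OF H sub(2) _ _ dec R S _ ceJ])
      show "m_inv G ` T \<subseteq> H" using T(2) by auto
      show "f \<in> R \<rightarrow> S" using qi by (simp add: quasi_isometric_embedding_def)
    qed (use T in auto)
    then show ?thesis using S qi unfolding extends_action_def by blast
  qed
qed

lemma free_abelian_subgroup_commute:
  assumes "free_abelian (G\<lparr>carrier := A\<rparr>)" and a: "a \<in> A" "b \<in> A" and A: "subgroup A G"
  shows "a \<otimes> b = b \<otimes> a"
proof -
  obtain S :: "'a set" and h where h: "h \<in> iso (G\<lparr>carrier := A\<rparr>) (free_Abelian_group S)"
    using assms(1) by (auto simp: free_abelian_def is_iso_def)
  then have inj: "inj_on h A" and m: "\<And>a b. a \<in> A \<Longrightarrow> b \<in> A \<Longrightarrow> h (a \<otimes> b) = h a + h b"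
    by (auto simp: iso_def bij_betw_def hom_def)
  have "h (a \<otimes> b) = h (b \<otimes> a)" using m a by (simp add: add.commute)
  then show ?thesis using inj a subgroup.m_closed[OF A] by (meson inj_onD)
qed

end

theorem theorem1p7:
  fixes G :: "'a monoid" (structure)
  assumes "group G"
    and "finitely_generated G"
    and "elementary_amenable G"
    and "infinite (UNIV :: 'r set)"
  shows "(\<forall>H. subgroup H G \<longrightarrow> extension_problem_solvable TYPE('r) G H) \<longleftrightarrow>
    (\<exists>A. A \<lhd> G \<and> finite (rcosets A) \<and> free_abelian (G\<lparr>carrier := A\<rparr>) \<and>
      (\<exists>\<epsilon>\<in>hom G sign_img. \<forall>g\<in>carrier G. \<forall>a\<in>A. g \<otimes> a \<otimes> inv g = a [^] \<epsilon> g))"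
proof
  interpret group G by fact
  assume solv: "\<forall>H. subgroup H G \<longrightarrow> extension_problem_solvable TYPE('r) G H"
  obtain X where "finite X" "X \<subseteq> carrier G" "generate G X = carrier G"
    using assms(2) unfolding finitely_generated_def by blast
  then have "countable (carrier G)" using countable_generate by metis
  then have ext: "lengths_extend G"
    using extension_problem_solvable_imp_lengths_extend[OF _ assms(4)] solv by blast
  have noeth: "noetherian_group G" by (rule noetherian_groupI[OF assms(2) ext])
  have "id \<in> epi (G\<lparr>carrier := carrier G\<rparr>) G" by (auto simp: epi_def hom_def)
  then have "fin_index G (carrier G) (fc_center G (carrier G))"
    by (rule elementary_amenable_section_virtually_fc[OF assms(3) subgroup_self assms(1) _ noeth ext])
  then show "\<exists>A. A \<lhd> G \<and> finite (rcosets A) \<and> free_abelian (G\<lparr>carrier := A\<rparr>) \<and>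
      (\<exists>\<epsilon>\<in>hom G sign_img. \<forall>g\<in>carrier G. \<forall>a\<in>A. g \<otimes> a \<otimes> inv g = a [^] \<epsilon> g)"
    by (rule virtually_fc_imp_conj_by_sign[OF noeth ext])
next
  interpret group G by fact
  assume "\<exists>A. A \<lhd> G \<and> finite (rcosets A) \<and> free_abelian (G\<lparr>carrier := A\<rparr>) \<and>
      (\<exists>\<epsilon>\<in>hom G sign_img. \<forall>g\<in>carrier G. \<forall>a\<in>A. g \<otimes> a \<otimes> inv g = a [^] \<epsilon> g)"
  then obtain A \<epsilon> where A: "A \<lhd> G" "finite (rcosets A)" "free_abelian (G\<lparr>carrier := A\<rparr>)"
    and \<epsilon>: "\<epsilon> \<in> hom G sign_img" "\<forall>g\<in>carrier G. \<forall>a\<in>A. g \<otimes> a \<otimes> inv g = a [^] \<epsilon> g"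
    by blast
  have Asub: "subgroup A G" by (rule normal_imp_subgroup[OF A(1)])
  have "g \<otimes> a \<otimes> inv g = a \<or> g \<otimes> a \<otimes> inv g = inv a" if "g \<in> carrier G" "a \<in> A" for g a
  proof -
    have "\<epsilon> g = 1 \<or> \<epsilon> g = -1" using \<epsilon>(1) that(1) by (auto simp: hom_def sign_img_def)
    moreover have "a \<in> carrier G" using subgroup.mem_carrier[OF Asub that(2)] .
    ultimately show ?thesis using \<epsilon>(2) that by (auto simp: int_pow_neg)
  qed
  then show "\<forall>H. subgroup H G \<longrightarrow> extension_problem_solvable TYPE('r) G H"
    using conj_by_sign_imp_extension_problem_solvable[OF assms(2) A(1)]
      finite_rcosets_iff_fin_index[OF A(1)] A(2) free_abelian_subgroup_commute[OF A(3) _ _ Asub]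
    by blast
qed

end
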